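(* Let $n\in\mathbb N$, $m\in\mathbb R$, $0\le\delta\le\rho\le 1$, $\delta<1$, and let $\sigma\in BS^m_{\rho,\delta}(\mathbb R^n)$. Then for $j=1,2$ there is a symbol $\sigma^{*j}\in BS^m_{\rho,\delta}(\mathbb R^n)$ such that the $j$-th transpose of $T_\sigma$ is the bilinear pseudodifferential operator with symbol $\sigma^{*j}$, i.e. $T_\sigma^{*j}=T_{\sigma^{*j}}$.
   Context: For $m\in\mathbb R$ and $\rho,\delta\in[0,1]$, the bilinear Hörmander class $BS^m_{\rho,\delta}=BS^m_{\rho,\delta}(\mathbb R^n)$ is the set of all $C^\infty$ functions $\sigma:\mathbb R^n\times\mathbb R^n\times\mathbb R^n\to\mathbb C$ such that for all multi-indices $\alpha,\beta,\gamma$ there is a constant $C_{\alpha\beta\gamma}>0$ with $$|\partial_x^\alpha\partial_\xi^\beta\partial_\eta^\gamma\sigma(x,\xi,\eta)|\le C_{\alpha\beta\gamma}(1+|\xi|+|\eta|)^{m+\delta|\alpha|-\rho(|\beta|+|\gamma|)}\quad\text{for all }x,\xi,\eta\in\mathbb R^n.$$ The associated bilinear pseudodifferential operator is, for Schwartz functions $f,g\in\mathcal S(\mathbb R^n)$, $$T_\sigma(f,g)(x)=\int_{\mathbb R^n}\int_{\mathbb R^n}\sigma(x,\xi,\eta)\widehat f(\xi)\widehat g(\eta)e^{ix\cdot(\xi+\eta)}\,d\xi\,d\eta,$$ with the Fourier transform normalized so that $f(x)=\int\widehat f(\xi)e^{ix\cdot\xi}\,d\xi$, i.e. $\widehat f(\xi)=(2\pi)^{-n}\int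 f(x)e^{-ix\cdot\xi}dx$. The transposes $T^{*1},T^{*2}$ of a bilinear operator $T$ are defined by $$\langle T(f,g),h\rangle=\langle T^{*1}(h,g),f\rangle=\langle T^{*2}(f,h),g\rangle$$ for all $f,g,h\in\mathcal S(\mathbb R^n)$, where $\langle u,v\rangle=\int uv$ is the bilinear (no complex conjugation) pairing. *)

theory Defs
  imports "HOL-Analysis.Analysis"
begin

definition dir_deriv :: "'a::real_normed_vector \<Rightarrow> ('a \<Rightarrow> 'b::real_normed_vector) \<Rightarrow> 'a \<Rightarrow> 'b" where
  "dir_deriv v f x = vector_derivative (\<lambda>t::real. f (x + t *\<^sub>R v)) (at 0)"

primrec C_k :: "nat \<Rightarrow> ('a::euclidean_space \<Rightarrow> 'b::real_normed_vector) \<Rightarrow> bool" where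
  "C_k 0 f \<longleftrightarrow> continuous_on UNIV f"
| "C_k (Suc k) f \<longleftrightarrow> (\<forall>x. f differentiable at x) \<and> (\<forall>b\<in>Basis. C_k k (dir_deriv b f))"

definition smooth :: "('a::euclidean_space \<Rightarrow> 'b::real_normed_vector) \<Rightarrow> bool" where
  "smooth f \<longleftrightarrow> (\<forall>k. C_k k f)"

text \<open>
  A multi-index is a function \<open>\<alpha> :: 'n \<Rightarrow> nat\<close>, where \<open>'n\<close> is the index type of \<open>real ^ 'n\<close>.
  The iterated partial derivative has to be taken in some order of the coordinates; we fix an
  arbitrary one. On smooth functions the choice is irrelevant, as partial derivatives commute.
\<close>

definition coords :: "'n::finite list" where
  "coords = (SOME is. set is = UNIV \<and> distinct is)"

lemma coords: "set (coords :: 'n::finite list) = UNIV" "distinct (coords :: 'n list)"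
proof -
  have "\<exists>is :: 'n list. set is = UNIV \<and> distinct is"
    by (simp add: finite_distinct_list)
  then have "set (coords :: 'n list) = UNIV \<and> distinct (coords :: 'n list)"
    unfolding coords_def by (rule someI_ex)
  then show "set (coords :: 'n list) = UNIV" "distinct (coords :: 'n list)" by auto
qed

text \<open>
  The family \<open>e\<close> lists the coordinate directions with respect to which one differentiates; this
  allows for derivatives in only one group of variables of a function on a product space.
\<close>

definition multi_deriv ::
  "('n::finite \<Rightarrow> 'a::real_normed_vector) \<Rightarrow> ('n \<Rightarrow> nat) \<Rightarrow> ('a \<Rightarrow> 'b::real_normed_vector) \<Rightarrow> 'a \<Rightarrow> 'b" where
  "multi_deriv e \<alpha> f = foldr (\<lambda>i. dir_deriv (e i) ^^ \<alpha> i) coords f"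

definition multi_order :: "('n::finite \<Rightarrow> nat) \<Rightarrow> nat" where
  "multi_order \<alpha> = (\<Sum>i\<in>UNIV. \<alpha> i)"

type_synonym 'n bisymbol = "(real ^ 'n) \<times> (real ^ 'n) \<times> (real ^ 'n) \<Rightarrow> complex"

definition deriv_x :: "('n::finite \<Rightarrow> nat) \<Rightarrow> 'n bisymbol \<Rightarrow> 'n bisymbol" where
  "deriv_x = multi_deriv (\<lambda>i. (axis i 1, 0, 0))"

definition deriv_xi :: "('n::finite \<Rightarrow> nat) \<Rightarrow> 'n bisymbol \<Rightarrow> 'n bisymbol" where
  "deriv_xi = multi_deriv (\<lambda>i. (0, axis i 1, 0))"

definition deriv_eta :: "('n::finite \<Rightarrow> nat) \<Rightarrow> 'n bisymbol \<Rightarrow> 'n bisymbol" where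
  "deriv_eta = multi_deriv (\<lambda>i. (0, 0, axis i 1))"

definition BS :: "real \<Rightarrow> real \<Rightarrow> real \<Rightarrow> ('n::finite) bisymbol set" where
  "BS m \<rho> \<delta> = {\<sigma>. smooth \<sigma> \<and>
     (\<forall>\<alpha> \<beta> \<gamma>. \<exists>C>0. \<forall>x \<xi> \<eta>.
        norm (deriv_x \<alpha> (deriv_xi \<beta> (deriv_eta \<gamma> \<sigma>)) (x, \<xi>, \<eta>))
          \<le> C * (1 + norm \<xi> + norm \<eta>) powr
                (m + \<delta> * real (multi_order \<alpha>)
                   - \<rho> * (real (multi_order \<beta>) + real (multi_order \<gamma>))))}"

definition schwartz :: "(real ^ 'n::finite \<Rightarrow> complex) set" where
  "schwartz = {f. smooth f \<and>
     (\<forall>\<alpha> \<beta>. bounded (range (\<lambda>x.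
        (\<Prod>i\<in>UNIV. (x $ i) ^ \<alpha> i) *\<^sub>R multi_deriv (\<lambda>i. axis i 1) \<beta> f x)))}"

definition fourier :: "(real ^ 'n::finite \<Rightarrow> complex) \<Rightarrow> real ^ 'n \<Rightarrow> complex" where
  "fourier f \<xi> = (1 / (2 * pi) ^ CARD('n)) *\<^sub>R
     (LINT x|lborel. f x * exp (- \<i> * complex_of_real (x \<bullet> \<xi>)))"

type_synonym 'n bioperator =
  "(real ^ 'n \<Rightarrow> complex) \<Rightarrow> (real ^ 'n \<Rightarrow> complex) \<Rightarrow> (real ^ 'n \<Rightarrow> complex)"

definition bilinear_psido :: "('n::finite) bisymbol \<Rightarrow> 'n bioperator" where
  "bilinear_psido \<sigma> f g x =
     (LINT \<eta>|lborel. LINT \<xi>|lborel.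
        \<sigma> (x, \<xi>, \<eta>) * fourier f \<xi> * fourier g \<eta> * exp (\<i> * complex_of_real (x \<bullet> (\<xi> + \<eta>))))"

definition pairing :: "(real ^ 'n::finite \<Rightarrow> complex) \<Rightarrow> (real ^ 'n \<Rightarrow> complex) \<Rightarrow> complex" where
  "pairing u v = (LINT x|lborel. u x * v x)"

definition pairable :: "(real ^ 'n::finite \<Rightarrow> complex) \<Rightarrow> (real ^ 'n \<Rightarrow> complex) \<Rightarrow> bool" where
  "pairable u v \<longleftrightarrow> integrable lborel (\<lambda>x. u x * v x)"

text \<open>
  \<open>is_transpose1 T S\<close> and \<open>is_transpose2 T S\<close> say that \<open>S\<close> is the first, respectively second, transpose
  of \<open>T\<close>. As the Bochner integral of a non-integrable function is \<open>0\<close>, the existence of the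
  pairings is required explicitly.
\<close>

definition is_transpose1 :: "('n::finite) bioperator \<Rightarrow> 'n bioperator \<Rightarrow> bool" where
  "is_transpose1 T S \<longleftrightarrow> (\<forall>f\<in>schwartz. \<forall>g\<in>schwartz. \<forall>h\<in>schwartz.
     pairable (T f g) h \<and> pairable (S h g) f \<and> pairing (T f g) h = pairing (S h g) f)"

definition is_transpose2 :: "('n::finite) bioperator \<Rightarrow> 'n bioperator \<Rightarrow> bool" where
  "is_transpose2 T S \<longleftrightarrow> (\<forall>f\<in>schwartz. \<forall>g\<in>schwartz. \<forall>h\<in>schwartz.
     pairable (T f g) h \<and> pairable (S f h) g \<and> pairing (T f g) h = pairing (S f h) g)"

end

(*
  Formally the first transpose of T_sigma has the symbol

    sigma1(y, zeta, eta) = (2 pi)^(-n) * INT INT e^(i z.theta) sigma(y + z, theta - zeta - eta, eta) dz dtheta.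

  To give the integral a meaning, insert factors (1 + i r z_j)^(-1) (1 - r d/dtheta_j), which leave
  e^(i z.theta) invariant.  After finitely many insertions the z-integral converges absolutely and,
  by integration by parts in z, decays rapidly in theta; it is then integrated over theta.  The
  result does not depend on the scale r.  With lambda = 1 + |zeta| + |eta| and r = lambda^delta every
  insertion costs only a bounded factor where |theta| <= lambda / 4 (this uses delta <= rho), while
  for larger theta the integration by parts in z at scale (lambda + |theta|)^(-delta) gains powers
  of |theta|^(1 - delta) (this uses delta < 1), so |sigma1| <= C lambda^m.  Derivatives of sigma1 are
  integrals of the same kind with sigma replaced by its derivatives, hence sigma1 is in BS^m.  The
  transposition identity follows with Fubini's theorem and Fourier inversion, for each eta
  separately.  The second transpose is the first one with the roles of xi and eta exchanged.
*)

theory Submission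
  imports Defs "HOL-Probability.Characteristic_Functions" "HOL-Probability.Sinc_Integral"
begin

subsection \<open>Directional derivatives\<close>

text \<open>Origin of the formula: in <T(f,g),h> write h by Fourier inversion with frequency
  \<zeta>, write the transform of f as an integral over y, and put x = y + z, \<theta> = \<xi> +
  \<eta> + \<zeta>. The phase becomes e^(i z.\<theta>) e^(i y.(\<zeta> + \<eta>)), and the rest of
  the z- and \<theta>-integral is the symbol. The obstacle is a conflict about the scale r. The
  sharp bound needs r = lambda^\<delta>, which depends on p = (y, \<zeta>, \<eta>), so that
  derivatives in p would also fall on r. Hence the symbol is defined with r = 1, where p enters
  through the amplitude alone, and is estimated at each point with the r of that point. The bound
  for the value then serves derivatives of all orders, with the same number of insertions. The
  choice of r balances the costs: a z-derivative of sigma costs lambda^\<delta>, r times a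
  \<xi>-derivative costs lambda^(\<delta> - \<rho>), and the volume factors r^(-n) of the z-integral
  and r^n of the \<theta>-integral cancel. No limit of cut-offs is needed for the pairing: the
  insertions are undone in the \<xi>-integral of T_sigma itself, where the decay of f makes all
  integrals converge absolutely.\<close>

lemma has_vector_derivative_line:
  assumes "(f has_derivative f') (at (x + t *\<^sub>R v))"
  shows "((\<lambda>s. f (x + s *\<^sub>R v)) has_vector_derivative f' v) (at t)"
proof -
  have "((\<lambda>s. x + s *\<^sub>R v) has_derivative (\<lambda>s. s *\<^sub>R v)) (at t)"
    by (auto intro!: derivative_eq_intros)
  from has_derivative_compose[OF this assms]
  have "((\<lambda>s. f (x + s *\<^sub>R v)) has_derivative (\<lambda>s. f' (s *\<^sub>R v))) (at t)" .
  moreover have "f' (s *\<^sub>R v) = s *\<^sub>R f' v" for s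
    using assms by (simp add: has_derivative_def bounded_linear.linear linear_cmul)
  ultimately show ?thesis by (simp add: has_vector_derivative_def)
qed

lemma dir_deriv_eqI:
  assumes "(f has_derivative f') (at x)"
  shows "dir_deriv v f x = f' v"
  unfolding dir_deriv_def
  using has_vector_derivative_line[where t=0 and x=x and v=v and f=f and f'=f'] assms
  by (simp add: vector_derivative_at)

lemma has_derivative_dir_deriv:
  assumes "f differentiable (at x)"
  shows "(f has_derivative (\<lambda>v. dir_deriv v f x)) (at x)"
proof -
  obtain f' where f': "(f has_derivative f') (at x)"
    using assms by (auto simp: differentiable_def)
  moreover have "(\<lambda>v. dir_deriv v f x) = f'" using dir_deriv_eqI[OF f'] by auto
  ultimately show ?thesis by simp
qed

lemma dir_deriv_line:
  assumes "f differentiable (at (x + t *\<^sub>R v))"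
  shows "((\<lambda>s. f (x + s *\<^sub>R v)) has_vector_derivative dir_deriv v f (x + t *\<^sub>R v)) (at t)"
  using has_vector_derivative_line[OF has_derivative_dir_deriv[OF assms]] .

text \<open>Regularity is only recorded for the basis directions; this brings a derivative along any
  other vector, as the chain rule produces it, back to them.\<close>

lemma dir_deriv_lin:
  assumes "f differentiable (at x)"
  shows "dir_deriv v f x = (\<Sum>b\<in>Basis. (v \<bullet> b) *\<^sub>R dir_deriv b f x)"
proof -
  let ?L = "\<lambda>v. dir_deriv v f x"
  have lin: "linear ?L"
    using has_derivative_dir_deriv[OF assms] by (simp add: has_derivative_def bounded_linear.linear)
  have "?L v = ?L (\<Sum>b\<in>Basis. (v \<bullet> b) *\<^sub>R b)" by (simp add: euclidean_representation)
  also have "\<dots> = (\<Sum>b\<in>Basis. (v \<bullet> b) *\<^sub>R ?L b)"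
    by (simp add: linear_sum[OF lin] linear_cmul[OF lin])
  finally show ?thesis .
qed

lemma dir_deriv_add:
  assumes "f differentiable (at x)" "g differentiable (at x)"
  shows "dir_deriv v (\<lambda>x. f x + g x) x = dir_deriv v f x + dir_deriv v g x"
  by (rule dir_deriv_eqI) (auto intro!: derivative_intros has_derivative_dir_deriv assms)

lemma dir_deriv_diff:
  assumes "f differentiable (at x)" "g differentiable (at x)"
  shows "dir_deriv v (\<lambda>x. f x - g x) x = dir_deriv v f x - dir_deriv v g x"
  by (rule dir_deriv_eqI) (auto intro!: derivative_intros has_derivative_dir_deriv assms)

lemma dir_deriv_cmult:
  fixes c :: complex
  assumes "f differentiable (at x)"
  shows "dir_deriv v (\<lambda>x. c * f x) x = c * dir_deriv v f x"
  by (rule dir_deriv_eqI) (auto intro!: derivative_intros has_derivative_dir_deriv assms)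

lemma dir_deriv_mult:
  fixes f :: "_ \<Rightarrow> complex"
  assumes "f differentiable (at x)" "g differentiable (at x)"
  shows "dir_deriv v (\<lambda>x. f x * g x) x = f x * dir_deriv v g x + dir_deriv v f x * g x"
  by (rule dir_deriv_eqI) (auto intro!: derivative_eq_intros has_derivative_dir_deriv assms)

lemma dir_deriv_linear_comp:
  assumes "linear L"
  shows "dir_deriv v (\<lambda>x. f (c + L x)) x = dir_deriv (L v) f (c + L x)"
  by (simp add: dir_deriv_def linear_add[OF assms] linear_cmul[OF assms] add.assoc)

lemma dir_deriv_linear_comp0:
  assumes "linear L"
  shows "dir_deriv v (\<lambda>x. f (L x)) x = dir_deriv (L v) f (L x)"
  using dir_deriv_linear_comp[OF assms, of v f 0] by simp

lemma dir_deriv_const [simp]: "dir_deriv v (\<lambda>x. c) = (\<lambda>x. 0)"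
  by (rule ext, rule dir_deriv_eqI) (auto intro!: derivative_eq_intros)

text \<open>
  Write \<open>F (s, t) = F (s, 0) + \<integral>\<^sub>0\<^sup>t \<partial>\<^sub>t F (s, \<tau>) d\<tau>\<close> and differentiate,
  first in \<open>s\<close> under the integral sign, then in \<open>t\<close>.
\<close>

lemma second_derivative_commute:
  fixes F :: "real \<Rightarrow> real \<Rightarrow> complex"
  assumes Fs: "\<And>s t. ((\<lambda>s. F s t) has_vector_derivative Fs s t) (at s)"
    and Ft: "\<And>s t. ((\<lambda>t. F s t) has_vector_derivative Ft s t) (at t)"
    and Fst: "\<And>s t. ((\<lambda>t. Fs s t) has_vector_derivative Fst s t) (at t)"
    and Fts: "\<And>s t. ((\<lambda>s. Ft s t) has_vector_derivative Fts s t) (at s)"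
    and cont: "continuous_on UNIV (\<lambda>(s, t). Fts s t)" "continuous_on UNIV (\<lambda>(s, t). Ft s t)"
  shows "Fst 0 0 = Fts 0 0"
proof -
  have contFt: "continuous_on A (Ft s)" for s A
  proof -
    have "continuous_on A (\<lambda>t. (s, t))" by (intro continuous_intros)
    from continuous_on_compose2[OF cont(2) this] show ?thesis by simp
  qed
  have contFts: "continuous_on A (Fts s)" for s A
  proof -
    have "continuous_on A (\<lambda>t. (s, t))" by (intro continuous_intros)
    from continuous_on_compose2[OF cont(1) this] show ?thesis by simp
  qed
  \<comment> \<open>The integral starts at -1 instead of 0, so that 0 is an interior point of the
    interval \<open>{-1..1}\<close> on which the derivatives are compared.\<close>
  have F_eq: "F s t = F s (-1) + integral (cbox (-1) t) (Ft s)" if "t \<ge> -1" for s t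
  proof -
    have "(Ft s has_integral (F s t - F s (-1))) {-1..t}"
      by (rule fundamental_theorem_of_calculus[OF that])
        (auto intro: has_vector_derivative_at_within Ft)
    then show ?thesis by (simp add: integral_unique)
  qed
  have lb: "((\<lambda>s. integral (cbox (-1) t) (Ft s)) has_vector_derivative
         integral (cbox (-1) t) (Fts 0)) (at 0 within {-1..1})" for t
  proof (rule leibniz_rule_vector_derivative)
    show "((\<lambda>x. Ft x \<tau>) has_vector_derivative Fts s \<tau>) (at s within {-1..1})" for s \<tau>
      by (rule has_vector_derivative_at_within[OF Fts])
    show "Ft s integrable_on cbox (-1) t" for s
      by (rule integrable_continuous) (rule contFt)
    show "continuous_on ({-1..1} \<times> cbox (-1) t) (\<lambda>(x, t). Fts x t)"
      by (rule continuous_on_subset[OF cont(1)]) auto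
  qed simp_all
  have Fs_eq: "Fs 0 t = Fs 0 (-1) + integral {-1..t} (Fts 0)" if "t \<ge> -1" for t
  proof -
    have "((\<lambda>s. F s (-1) + integral (cbox (-1) t) (Ft s)) has_vector_derivative
         Fs 0 (-1) + integral (cbox (-1) t) (Fts 0)) (at 0 within {-1..1})"
      by (intro has_vector_derivative_add has_vector_derivative_at_within[OF Fs] lb)
    then have 1: "((\<lambda>s. F s t) has_vector_derivative
         Fs 0 (-1) + integral (cbox (-1) t) (Fts 0)) (at 0 within {-1..1})"
      using F_eq[OF that] by simp
    have 2: "((\<lambda>s. F s t) has_vector_derivative Fs 0 t) (at 0 within {-1..1})"
      by (rule has_vector_derivative_at_within[OF Fs])
    show ?thesis
      using vector_derivative_unique_within[OF _ 1 2] by (simp add: trivial_limit_within islimpt_Icc)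
  qed
  have "((\<lambda>t. integral {-1..t} (Fts 0)) has_vector_derivative Fts 0 0) (at 0 within {-1..1})"
    by (rule integral_has_vector_derivative) (auto intro: contFts)
  then have "((\<lambda>t. Fs 0 (-1) + integral {-1..t} (Fts 0)) has_vector_derivative 0 + Fts 0 0) (at 0 within {-1..1})"
    by (intro has_vector_derivative_add has_vector_derivative_const)
  then have 1: "((\<lambda>t. Fs 0 t) has_vector_derivative Fts 0 0) (at 0 within {-1..1})"
  proof -
    have *: "Fs 0 t = Fs 0 (-1) + integral {-1..t} (Fts 0)" if "t \<in> {-1..1}" for t
      by (rule Fs_eq) (use that in simp)
    show ?thesis
      by (rule has_vector_derivative_transform[OF _ *]) (use \<open>(_ has_vector_derivative 0 + Fts 0 0) _\<close> in auto)
  qed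
  have 2: "((\<lambda>t. Fs 0 t) has_vector_derivative Fst 0 0) (at 0 within {-1..1})"
    by (rule has_vector_derivative_at_within[OF Fst])
  show ?thesis
    using vector_derivative_unique_within[OF _ 1 2] by (simp add: trivial_limit_within islimpt_Icc)
qed

text \<open>Restriction to the plane of the points x + s u + t v reduces the claim to two real
  variables. Continuity of one of the two mixed derivatives is enough.\<close>

lemma dir_deriv_commute:
  fixes f :: "'a::real_normed_vector \<Rightarrow> complex"
  assumes d: "\<And>x. f differentiable (at x)" "\<And>x. dir_deriv u f differentiable (at x)"
      "\<And>x. dir_deriv v f differentiable (at x)"
    and c: "continuous_on UNIV (dir_deriv u (dir_deriv v f))"
  shows "dir_deriv u (dir_deriv v f) x = dir_deriv v (dir_deriv u f) x"
proof -
  define F where "F = (\<lambda>s t. f (x + s *\<^sub>R u + t *\<^sub>R v))"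
  have ss: "((\<lambda>s. g (x + s *\<^sub>R u + t *\<^sub>R v)) has_vector_derivative dir_deriv u g (x + s *\<^sub>R u + t *\<^sub>R v)) (at s)"
    if "\<And>x. g differentiable (at x)" for g :: "'a \<Rightarrow> complex" and s t
    using dir_deriv_line[of g "x + t *\<^sub>R v" s u] that by (simp add: algebra_simps)
  have tt: "((\<lambda>t. g (x + s *\<^sub>R u + t *\<^sub>R v)) has_vector_derivative dir_deriv v g (x + s *\<^sub>R u + t *\<^sub>R v)) (at t)"
    if "\<And>x. g differentiable (at x)" for g :: "'a \<Rightarrow> complex" and s t
    using dir_deriv_line[of g "x + s *\<^sub>R u" t v] that by (simp add: algebra_simps)
  have "continuous_on UNIV (dir_deriv v f)"
    using d(3) by (simp add: continuous_at_imp_continuous_on differentiable_imp_continuous_within)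
  then have c2: "continuous_on UNIV (\<lambda>(s, t). dir_deriv v f (x + s *\<^sub>R u + t *\<^sub>R v))"
    unfolding case_prod_unfold by (rule continuous_on_compose2) (auto intro!: continuous_intros)
  have c1: "continuous_on UNIV (\<lambda>(s, t). dir_deriv u (dir_deriv v f) (x + s *\<^sub>R u + t *\<^sub>R v))"
    using c unfolding case_prod_unfold by (rule continuous_on_compose2) (auto intro!: continuous_intros)
  from second_derivative_commute[OF ss[OF d(1)] tt[OF d(1)] tt[OF d(2)] ss[OF d(3)] c1 c2]
  show ?thesis by simp
qed

subsection \<open>Functions with weighted bounds on all derivatives\<close>

text \<open>
  \<open>W a\<close> is the weight that belongs to the order \<open>a\<close>, and a derivative in the direction \<open>b\<close> changes the
  order by \<open>dg b\<close>. One scheme thus covers symbols as well as decaying functions, where \<open>dg = 0\<close>.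
\<close>

primrec weighted_Ck :: "(real \<Rightarrow> 'a \<Rightarrow> real) \<Rightarrow> ('a \<Rightarrow> real) \<Rightarrow> nat \<Rightarrow> real \<Rightarrow> ('a::euclidean_space \<Rightarrow> complex) \<Rightarrow> bool" where
  "weighted_Ck W dg 0 a f \<longleftrightarrow> continuous_on UNIV f \<and> (\<exists>C. \<forall>x. norm (f x) \<le> C * W a x)"
| "weighted_Ck W dg (Suc k) a f \<longleftrightarrow> (\<exists>C. \<forall>x. norm (f x) \<le> C * W a x) \<and> (\<forall>x. f differentiable (at x)) \<and>
     (\<forall>b\<in>Basis. weighted_Ck W dg k (a + dg b) (dir_deriv b f))"

definition weighted_smooth :: "(real \<Rightarrow> 'a \<Rightarrow> real) \<Rightarrow> ('a \<Rightarrow> real) \<Rightarrow> real \<Rightarrow> ('a::euclidean_space \<Rightarrow> complex) \<Rightarrow> bool" where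
  "weighted_smooth W dg a f \<longleftrightarrow> (\<forall>k. weighted_Ck W dg k a f)"

lemma weighted_Ck_bound: "weighted_Ck W dg k a f \<Longrightarrow> \<exists>C. \<forall>x. norm (f x) \<le> C * W a x"
  by (cases k) auto

lemma continuous_if_differentiable:
  "(\<And>x. f differentiable (at x)) \<Longrightarrow> continuous_on UNIV f"
  by (simp add: continuous_at_imp_continuous_on differentiable_imp_continuous_within)

lemma weighted_Ck_continuous: "weighted_Ck W dg k a f \<Longrightarrow> continuous_on UNIV f"
  by (cases k) (auto intro: continuous_if_differentiable)

lemma weighted_Ck_SucD: "weighted_Ck W dg (Suc k) a f \<Longrightarrow> weighted_Ck W dg k a f"
proof (induction k arbitrary: a f)
  case 0 then show ?case by (auto intro: continuous_if_differentiable)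
next
  case (Suc k)
  then have "weighted_Ck W dg k (a + dg b) (dir_deriv b f)" if "b \<in> Basis" for b
    using that by (metis weighted_Ck.simps(2))
  then show ?case using Suc.prems by simp
qed

lemma weighted_Ck_C_k: "weighted_Ck W dg k a f \<Longrightarrow> C_k k f"
  by (induction k arbitrary: a f) auto

lemma weighted_smooth_smooth: "weighted_smooth W dg a f \<Longrightarrow> smooth f"
  unfolding weighted_smooth_def smooth_def using weighted_Ck_C_k by blast

lemma weighted_smooth_bound: "weighted_smooth W dg a f \<Longrightarrow> \<exists>C. \<forall>x. norm (f x) \<le> C * W a x"
  unfolding weighted_smooth_def using weighted_Ck_bound by blast

lemma weighted_smooth_continuous: "weighted_smooth W dg a f \<Longrightarrow> continuous_on UNIV f"
  unfolding weighted_smooth_def using weighted_Ck_continuous by blast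

lemma weighted_smooth_differentiable: "weighted_smooth W dg a f \<Longrightarrow> f differentiable (at x)"
  unfolding weighted_smooth_def using weighted_Ck.simps(2) by blast

lemma weighted_smooth_dir_deriv: "weighted_smooth W dg a f \<Longrightarrow> b \<in> Basis \<Longrightarrow> weighted_smooth W dg (a + dg b) (dir_deriv b f)"
  unfolding weighted_smooth_def using weighted_Ck.simps(2) by blast

text \<open>A shift of the order by \<open>c\<close> is compatible with the change of order under
  differentiation. With \<open>c = 0\<close> it weakens a rate of decay, with
  \<open>c = b - a\<close> it embeds a symbol class into one of higher order.\<close>

lemma weighted_Ck_weaken:
  assumes W: "\<And>a x. 0 \<le> W a x" and le: "\<And>a x. W a x \<le> W' (a + c) x"
  shows "weighted_Ck W dg k a f \<Longrightarrow> weighted_Ck W' dg k (a + c) f"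
proof (induction k arbitrary: a f)
  have *: "\<exists>C. \<forall>x. norm (f x) \<le> C * W' (a + c) x" if "\<exists>C. \<forall>x. norm (f x) \<le> C * W a x" for a and f :: "'a \<Rightarrow> complex"
  proof -
    from that obtain C where C: "norm (f x) \<le> C * W a x" for x by blast
    have "norm (f x) \<le> \<bar>C\<bar> * W' (a + c) x" for x
    proof -
      have "C * W a x \<le> \<bar>C\<bar> * W a x" using W by (intro mult_right_mono) auto
      also have "\<dots> \<le> \<bar>C\<bar> * W' (a + c) x" using le by (intro mult_left_mono) auto
      finally show ?thesis using C[of x] by linarith
    qed
    then show ?thesis by blast
  qed
  { case 0 then show ?case using * by simp }
  { case (Suc k)
    have "weighted_Ck W' dg k (a + c + dg b) (dir_deriv b f)" if "b \<in> Basis" for b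
    proof -
      have "weighted_Ck W' dg k (a + dg b + c) (dir_deriv b f)"
        using Suc that by (intro Suc.IH) simp
      then show ?thesis by (simp add: ac_simps)
    qed
    then show ?case using * Suc.prems by simp }
qed

lemma weighted_smooth_weaken:
  assumes "\<And>a x. 0 \<le> W a x" "\<And>a x. W a x \<le> W' (a + c) x" "weighted_smooth W dg a f"
  shows "weighted_smooth W' dg (a + c) f"
  using weighted_Ck_weaken[of W W' c] assms unfolding weighted_smooth_def by blast

section \<open>Sums, multiples and products under weighted bounds\<close>

lemma dir_deriv_add': "(\<And>x. f differentiable (at x)) \<Longrightarrow> (\<And>x. g differentiable (at x)) \<Longrightarrow>
    dir_deriv v (\<lambda>x. f x + g x) = (\<lambda>x. dir_deriv v f x + dir_deriv v g x)"
  by (rule ext) (rule dir_deriv_add)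

lemma dir_deriv_diff': "(\<And>x. f differentiable (at x)) \<Longrightarrow> (\<And>x. g differentiable (at x)) \<Longrightarrow>
    dir_deriv v (\<lambda>x. f x - g x) = (\<lambda>x. dir_deriv v f x - dir_deriv v g x)"
  by (rule ext) (rule dir_deriv_diff)

lemma dir_deriv_mult':
  fixes f :: "_ \<Rightarrow> complex"
  shows "(\<And>x. f differentiable (at x)) \<Longrightarrow> (\<And>x. g differentiable (at x)) \<Longrightarrow>
    dir_deriv v (\<lambda>x. f x * g x) = (\<lambda>x. f x * dir_deriv v g x + dir_deriv v f x * g x)"
  by (rule ext) (rule dir_deriv_mult)

lemma dir_deriv_cmult':
  fixes f :: "_ \<Rightarrow> complex"
  shows "(\<And>x. f differentiable (at x)) \<Longrightarrow> dir_deriv v (\<lambda>x. c * f x) = (\<lambda>x. c * dir_deriv v f x)"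
  by (rule ext) (rule dir_deriv_cmult)

lemma weighted_Ck_add:
  "weighted_Ck W dg k a f \<Longrightarrow> weighted_Ck W dg k a g \<Longrightarrow> weighted_Ck W dg k a (\<lambda>x. f x + g x)"
proof (induction k arbitrary: a f g)
  have *: "\<exists>C. \<forall>x. norm (f x + g x) \<le> C * W a x"
    if "\<exists>C. \<forall>x. norm (f x) \<le> C * W a x" "\<exists>C. \<forall>x. norm (g x) \<le> C * W a x" for a and f g :: "'a \<Rightarrow> complex"
  proof -
    from that obtain C D where "norm (f x) \<le> C * W a x" "norm (g x) \<le> D * W a x" for x by blast
    then have "norm (f x + g x) \<le> (C + D) * W a x" for x
      by (metis add_mono distrib_right norm_triangle_le)
    then show ?thesis by blast
  qed
  { case 0 then show ?case using * by (auto intro!: continuous_intros) }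
  { case (Suc k) then show ?case using * by (simp add: dir_deriv_add' differentiable_add) }
qed

lemma weighted_Ck_cmult:
  "weighted_Ck W dg k a f \<Longrightarrow> weighted_Ck W dg k a (\<lambda>x. c * f x)"
proof (induction k arbitrary: a f)
  have *: "\<exists>C. \<forall>x. norm (c * f x) \<le> C * W a x"
    if "\<exists>C. \<forall>x. norm (f x) \<le> C * W a x" for a and f :: "'a \<Rightarrow> complex"
  proof -
    from that obtain C where "norm (f x) \<le> C * W a x" for x by blast
    then have "norm (c * f x) \<le> (norm c * C) * W a x" for x
      by (metis mult.assoc mult_left_mono norm_ge_zero norm_mult)
    then show ?thesis by blast
  qed
  { case 0 then show ?case using * by (auto intro!: continuous_intros) }
  { case (Suc k) then show ?case using * by (simp add: dir_deriv_cmult' differentiable_mult) }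
qed

lemma weighted_Ck_zero: "(\<And>a x. 0 \<le> W a x) \<Longrightarrow> weighted_Ck W dg k a (\<lambda>x. 0)"
proof (induction k arbitrary: a)
  case 0 then show ?case by (auto intro: exI[of _ 0])
next
  case (Suc k) then show ?case by (auto intro: exI[of _ 0])
qed

lemma weighted_Ck_sum:
  assumes "\<And>a x. 0 \<le> W a x" "\<And>i. i \<in> I \<Longrightarrow> weighted_Ck W dg k a (f i)"
  shows "weighted_Ck W dg k a (\<lambda>x. \<Sum>i\<in>I. f i x)"
  using assms(2)
  by (induction I rule: infinite_finite_induct) (auto intro!: weighted_Ck_zero weighted_Ck_add assms(1))

text \<open>Both terms of the product rule have the same total order, so a single induction on
  \<open>k\<close> closes as soon as the weights are submultiplicative in the sense of the third
  assumption.\<close>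

lemma weighted_Ck_mult:
  assumes W: "\<And>a x. 0 \<le> W a x" "\<And>a x. 0 \<le> W' a x" "\<And>a b x. W a x * W' b x \<le> W'' (a + b) x"
  shows "weighted_Ck W dg k a f \<Longrightarrow> weighted_Ck W' dg k b g \<Longrightarrow> weighted_Ck W'' dg k (a + b) (\<lambda>x. f x * g x)"
proof (induction k arbitrary: a b f g)
  have *: "\<exists>C. \<forall>x. norm (f x * g x) \<le> C * W'' (a + b) x"
    if "\<exists>C. \<forall>x. norm (f x) \<le> C * W a x" "\<exists>C. \<forall>x. norm (g x) \<le> C * W' b x" for a b and f g :: "'a \<Rightarrow> complex"
  proof -
    from that obtain C D where CD: "norm (f x) \<le> C * W a x" "norm (g x) \<le> D * W' b x" for x by blast
    have "norm (f x * g x) \<le> \<bar>C * D\<bar> * W'' (a + b) x" for x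
    proof -
      have 1: "0 \<le> C * W a x" "0 \<le> D * W' b x"
        using CD[of x] norm_ge_zero order_trans by blast+
      have "norm (f x * g x) \<le> (C * W a x) * (D * W' b x)"
        unfolding norm_mult using CD 1 by (intro mult_mono) auto
      also have "\<dots> = (C * D) * (W a x * W' b x)" by simp
      also have "\<dots> \<le> \<bar>C * D\<bar> * (W a x * W' b x)" using W by (intro mult_right_mono) auto
      also have "\<dots> \<le> \<bar>C * D\<bar> * W'' (a + b) x" using W by (intro mult_left_mono) auto
      finally show ?thesis .
    qed
    then show ?thesis by blast
  qed
  { case 0 then show ?case using * by (auto intro!: continuous_intros) }
  { case (Suc k)
    have d: "f differentiable (at x)" "g differentiable (at x)" for x using Suc.prems by auto
    have "weighted_Ck W'' dg k (a + b + dg v) (\<lambda>x. f x * dir_deriv v g x + dir_deriv v f x * g x)" if v: "v \<in> Basis" for v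
    proof (rule weighted_Ck_add)
      have "weighted_Ck W'' dg k (a + (b + dg v)) (\<lambda>x. f x * dir_deriv v g x)"
        using weighted_Ck_SucD[OF Suc.prems(1)] Suc.prems(2) v by (intro Suc.IH) auto
      then show "weighted_Ck W'' dg k (a + b + dg v) (\<lambda>x. f x * dir_deriv v g x)" by (simp add: ac_simps)
      have "weighted_Ck W'' dg k ((a + dg v) + b) (\<lambda>x. dir_deriv v f x * g x)"
        using Suc.prems(1) weighted_Ck_SucD[OF Suc.prems(2)] v by (intro Suc.IH) auto
      then show "weighted_Ck W'' dg k (a + b + dg v) (\<lambda>x. dir_deriv v f x * g x)" by (simp add: ac_simps)
    qed
    moreover have "\<exists>C. \<forall>x. norm (f x * g x) \<le> C * W'' (a + b) x"
      by (rule *) (use Suc.prems in auto)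
    ultimately show ?case using d by (simp add: dir_deriv_mult' differentiable_mult) }
qed

lemma weighted_smooth_add: "weighted_smooth W dg a f \<Longrightarrow> weighted_smooth W dg a g \<Longrightarrow> weighted_smooth W dg a (\<lambda>x. f x + g x)"
  unfolding weighted_smooth_def using weighted_Ck_add by blast

lemma weighted_smooth_cmult: "weighted_smooth W dg a f \<Longrightarrow> weighted_smooth W dg a (\<lambda>x. c * f x)"
  unfolding weighted_smooth_def using weighted_Ck_cmult by blast

lemma weighted_smooth_diff: "weighted_smooth W dg a f \<Longrightarrow> weighted_smooth W dg a g \<Longrightarrow> weighted_smooth W dg a (\<lambda>x. f x - g x)"
  using weighted_smooth_add[of W dg a f "\<lambda>x. (-1) * g x"] weighted_smooth_cmult[of W dg a g "-1"] by simp

lemma weighted_smooth_mult: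
  assumes "\<And>a x. 0 \<le> W a x" "\<And>a x. 0 \<le> W' a x" "\<And>a b x. W a x * W' b x \<le> W'' (a + b) x"
    and "weighted_smooth W dg a f" "weighted_smooth W' dg b g"
  shows "weighted_smooth W'' dg (a + b) (\<lambda>x. f x * g x)"
  using weighted_Ck_mult[of W W' W''] assms unfolding weighted_smooth_def by blast

lemma dir_deriv_scaleR:
  assumes "f differentiable (at x)"
  shows "dir_deriv (t *\<^sub>R v) f x = t *\<^sub>R dir_deriv v f x"
  by (rule linear_cmul[OF has_derivative_linear[OF has_derivative_dir_deriv[OF assms]]])

lemma dir_deriv_zero [simp]: "dir_deriv 0 f x = 0"
  by (simp add: dir_deriv_def)

text \<open>Only the orders in \<open>A\<close> can arise from the initial order by differentiation.\<close>

lemma weighted_Ck_affine: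
  fixes L :: "'a::euclidean_space \<Rightarrow> 'b::euclidean_space"
  assumes L: "linear L" and W: "\<And>a x. 0 \<le> W a x" "\<And>a x. 0 \<le> W' a x"
    and K: "\<And>a. a \<in> A \<Longrightarrow> \<exists>K\<ge>0. \<forall>x. W a (c + L x) \<le> K * W' a x"
    and A: "\<And>a b. a \<in> A \<Longrightarrow> b \<in> Basis \<Longrightarrow> a + dg' b \<in> A"
    and B: "\<And>b. b \<in> Basis \<Longrightarrow> L b = 0 \<or> (\<exists>t b'. b' \<in> Basis \<and> L b = t *\<^sub>R b' \<and> dg b' = dg' b)"
  shows "weighted_Ck W dg k a f \<Longrightarrow> a \<in> A \<Longrightarrow> weighted_Ck W' dg' k a (\<lambda>x. f (c + L x))"
proof (induction k arbitrary: a f)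
  have bd: "\<exists>C. \<forall>x. norm (f (c + L x)) \<le> C * W' a x" if "\<exists>C. \<forall>x. norm (f x) \<le> C * W a x" "a \<in> A" for a and f :: "'b \<Rightarrow> complex"
  proof -
    from that obtain C where C: "norm (f x) \<le> C * W a x" for x by blast
    from K[OF that(2)] obtain K where K: "0 \<le> K" "\<And>x. W a (c + L x) \<le> K * W' a x" by blast
    have "norm (f (c + L x)) \<le> (\<bar>C\<bar> * K) * W' a x" for x
    proof -
      have "norm (f (c + L x)) \<le> \<bar>C\<bar> * W a (c + L x)"
        by (rule order_trans[OF C mult_right_mono[OF abs_ge_self W(1)]])
      also have "\<dots> \<le> \<bar>C\<bar> * (K * W' a x)" by (intro mult_left_mono K) simp
      finally show ?thesis by (simp add: mult.assoc)
    qed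
    then show ?thesis by blast
  qed
  {
    case 0
    have "continuous_on UNIV (\<lambda>x. c + L x)"
      using linear_continuous_on[of L UNIV] L by (auto intro!: continuous_intros simp: linear_conv_bounded_linear)
    then have "continuous_on UNIV (\<lambda>x. f (c + L x))"
      using 0 by (auto intro: continuous_on_compose2)
    then show ?case using bd 0 by simp
  next
    case (Suc k)
    have df: "f differentiable (at x)" for x using Suc.prems by simp
    have "(\<lambda>x. c + L x) differentiable (at x)" for x
      by (intro differentiable_add differentiable_const linear_imp_differentiable L)
    from differentiable_chain_at[OF this df] have d: "(\<lambda>x. f (c + L x)) differentiable (at x)" for x by (simp add: comp_def)
    have "weighted_Ck W' dg' k (a + dg' b) (dir_deriv b (\<lambda>x. f (c + L x)))" if b: "b \<in> Basis" for b
    proof (cases "L b = 0")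
      case True
      then have "dir_deriv b (\<lambda>x. f (c + L x)) = (\<lambda>x. 0)"
        by (simp add: fun_eq_iff dir_deriv_linear_comp[OF L])
      then show ?thesis by (simp add: weighted_Ck_zero W)
    next
      case False
      then obtain t b' where t: "b' \<in> Basis" "L b = t *\<^sub>R b'" "dg b' = dg' b" using B[OF b] by blast
      have "dir_deriv b (\<lambda>x. f (c + L x)) = (\<lambda>x. of_real t * dir_deriv b' f (c + L x))"
        by (simp add: fun_eq_iff dir_deriv_linear_comp[OF L] t(2) dir_deriv_scaleR[OF df] scaleR_conv_of_real)
      moreover have "weighted_Ck W' dg' k (a + dg' b) (\<lambda>x. dir_deriv b' f (c + L x))"
        using Suc.prems t by (intro Suc.IH A[OF _ b]) auto
      ultimately show ?thesis by (simp add: weighted_Ck_cmult)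
    qed
    then show ?case using bd Suc.prems d by simp
  }
qed

lemma weighted_smooth_affine:
  fixes L :: "'a::euclidean_space \<Rightarrow> 'b::euclidean_space"
  assumes "linear L" "\<And>a x. 0 \<le> W a x" "\<And>a x. 0 \<le> W' a x"
    and "\<And>a. a \<in> A \<Longrightarrow> \<exists>K\<ge>0. \<forall>x. W a (c + L x) \<le> K * W' a x"
    and "\<And>a b. a \<in> A \<Longrightarrow> b \<in> Basis \<Longrightarrow> a + dg' b \<in> A"
    and "\<And>b. b \<in> Basis \<Longrightarrow> L b = 0 \<or> (\<exists>t b'. b' \<in> Basis \<and> L b = t *\<^sub>R b' \<and> dg b' = dg' b)"
    and "weighted_smooth W dg a f" "a \<in> A"
  shows "weighted_smooth W' dg' a (\<lambda>x. f (c + L x))"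
  using weighted_Ck_affine[of L W W' A c dg' dg] assms unfolding weighted_smooth_def by blast

lemma smooth_differentiable: "smooth f \<Longrightarrow> f differentiable (at x)"
  unfolding smooth_def using C_k.simps(2) by blast

lemma smooth_dir_deriv: "smooth f \<Longrightarrow> b \<in> Basis \<Longrightarrow> smooth (dir_deriv b f)"
  unfolding smooth_def using C_k.simps(2) by blast

lemma smooth_continuous: "smooth f \<Longrightarrow> continuous_on UNIV f"
  using smooth_def C_k.simps(1) by blast

lemma smooth_dir_deriv_commute:
  fixes f :: "'a::euclidean_space \<Rightarrow> complex"
  assumes "smooth f" "u \<in> Basis" "v \<in> Basis"
  shows "dir_deriv u (dir_deriv v f) = dir_deriv v (dir_deriv u f)"
  using assms
  by (intro ext dir_deriv_commute) (auto intro!: smooth_differentiable smooth_dir_deriv smooth_continuous)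

subsection \<open>Iterated derivatives\<close>

definition dir_derivs :: "'a::real_normed_vector list \<Rightarrow> ('a \<Rightarrow> complex) \<Rightarrow> 'a \<Rightarrow> complex" where
  "dir_derivs vs f = foldr dir_deriv vs f"

lemma dir_derivs_simps [simp]: "dir_derivs [] f = f" "dir_derivs (v # vs) f = dir_deriv v (dir_derivs vs f)"
  "dir_derivs (vs @ ws) f = dir_derivs vs (dir_derivs ws f)"
  by (simp_all add: dir_derivs_def)

lemma smooth_dir_derivs: "smooth f \<Longrightarrow> set vs \<subseteq> Basis \<Longrightarrow> smooth (dir_derivs vs f)"
  by (induction vs) (auto intro: smooth_dir_deriv)

lemma dir_derivs_move:
  "smooth f \<Longrightarrow> set vs \<subseteq> Basis \<Longrightarrow> v \<in> Basis \<Longrightarrow> dir_derivs vs (dir_deriv v f) = dir_deriv v (dir_derivs vs f)"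
  by (induction vs) (auto simp: smooth_dir_deriv_commute smooth_dir_derivs)

text \<open>For a smooth function only the multiset of directions counts. This mediates between the
  arbitrary order in which the inductive scheme differentiates and the fixed order in
  \<open>multi_deriv\<close>.\<close>

lemma dir_derivs_perm:
  assumes "smooth f" "set vs \<subseteq> Basis" "mset vs = mset ws"
  shows "dir_derivs vs f = dir_derivs ws f"
  using assms(2,3)
proof (induction vs arbitrary: ws)
  case (Cons v vs)
  then obtain as bs where ws: "ws = as @ v # bs"
    by (metis list.set_intros(1) mset_eq_setD split_list)
  then have m: "mset vs = mset (as @ bs)" using Cons.prems by simp
  have sub: "set as \<subseteq> Basis" "set bs \<subseteq> Basis"
    using Cons.prems mset_eq_setD[OF Cons.prems(2)] ws by auto
  have "dir_derivs (v # vs) f = dir_deriv v (dir_derivs as (dir_derivs bs f))"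
    using Cons.IH[OF _ m] Cons.prems by simp
  also have "\<dots> = dir_derivs ws f"
    using Cons.prems sub assms(1) by (simp add: ws dir_derivs_move smooth_dir_derivs)
  finally show ?case .
qed simp

definition dir_list :: "('n::finite \<Rightarrow> 'a) \<Rightarrow> ('n \<Rightarrow> nat) \<Rightarrow> 'a list" where
  "dir_list e \<alpha> = concat (map (\<lambda>i. replicate (\<alpha> i) (e i)) coords)"

lemma multi_deriv_dir_list:
  fixes f :: "'b::real_normed_vector \<Rightarrow> complex"
  shows "multi_deriv e \<alpha> f = dir_derivs (dir_list e \<alpha>) f"
proof -
  have rep: "dir_derivs (replicate k v) f = (dir_deriv v ^^ k) f" for k v and f :: "'b::real_normed_vector \<Rightarrow> complex"
    by (induction k) auto
  have "foldr (\<lambda>i. dir_deriv (e i) ^^ \<alpha> i) is f = dir_derivs (concat (map (\<lambda>i. replicate (\<alpha> i) (e i)) is)) f" for "is"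
    by (induction "is") (auto simp: rep)
  then show ?thesis by (simp add: multi_deriv_def dir_list_def)
qed

lemma sum_list_coords: "sum_list (map g coords) = (\<Sum>i\<in>UNIV. g i)"
  using sum_list_distinct_conv_sum_set[OF coords(2), of g] by (simp add: coords(1))

lemma length_dir_list: "length (dir_list e \<alpha>) = multi_order \<alpha>"
  by (simp add: dir_list_def length_concat comp_def sum_list_coords multi_order_def)

lemma set_dir_list: "set (dir_list e \<alpha>) \<subseteq> range e"
  by (auto simp: dir_list_def)

text \<open>Up to order, every list of coordinate directions comes from a multi-index: count how
  often each direction occurs. Injectivity of \<open>e\<close> keeps the counts of different indices
  apart.\<close>

lemma mset_dir_list:
  assumes "inj e" "set vs \<subseteq> range e"
  shows "mset (dir_list e (\<lambda>i. count (mset vs) (e i))) = mset vs"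
proof (rule multiset_eqI)
  fix w
  have "count (mset (dir_list e (\<lambda>i. count (mset vs) (e i)))) w =
      sum_list (map (\<lambda>i. if e i = w then count (mset vs) (e i) else 0) is)"
    if "is = coords" for "is"
    unfolding dir_list_def that[symmetric] by (induction "is") (auto simp: mset_replicate)
  then have *: "count (mset (dir_list e (\<lambda>i. count (mset vs) (e i)))) w =
      (\<Sum>i\<in>UNIV. if e i = w then count (mset vs) (e i) else 0)"
    by (simp add: sum_list_coords)
  show "count (mset (dir_list e (\<lambda>i. count (mset vs) (e i)))) w = count (mset vs) w"
  proof (cases "w \<in> range e")
    case True
    then obtain k where k: "w = e k" by blast
    have "(\<Sum>i\<in>UNIV. if e i = w then count (mset vs) (e i) else 0) =
       (\<Sum>i\<in>UNIV. if i = k then count (mset vs) w else 0)"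
      using assms(1) k by (intro sum.cong) (auto dest: injD)
    then show ?thesis using * by simp
  next
    case False
    then have "count (mset vs) w = 0" using assms(2) by (auto simp: count_eq_zero_iff)
    moreover have "(\<Sum>i\<in>UNIV. if e i = w then count (mset vs) (e i) else 0) = 0"
      using False by (intro sum.neutral) auto
    ultimately show ?thesis using * by metis
  qed
qed

lemma weighted_smooth_dir_derivs:
  "weighted_smooth W dg a f \<Longrightarrow> set vs \<subseteq> Basis \<Longrightarrow> weighted_smooth W dg (a + sum_list (map dg vs)) (dir_derivs vs f)"
proof (induction vs)
  case (Cons v vs)
  then have "weighted_smooth W dg (a + sum_list (map dg vs) + dg v) (dir_deriv v (dir_derivs vs f))"
    by (intro weighted_smooth_dir_deriv) auto
  then show ?case by (simp add: ac_simps)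
qed simp

lemma weighted_smooth_if_dir_derivs_bounds:
  assumes "smooth f"
    and "\<And>vs. set vs \<subseteq> Basis \<Longrightarrow> \<exists>C. \<forall>x. norm (dir_derivs vs f x) \<le> C * W (a + sum_list (map dg vs)) x"
  shows "weighted_smooth W dg a f"
proof -
  have "weighted_Ck W dg k a f" for k
    using assms
  proof (induction k arbitrary: a f)
    case 0
    then show ?case using "0.prems"(2)[of "[]"] by (simp add: smooth_continuous)
  next
    case (Suc k)
    have "weighted_Ck W dg k (a + dg b) (dir_deriv b f)" if b: "b \<in> Basis" for b
    proof (rule Suc.IH)
      fix vs :: "'a list" assume "set vs \<subseteq> Basis"
      then show "\<exists>C. \<forall>x. norm (dir_derivs vs (dir_deriv b f) x) \<le> C * W (a + dg b + sum_list (map dg vs)) x"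
        using Suc.prems(2)[of "vs @ [b]"] b by (simp add: ac_simps)
    qed (use Suc b in \<open>auto intro: smooth_dir_deriv\<close>)
    then show ?case using Suc.prems(1) Suc.prems(2)[of "[]"] by (simp add: smooth_differentiable)
  qed
  then show ?thesis by (simp add: weighted_smooth_def)
qed

subsection \<open>Symbols\<close>

type_synonym 'n point = "(real ^ 'n) \<times> (real ^ 'n) \<times> (real ^ 'n)"

definition japanese :: "real ^ 'n::finite \<Rightarrow> real ^ 'n \<Rightarrow> real" where
  "japanese \<xi> \<eta> = 1 + norm \<xi> + norm \<eta>"

lemma japanese_ge_1: "1 \<le> japanese \<xi> \<eta>" and japanese_pos: "0 < japanese \<xi> \<eta>"
  using norm_ge_zero[of \<xi>] norm_ge_zero[of \<eta>] by (simp_all add: japanese_def add_pos_nonneg)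

definition symbol_weight :: "real \<Rightarrow> ('n::finite) point \<Rightarrow> real" where
  "symbol_weight a q = japanese (fst (snd q)) (snd (snd q)) powr a"

text \<open>Only used for basis vectors, where \<open>fst v \<noteq> 0\<close> singles out the \<open>x\<close> directions.\<close>

definition symbol_order :: "real \<Rightarrow> real \<Rightarrow> ('n::finite) point \<Rightarrow> real" where
  "symbol_order \<rho> \<delta> v = (if fst v = 0 then - \<rho> else \<delta>)"

definition is_symbol :: "real \<Rightarrow> real \<Rightarrow> real \<Rightarrow> ('n::finite) bisymbol \<Rightarrow> bool" where
  "is_symbol \<rho> \<delta> = weighted_smooth symbol_weight (symbol_order \<rho> \<delta>)"

definition unit_x :: "'n::finite \<Rightarrow> 'n point" where "unit_x i = (axis i 1, 0, 0)"
definition unit_xi :: "'n::finite \<Rightarrow> 'n point" where "unit_xi i = (0, axis i 1, 0)"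
definition unit_eta :: "'n::finite \<Rightarrow> 'n point" where "unit_eta i = (0, 0, axis i 1)"

lemma Basis_vec_axis: "(Basis :: (real ^ 'n::finite) set) = range (\<lambda>i. axis i 1)"
  by (auto simp: Basis_vec_def)

lemma Basis_triple: "Basis = range unit_x \<union> range unit_xi \<union> range unit_eta"
  by (simp add: Basis_prod_def Basis_vec_axis image_Un image_image unit_x_def[abs_def] unit_xi_def[abs_def]
      unit_eta_def[abs_def] zero_prod_def Un_assoc)

lemma axis_neq_0 [simp]: "axis i (1::real) \<noteq> 0" "0 \<noteq> axis i (1::real)"
  by (auto simp: axis_eq_0_iff dest: HOL.sym)

lemma in_Basis_triple [simp]: "unit_x i \<in> Basis" "unit_xi i \<in> Basis" "unit_eta i \<in> Basis"
  by (auto simp: Basis_triple)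

lemma symbol_order_simps [simp]: "symbol_order \<rho> \<delta> (unit_x i) = \<delta>" "symbol_order \<rho> \<delta> (unit_xi i) = - \<rho>" "symbol_order \<rho> \<delta> (unit_eta i) = - \<rho>"
  by (auto simp: symbol_order_def unit_x_def unit_xi_def unit_eta_def)

lemma inj_axes: "inj unit_x" "inj unit_xi" "inj unit_eta" "inj (\<lambda>i. axis i (1::real))"
  by (auto simp: inj_def unit_x_def unit_xi_def unit_eta_def axis_eq_axis)

lemma symbol_weight_nonneg: "0 \<le> symbol_weight a q" by (simp add: symbol_weight_def)

lemma deriv_x_dir_derivs: "deriv_x \<alpha> \<sigma> = dir_derivs (dir_list unit_x \<alpha>) \<sigma>"
  and deriv_xi_dir_derivs: "deriv_xi \<alpha> \<sigma> = dir_derivs (dir_list unit_xi \<alpha>) \<sigma>"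
  and deriv_eta_dir_derivs: "deriv_eta \<alpha> \<sigma> = dir_derivs (dir_list unit_eta \<alpha>) \<sigma>"
  unfolding deriv_x_def deriv_xi_def deriv_eta_def multi_deriv_dir_list
  by (simp_all add: unit_x_def[abs_def] unit_xi_def[abs_def] unit_eta_def[abs_def])

lemma sum_list_symbol_order_dir_list:
  fixes \<alpha> \<beta> \<gamma> :: "'n::finite \<Rightarrow> nat"
  shows "sum_list (map (symbol_order \<rho> \<delta>) (dir_list unit_x \<alpha> @ dir_list unit_xi \<beta> @ dir_list unit_eta \<gamma>)) =
    \<delta> * real (multi_order \<alpha>) - \<rho> * (real (multi_order \<beta>) + real (multi_order \<gamma>))"
proof -
  have *: "sum_list (map (symbol_order \<rho> \<delta>) vs) = c * real (length vs)" if "\<And>v. v \<in> set vs \<Longrightarrow> symbol_order \<rho> \<delta> v = c"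
    for vs :: "'n point list" and c
    using that by (induction vs) (auto simp: algebra_simps)
  have "sum_list (map (symbol_order \<rho> \<delta>) (dir_list unit_x \<alpha> :: 'n point list)) = \<delta> * real (multi_order \<alpha>)"
    using *[of "dir_list unit_x \<alpha>" \<delta>] set_dir_list[of unit_x \<alpha>] by (force simp: length_dir_list)
  moreover have "sum_list (map (symbol_order \<rho> \<delta>) (dir_list unit_xi \<beta> :: 'n point list)) = - \<rho> * real (multi_order \<beta>)"
    using *[of "dir_list unit_xi \<beta>" "-\<rho>"] set_dir_list[of unit_xi \<beta>] by (force simp: length_dir_list)
  moreover have "sum_list (map (symbol_order \<rho> \<delta>) (dir_list unit_eta \<gamma> :: 'n point list)) = - \<rho> * real (multi_order \<gamma>)"
    using *[of "dir_list unit_eta \<gamma>" "-\<rho>"] set_dir_list[of unit_eta \<gamma>] by (force simp: length_dir_list)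
  ultimately show ?thesis by (simp add: algebra_simps)
qed

lemma is_symbol_imp_BS:
  assumes "is_symbol \<rho> \<delta> m \<sigma>" shows "\<sigma> \<in> BS m \<rho> \<delta>"
  unfolding BS_def
proof (intro CollectI conjI allI)
  show "smooth \<sigma>" using assms unfolding is_symbol_def by (rule weighted_smooth_smooth)
  fix \<alpha> \<beta> \<gamma> :: "'a \<Rightarrow> nat"
  let ?vs = "dir_list unit_x \<alpha> @ dir_list unit_xi \<beta> @ dir_list unit_eta \<gamma>"
  have "set ?vs \<subseteq> Basis" using set_dir_list[of unit_x \<alpha>] set_dir_list[of unit_xi \<beta>] set_dir_list[of unit_eta \<gamma>]
    by (auto simp: Basis_triple)
  from weighted_smooth_bound[OF weighted_smooth_dir_derivs[OF assms[unfolded is_symbol_def] this]] obtain C where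
    C: "norm (dir_derivs ?vs \<sigma> q) \<le> C * symbol_weight (m + sum_list (map (symbol_order \<rho> \<delta>) ?vs)) q" for q by blast
  have "norm (dir_derivs ?vs \<sigma> q) \<le> (\<bar>C\<bar> + 1) * symbol_weight (m + sum_list (map (symbol_order \<rho> \<delta>) ?vs)) q" for q
    by (rule order_trans[OF C]) (auto intro!: mult_right_mono symbol_weight_nonneg)
  then show "\<exists>C>0. \<forall>x \<xi> \<eta>. norm (deriv_x \<alpha> (deriv_xi \<beta> (deriv_eta \<gamma> \<sigma>)) (x, \<xi>, \<eta>))
     \<le> C * (1 + norm \<xi> + norm \<eta>) powr (m + \<delta> * real (multi_order \<alpha>)
                   - \<rho> * (real (multi_order \<beta>) + real (multi_order \<gamma>)))"
    unfolding sum_list_symbol_order_dir_list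
    by (intro exI[of _ "\<bar>C\<bar> + 1"])
      (auto simp: deriv_x_dir_derivs deriv_xi_dir_derivs deriv_eta_dir_derivs symbol_weight_def japanese_def add_diff_eq)
qed

text \<open>The class \<open>BS\<close> only bounds derivatives taken in the order \<eta>, \<xi>, x.
  An arbitrary list of basis directions is sorted into these three groups, each group is read as a
  multi-index, and \<open>dir_derivs_perm\<close> does the rest.\<close>

lemma BS_imp_is_symbol:
  assumes "\<sigma> \<in> BS m \<rho> \<delta>" shows "is_symbol \<rho> \<delta> m (\<sigma> :: ('n::finite) bisymbol)"
  unfolding is_symbol_def
proof (rule weighted_smooth_if_dir_derivs_bounds)
  show sm: "smooth \<sigma>" using assms by (simp add: BS_def)
  fix vs :: "'n point list"
  assume vs: "set vs \<subseteq> Basis"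
  define A where "A = filter (\<lambda>v. v \<in> range unit_x) vs"
  define B where "B = filter (\<lambda>v. v \<in> range unit_xi) vs"
  define C where "C = filter (\<lambda>v. v \<in> range unit_eta) vs"
  have disj: "range unit_x \<inter> range unit_xi = {}" "range unit_x \<inter> range unit_eta = {}" "range unit_xi \<inter> range unit_eta = {}"
    by (auto simp: unit_x_def unit_xi_def unit_eta_def)
  have "mset vs = mset A + mset B + mset C"
    using vs unfolding A_def B_def C_def
  proof (induction vs)
    case (Cons v vs)
    then have "v \<in> range unit_x \<or> v \<in> range unit_xi \<or> v \<in> range unit_eta" by (auto simp: Basis_triple)
    then show ?case using Cons disj by auto
  qed simp
  moreover define \<alpha> \<beta> \<gamma> where "\<alpha> = (\<lambda>i. count (mset A) (unit_x i))" "\<beta> = (\<lambda>i. count (mset B) (unit_xi i))"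
    "\<gamma> = (\<lambda>i. count (mset C) (unit_eta i))"
  moreover have "mset (dir_list unit_x \<alpha>) = mset A" "mset (dir_list unit_xi \<beta>) = mset B" "mset (dir_list unit_eta \<gamma>) = mset C"
    unfolding \<alpha>_\<beta>_\<gamma>_def by (rule mset_dir_list; auto simp: inj_axes A_def B_def C_def)+
  ultimately have ms: "mset vs = mset (dir_list unit_x \<alpha> @ dir_list unit_xi \<beta> @ dir_list unit_eta \<gamma>)" by simp
  have "sum_list (map (symbol_order \<rho> \<delta>) vs) = sum_list (map (symbol_order \<rho> \<delta>) (dir_list unit_x \<alpha> @ dir_list unit_xi \<beta> @ dir_list unit_eta \<gamma>))"
    using ms by (metis mset_map sum_mset_sum_list)
  then have dg: "sum_list (map (symbol_order \<rho> \<delta>) vs) =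
      \<delta> * real (multi_order \<alpha>) - \<rho> * (real (multi_order \<beta>) + real (multi_order \<gamma>))"
    using sum_list_symbol_order_dir_list by metis
  from assms obtain K where
    "norm (deriv_x \<alpha> (deriv_xi \<beta> (deriv_eta \<gamma> \<sigma>)) (x, \<xi>, \<eta>)) \<le> K * (1 + norm \<xi> + norm \<eta>) powr
                (m + \<delta> * real (multi_order \<alpha>)
                   - \<rho> * (real (multi_order \<beta>) + real (multi_order \<gamma>)))" for x \<xi> \<eta>
    unfolding BS_def by blast
  then have "norm (dir_derivs vs \<sigma> (x, \<xi>, \<eta>)) \<le> K * symbol_weight (m + sum_list (map (symbol_order \<rho> \<delta>) vs)) (x, \<xi>, \<eta>)" for x \<xi> \<eta>
    unfolding dir_derivs_perm[OF sm vs ms] dg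
    by (simp add: deriv_x_dir_derivs deriv_xi_dir_derivs deriv_eta_dir_derivs symbol_weight_def japanese_def add_diff_eq)
  then show "\<exists>C. \<forall>x. norm (dir_derivs vs \<sigma> x) \<le> C * symbol_weight (m + sum_list (map (symbol_order \<rho> \<delta>) vs)) x"
    by auto
qed

subsection \<open>Integration over Euclidean space\<close>

lemma lborel_affine_transform:
  fixes f :: "'a::euclidean_space \<Rightarrow> 'b::{banach,second_countable_topology}"
  assumes c: "c \<noteq> 0" and [measurable]: "f \<in> borel_measurable borel"
  shows "integral\<^sup>L lborel f = \<bar>c\<bar> ^ DIM('a) *\<^sub>R (LINT x|lborel. f (t + c *\<^sub>R x))"
    and "integrable lborel f \<longleftrightarrow> integrable lborel (\<lambda>x. f (t + c *\<^sub>R x))"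
proof -
  let ?M = "density (distr lborel borel (\<lambda>x. t + c *\<^sub>R x)) (\<lambda>_. ennreal (\<bar>c\<bar> ^ DIM('a)))"
  have L: "lborel = ?M" using lborel_affine[OF c, of t] by simp
  have "integral\<^sup>L lborel f = integral\<^sup>L ?M f" using L by simp
  also have "\<dots> = \<bar>c\<bar> ^ DIM('a) *\<^sub>R (LINT x|lborel. f (t + c *\<^sub>R x))"
    by (subst integral_density) (auto simp: integral_distr)
  finally show "integral\<^sup>L lborel f = \<bar>c\<bar> ^ DIM('a) *\<^sub>R (LINT x|lborel. f (t + c *\<^sub>R x))" .
  have "integrable lborel f \<longleftrightarrow> integrable ?M f" using L by simp
  also have "\<dots> \<longleftrightarrow> integrable lborel (\<lambda>x. f (t + c *\<^sub>R x))"
    using c integrable_scaleR_right[of "inverse (\<bar>c\<bar> ^ DIM('a))" lborel "\<lambda>x. \<bar>c\<bar> ^ DIM('a) *\<^sub>R f (t + c *\<^sub>R x)"]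
    by (subst integrable_density) (auto simp: integrable_distr_eq)
  finally show "integrable lborel f \<longleftrightarrow> integrable lborel (\<lambda>x. f (t + c *\<^sub>R x))" .
qed

lemma lborel_translate:
  fixes f :: "'a::euclidean_space \<Rightarrow> 'b::{banach,second_countable_topology}"
  assumes "f \<in> borel_measurable borel"
  shows "(LINT x|lborel. f (t + x)) = integral\<^sup>L lborel f"
    and "(LINT x|lborel. f (t - x)) = integral\<^sup>L lborel f"
    and "integrable lborel f \<Longrightarrow> integrable lborel (\<lambda>x. f (t + x))"
    and "integrable lborel f \<Longrightarrow> integrable lborel (\<lambda>x. f (t - x))"
  using lborel_affine_transform[OF _ assms, of 1 t] lborel_affine_transform[OF _ assms, of "-1" t] by simp_all

lemma integral_prod_coordinates:
  fixes g :: "'n::finite \<Rightarrow> real \<Rightarrow> 'b::{real_normed_field,banach,second_countable_topology}"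
  assumes int: "\<And>i. integrable lborel (g i)"
  shows "integrable lborel (\<lambda>x :: real ^ 'n. \<Prod>i\<in>UNIV. g i (x $ i))"
    and "(LINT x|lborel. (\<Prod>i\<in>UNIV. g i (x $ i))) = (\<Prod>i\<in>UNIV. integral\<^sup>L lborel (g i))"
proof -
  interpret product_sigma_finite "\<lambda>_ :: real ^ 'n. lborel :: real measure"
    by standard
  have inj: "inj (\<lambda>i :: 'n. axis i (1::real))" by (rule inj_axes)
  \<comment> \<open>\<open>lborel_eq\<close> presents the measure as a product over basis vectors,
    whereas the factors are indexed by coordinates; \<open>k\<close> recovers the coordinate from
    the basis vector.\<close>
  define k where "k = (\<lambda>b :: real ^ 'n. SOME i. b = axis i 1)"
  have k: "k (axis i 1) = i" for i
    unfolding k_def by (rule some_equality) (auto simp: axis_eq_axis)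
  have eq: "(\<Prod>i\<in>UNIV. g i (x $ i)) = (\<Prod>b\<in>Basis. g (k b) (x \<bullet> b))" for x :: "real ^ 'n"
    unfolding Basis_vec_axis by (subst prod.reindex[OF inj]) (simp add: k inner_axis)
  have eq2: "(\<Prod>i\<in>UNIV. integral\<^sup>L lborel (g i)) = (\<Prod>b\<in>(Basis :: (real ^ 'n) set). integral\<^sup>L lborel (g (k b)))"
    unfolding Basis_vec_axis by (subst prod.reindex[OF inj]) (simp add: k)
  have [measurable]: "g i \<in> borel_measurable borel" for i
    using int[of i] by (simp add: integrable_iff_bounded)
  have fin: "finite (Basis :: (real ^ 'n) set)" by simp
  have simp1: "(\<Prod>b\<in>Basis. g (k b) ((\<Sum>b\<in>Basis. f b *\<^sub>R b) \<bullet> b)) = (\<Prod>b\<in>Basis. g (k b) (f b))"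
    for f :: "real ^ 'n \<Rightarrow> real"
    by (intro prod.cong refl) (simp add: inner_sum_left inner_Basis if_distrib sum.delta cong: if_cong)
  have i1: "integrable (Pi\<^sub>M Basis (\<lambda>_. lborel)) (\<lambda>f. \<Prod>b\<in>Basis. g (k b) (f b))"
    by (rule product_integrable_prod[OF fin]) (rule int)
  show "integrable lborel (\<lambda>x :: real ^ 'n. \<Prod>i\<in>UNIV. g i (x $ i))"
    unfolding eq by (subst lborel_eq) (simp add: integrable_distr_eq simp1 i1)
  show "(LINT x|lborel. (\<Prod>i\<in>UNIV. g i (x $ i))) = (\<Prod>i\<in>UNIV. integral\<^sup>L lborel (g i))"
    unfolding eq eq2
    by (subst lborel_eq) (simp add: integral_distr simp1 product_integral_prod[OF fin int])
qed

section \<open>The product weight and Peetre's inequality\<close>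

definition pweight :: "real ^ 'n::finite \<Rightarrow> real" where
  "pweight z = (\<Prod>i\<in>UNIV. 1 / (1 + (z $ i)\<^sup>2))"

lemma pweight_pos: "0 < pweight z" and pweight_le_1: "pweight z \<le> 1"
proof -
  have 1: "0 < 1 / (1 + (z $ i)\<^sup>2)" "1 / (1 + (z $ i)\<^sup>2) \<le> 1" for i
    using zero_le_power2[of "z $ i"] by (simp_all add: add_pos_nonneg divide_le_eq_1_pos)
  show "0 < pweight z" unfolding pweight_def by (rule prod_pos) (rule 1)
  show "pweight z \<le> 1" unfolding pweight_def by (rule prod_le_1) (use 1 less_imp_le in blast)
qed

lemma pweight_nonneg [simp]: "0 \<le> pweight z" using pweight_pos[of z] by simp

lemma pweight_minus [simp]: "pweight (- z) = pweight z" by (simp add: pweight_def)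

lemma pweight_0 [simp]: "pweight 0 = 1" by (simp add: pweight_def)

lemma continuous_on_pweight [continuous_intros]:
  "continuous_on A f \<Longrightarrow> continuous_on A (\<lambda>x. pweight (f x))"
  unfolding pweight_def by (intro continuous_intros) (auto simp: add_nonneg_eq_0_iff)

lemma measurable_pweight [measurable]: "pweight \<in> borel_measurable borel"
  by (intro borel_measurable_continuous_onI continuous_intros)

text \<open>The reason for a weight that is a product over the coordinates rather than a function of
  the norm: in every dimension integrability comes from the one-dimensional integral of 1 / (1 +
  x^2).\<close>

lemma integrable_pweight: "integrable lborel (pweight :: real ^ 'n::finite \<Rightarrow> real)"
proof -
  have "integrable lborel (\<lambda>x::real. 1 / (1 + x\<^sup>2))"
    using integrable_inverse_1_plus_square by (simp add: set_integrable_def divide_inverse)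
  then show ?thesis unfolding pweight_def by (intro integral_prod_coordinates(1))
qed

text \<open>Peetre's inequality one coordinate at a time: 1 + (a + b)^2 \<le> 2 (1 + a^2) (1 + b^2),
  since the difference is 1 + (a - b)^2 + 2 a^2 b^2.\<close>

lemma pweight_peetre: "pweight x * pweight y \<le> 2 ^ CARD('n) * pweight (x + y)" for x y :: "real ^ 'n::finite"
proof -
  have "1 / (1 + (x $ i)\<^sup>2) * (1 / (1 + (y $ i)\<^sup>2)) \<le> 2 * (1 / (1 + ((x + y) $ i)\<^sup>2))" for i
  proof -
    have pos: "0 < 1 + (x $ i)\<^sup>2" "0 < 1 + (y $ i)\<^sup>2" "0 < 1 + ((x + y) $ i)\<^sup>2" by (auto intro: add_pos_nonneg)
    have "0 \<le> (x $ i - y $ i)\<^sup>2" "0 \<le> (x $ i * y $ i)\<^sup>2" by simp_all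
    then have "1 + (x $ i + y $ i)\<^sup>2 \<le> 2 * ((1 + (x $ i)\<^sup>2) * (1 + (y $ i)\<^sup>2))"
      by (simp add: power2_eq_square algebra_simps)
    then show ?thesis using pos by (simp add: field_simps)
  qed
  then have "(\<Prod>i\<in>UNIV. 1 / (1 + (x $ i)\<^sup>2) * (1 / (1 + (y $ i)\<^sup>2))) \<le> (\<Prod>i\<in>UNIV. 2 * (1 / (1 + ((x + y) $ i)\<^sup>2)))"
    by (intro prod_mono) auto
  then show ?thesis unfolding pweight_def prod.distrib by simp
qed

text \<open>Expanding the product of the 1 + x_i^2 leaves at least 1 + |x|^2. One power of the
  weight thus buys only two powers of the norm, in every dimension.\<close>

lemma pweight_norm_upper: "pweight x * (1 + norm x)\<^sup>2 \<le> 2" for x :: "real ^ 'n::finite"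
proof -
  have fin: "1 + (\<Sum>i\<in>A. (x $ i)\<^sup>2) \<le> (\<Prod>i\<in>A. 1 + (x $ i)\<^sup>2)" if "finite A" for A
    using that
  proof induction
    case (insert a A)
    have 1: "1 \<le> (\<Prod>i\<in>A. 1 + (x $ i)\<^sup>2)" by (rule prod_ge_1) simp
    have "1 + (\<Sum>i\<in>insert a A. (x $ i)\<^sup>2) = 1 + (\<Sum>i\<in>A. (x $ i)\<^sup>2) + (x $ a)\<^sup>2 * 1" using insert by simp
    also have "\<dots> \<le> (\<Prod>i\<in>A. 1 + (x $ i)\<^sup>2) + (x $ a)\<^sup>2 * (\<Prod>i\<in>A. 1 + (x $ i)\<^sup>2)"
      by (intro add_mono insert.IH mult_left_mono 1) simp
    finally show ?case using insert by (simp add: algebra_simps)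
  qed simp
  have "(norm x)\<^sup>2 = (\<Sum>i\<in>UNIV. (x $ i)\<^sup>2)"
    by (simp add: norm_vec_def L2_set_def real_sqrt_pow2 sum_nonneg)
  then have "1 + (norm x)\<^sup>2 \<le> (\<Prod>i\<in>UNIV. 1 + (x $ i)\<^sup>2)" using fin[of UNIV] by simp
  then have "pweight x * (1 + (norm x)\<^sup>2) \<le> pweight x * (\<Prod>i\<in>UNIV. 1 + (x $ i)\<^sup>2)"
    by (intro mult_left_mono) auto
  also have "\<dots> = 1"
    unfolding pweight_def by (subst prod.distrib[symmetric]) (simp add: add_nonneg_eq_0_iff)
  finally have 1: "pweight x * (1 + (norm x)\<^sup>2) \<le> 1" .
  have "(1 + norm x)\<^sup>2 \<le> 2 * (1 + (norm x)\<^sup>2)"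
    using zero_le_power2[of "1 - norm x"] by (simp add: power2_eq_square algebra_simps)
  then have "pweight x * (1 + norm x)\<^sup>2 \<le> pweight x * (2 * (1 + (norm x)\<^sup>2))" by (intro mult_left_mono) auto
  then show ?thesis using 1 by linarith
qed

text \<open>Each of the \<open>CARD('n)\<close> factors can be as large as (1 + |x|)^2. This is the
  source of the exponent \<open>2 * CARD('n)\<close> in \<open>pweight_shift\<close> and in the
  estimate for large \<theta>.\<close>

lemma pweight_norm_lower: "1 \<le> pweight x * (1 + norm x) ^ (2 * CARD('n))" for x :: "real ^ 'n::finite"
proof -
  have "1 + (x $ i)\<^sup>2 \<le> (1 + norm x)\<^sup>2" for i
  proof -
    have "(x $ i)\<^sup>2 \<le> (norm x)\<^sup>2" using component_le_norm_cart[of x i] power_mono[of "\<bar>x $ i\<bar>" "norm x" 2] by simp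
    then have "1 + (x $ i)\<^sup>2 \<le> 1 + (norm x)\<^sup>2 + 2 * norm x" by (simp add: add_increasing2)
    then show ?thesis by (simp add: power2_eq_square algebra_simps)
  qed
  then have "1 \<le> 1 / (1 + (x $ i)\<^sup>2) * (1 + norm x)\<^sup>2" for i
    by (simp add: add_pos_nonneg)
  then have "1 \<le> (\<Prod>i\<in>UNIV. 1 / (1 + (x $ i)\<^sup>2) * (1 + norm x)\<^sup>2)"
    by (intro prod_ge_1) auto
  then show ?thesis unfolding pweight_def prod.distrib by (simp add: power_mult)
qed

text \<open>Peetre's inequality for \<open>x + y\<close> and \<open>- y\<close>, with
  \<open>pweight y\<close> traded for a power of the norm.\<close>

lemma pweight_shift: "pweight (x + y) \<le> 2 ^ CARD('n) * (1 + norm y) ^ (2 * CARD('n)) * pweight x" for x y :: "real ^ 'n::finite"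
proof -
  have "pweight (x + y) * 1 \<le> pweight (x + y) * (pweight y * (1 + norm y) ^ (2 * CARD('n)))"
    using pweight_norm_lower[of y] by (intro mult_left_mono) auto
  also have "\<dots> \<le> (2 ^ CARD('n) * pweight x) * (1 + norm y) ^ (2 * CARD('n))"
    using pweight_peetre[of "x + y" "- y"] by (simp add: mult.assoc[symmetric] mult_right_mono)
  finally show ?thesis by (simp add: ac_simps)
qed

section \<open>Fubini, differentiation under the integral sign, integration by parts\<close>

lemma borel_measurable_cont_pair:
  fixes F :: "'a::euclidean_space \<times> 'b::euclidean_space \<Rightarrow> 'c::real_normed_vector"
  shows "continuous_on UNIV F \<Longrightarrow> F \<in> borel_measurable (lborel \<Otimes>\<^sub>M lborel)"
  using borel_measurable_continuous_onI[of F] by (simp add: borel_prod[symmetric] cong: measurable_cong_sets)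

text \<open>A majorant that is a product settles integrability on the product space once and for
  all; every interchange of integrals below rests on it.\<close>

lemma dominated_swap:
  fixes F :: "'a::euclidean_space \<Rightarrow> 'b::euclidean_space \<Rightarrow> complex"
  assumes F: "case_prod F \<in> borel_measurable (lborel \<Otimes>\<^sub>M lborel)"
    and p: "integrable lborel p" and q: "integrable lborel q"
    and le: "\<And>x y. norm (F x y) \<le> p x * q y"
  shows "integrable (lborel \<Otimes>\<^sub>M lborel) (case_prod F)"
    and "(LINT x|lborel. LINT y|lborel. F x y) = (LINT y|lborel. LINT x|lborel. F x y)"
    and "integrable lborel (\<lambda>x. LINT y|lborel. F x y)"
    and "integrable lborel (F x)"
proof -
  have [measurable]: "p \<in> borel_measurable borel" "q \<in> borel_measurable borel"
    using p q by (simp_all add: integrable_iff_bounded)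
  have "integrable (lborel \<Otimes>\<^sub>M lborel) (\<lambda>(x, y). p x * q y)"
  proof (rule lborel_pair.Fubini_integrable)
    show "integrable lborel (\<lambda>x. LINT y|lborel. norm (case (x, y) of (x, y) \<Rightarrow> p x * q y))"
      using p q by (simp add: abs_mult)
    show "AE x in lborel. integrable lborel (\<lambda>y. case (x, y) of (x, y) \<Rightarrow> p x * q y)"
      using q by simp
  qed measurable
  then show 1: "integrable (lborel \<Otimes>\<^sub>M lborel) (case_prod F)"
    by (rule Bochner_Integration.integrable_bound) (use F in \<open>auto simp: order_trans[OF le abs_ge_self]\<close>)
  show "(LINT x|lborel. LINT y|lborel. F x y) = (LINT y|lborel. LINT x|lborel. F x y)"
    by (rule lborel_pair.Fubini_integral[OF 1, symmetric])
  show "integrable lborel (\<lambda>x. LINT y|lborel. F x y)"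
    using lborel_pair.integrable_fst[OF 1] by simp
  show "integrable lborel (F x)"
  proof (rule Bochner_Integration.integrable_bound)
    show "integrable lborel (\<lambda>y. p x * q y)" using q by simp
    show "F x \<in> borel_measurable lborel"
      using measurable_compose[OF measurable_Pair1' F, of x] by simp
  qed (use le in \<open>auto simp: order_trans[OF le abs_ge_self]\<close>)
qed

lemma measurable_integral_param:
  fixes F :: "'a::euclidean_space \<Rightarrow> 'b::euclidean_space \<Rightarrow> complex"
  assumes "continuous_on UNIV (\<lambda>q. F (fst q) (snd q))"
  shows "(\<lambda>x. LINT y|lborel. F x y) \<in> borel_measurable borel"
proof -
  have [measurable]: "case_prod F \<in> borel_measurable (lborel \<Otimes>\<^sub>M lborel)"
    by (rule borel_measurable_cont_pair) (use assms in \<open>simp add: case_prod_unfold\<close>)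
  have "(\<lambda>x. LINT y|lborel. F x y) \<in> borel_measurable lborel" by measurable
  then show ?thesis by simp
qed

text \<open>Dominated convergence for the normalised remainder of the first-order expansion, along
  sequences tending to \<open>p\<close>. A Frechet derivative is needed because the parameter will
  be a point (y, \<zeta>, \<eta>) and smoothness asks for total differentiability.\<close>

lemma leibniz_frechet:
  fixes g :: "'p::euclidean_space \<Rightarrow> 'w \<Rightarrow> complex"
  assumes e: "0 < e"
    and d: "\<And>q \<omega>. q \<in> ball p e \<Longrightarrow> ((\<lambda>q. g q \<omega>) has_derivative g' q \<omega>) (at q)"
    and b: "\<And>q \<omega> v. q \<in> ball p e \<Longrightarrow> norm (g' q \<omega> v) \<le> B \<omega> * norm v"
    and i: "\<And>q. q \<in> ball p e \<Longrightarrow> integrable M (g q)" "integrable M B"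
    and m: "\<And>v. (\<lambda>\<omega>. g' p \<omega> v) \<in> borel_measurable M"
  shows "((\<lambda>q. integral\<^sup>L M (g q)) has_derivative (\<lambda>v. LINT \<omega>|M. g' p \<omega> v)) (at p)"
proof -
  have pin: "p \<in> ball p e" using e by simp
  have i': "integrable M (\<lambda>\<omega>. g' p \<omega> v)" for v
    by (rule Bochner_Integration.integrable_bound[OF integrable_mult_left[OF i(2), of "norm v"] m])
      (use b[OF pin] in \<open>auto intro: order_trans[OF _ abs_ge_self]\<close>)
  have lin: "linear (g' p \<omega>)" for \<omega>
    using d[OF pin] by (simp add: has_derivative_def bounded_linear.linear)
  have bl: "bounded_linear (\<lambda>v. LINT \<omega>|M. g' p \<omega> v)"
  proof -
    have "linear (\<lambda>v. LINT \<omega>|M. g' p \<omega> v)"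
      by (rule linearI) (simp_all add: linear_add[OF lin] linear_cmul[OF lin] i')
    then show ?thesis by (simp add: linear_conv_bounded_linear)
  qed
  have "((\<lambda>q. (1 / norm (q - p)) *\<^sub>R (integral\<^sup>L M (g q) - (integral\<^sup>L M (g p) + (LINT \<omega>|M. g' p \<omega> (q - p))))) \<longlongrightarrow> 0) (at p within ball p e)"
    unfolding tendsto_at_iff_sequentially comp_def
  proof (intro allI impI)
    fix X assume X: "\<forall>i. X i \<in> ball p e - {p}" and lim: "X \<longlonglongrightarrow> p"
    define s where "s = (\<lambda>i \<omega>. (1 / norm (X i - p)) *\<^sub>R (g (X i) \<omega> - (g p \<omega> + g' p \<omega> (X i - p))))"
    have Xb: "X i \<in> ball p e" "X i \<noteq> p" for i using X by auto
    have "(\<lambda>i. integral\<^sup>L M (s i)) \<longlonglongrightarrow> (LINT \<omega>|M. 0)"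
    \<comment> \<open>One \<open>B\<close> bounds the difference quotient by the mean value
      inequality, the other one bounds the linear term.\<close>
    proof (rule integral_dominated_convergence[where w="\<lambda>\<omega>. 2 * B \<omega>"])
      show "s i \<in> borel_measurable M" for i
        unfolding s_def using i(1)[OF Xb(1)] i(1)[OF pin] i'
        by (intro borel_measurable_scaleR borel_measurable_diff borel_measurable_add) auto
      show "AE \<omega> in M. (\<lambda>i. s i \<omega>) \<longlonglongrightarrow> 0"
      proof (rule AE_I2)
        fix \<omega>
        have "((\<lambda>y. (1 / norm (y - p)) *\<^sub>R (g y \<omega> - (g p \<omega> + g' p \<omega> (y - p)))) \<longlongrightarrow> 0) (at p)"
          using d[OF pin, of \<omega>] by (simp add: has_derivative_within)
        then show "(\<lambda>i. s i \<omega>) \<longlonglongrightarrow> 0"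
          unfolding tendsto_at_iff_sequentially comp_def s_def using Xb lim by auto
      qed
      show "AE \<omega> in M. norm (s i \<omega>) \<le> 2 * B \<omega>" for i
      proof (rule AE_I2)
        fix \<omega>
        have "norm (g (X i) \<omega> - g p \<omega>) \<le> B \<omega> * norm (X i - p)"
        proof (rule differentiable_bound[where f="\<lambda>q. g q \<omega>" and S="ball p e" and f'="\<lambda>q. g' q \<omega>"])
          show "((\<lambda>q. g q \<omega>) has_derivative g' q \<omega>) (at q within ball p e)" if "q \<in> ball p e" for q
            using d[OF that] by (rule has_derivative_at_withinI)
          show "onorm (g' q \<omega>) \<le> B \<omega>" if "q \<in> ball p e" for q
            by (rule onorm_le) (rule b[OF that])
        qed (use Xb pin in auto)
        moreover have "norm (g' p \<omega> (X i - p)) \<le> B \<omega> * norm (X i - p)" by (rule b[OF pin])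
        ultimately have "norm (g (X i) \<omega> - (g p \<omega> + g' p \<omega> (X i - p))) \<le> 2 * B \<omega> * norm (X i - p)"
          using norm_triangle_ineq4[of "g (X i) \<omega> - g p \<omega>" "g' p \<omega> (X i - p)"]
          by (simp add: diff_diff_eq)
        then show "norm (s i \<omega>) \<le> 2 * B \<omega>"
          using Xb(2)[of i] unfolding s_def norm_scaleR by (simp add: pos_divide_le_eq)
      qed
    qed (use i in auto)
    moreover have "integral\<^sup>L M (s i) = (1 / norm (X i - p)) *\<^sub>R (integral\<^sup>L M (g (X i)) - (integral\<^sup>L M (g p) + (LINT \<omega>|M. g' p \<omega> (X i - p))))" for i
      unfolding s_def using i(1)[OF Xb(1)[of i]] i(1)[OF pin] i'[of "X i - p"] by simp
    ultimately show "(\<lambda>i. (1 / norm (X i - p)) *\<^sub>R (integral\<^sup>L M (g (X i)) - (integral\<^sup>L M (g p) + (LINT \<omega>|M. g' p \<omega> (X i - p))))) \<longlonglongrightarrow> 0"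
      by simp
  qed
  moreover have "at p within ball p e = at p" by (rule at_within_open) (use e in auto)
  ultimately show ?thesis using bl unfolding has_derivative_within by metis
qed

text \<open>By translation invariance the integral of f(x + t v) does not depend on t;
  differentiating at t = 0 gives the claim. All integrations by parts, in z as well as in \<theta>,
  are instances of this.\<close>

lemma integral_dir_deriv_zero:
  fixes f :: "real ^ 'n::finite \<Rightarrow> complex"
  assumes d: "\<And>x. ((\<lambda>t. f (x + t *\<^sub>R v)) has_vector_derivative f' x) (at 0)"
    and b: "\<And>x. norm (f x) \<le> C * pweight x" "\<And>x. norm (f' x) \<le> C * pweight x"
    and [measurable]: "f \<in> borel_measurable borel" "f' \<in> borel_measurable borel"
  shows "integral\<^sup>L lborel f' = 0"
proof -
  have C: "0 \<le> C" using order_trans[OF norm_ge_zero b(1)[of 0]] by simp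
  \<comment> \<open>The cost by \<open>pweight_shift\<close> of moving the weight by t v, uniformly
    for |t| < 1.\<close>
  define K where "K = 2 ^ CARD('n) * (1 + norm v) ^ (2 * CARD('n))"
  have int: "integrable lborel f"
    by (rule Bochner_Integration.integrable_bound[OF integrable_mult_right[OF integrable_pweight, of C]])
      (auto intro: order_trans[OF b(1) abs_ge_self])
  have "((\<lambda>t. LINT x|lborel. f (x + t *\<^sub>R v)) has_derivative (\<lambda>s. LINT x|lborel. s *\<^sub>R f' (x + 0 *\<^sub>R v))) (at (0::real))"
  proof (rule leibniz_frechet[where e=1 and B="\<lambda>x. C * (K * pweight x)" and g'="\<lambda>t x s. s *\<^sub>R f' (x + t *\<^sub>R v)"])
    fix t :: real and x
    assume t: "t \<in> ball 0 1"
    have "((\<lambda>s. f ((x + t *\<^sub>R v) + (s - t) *\<^sub>R v)) has_vector_derivative 1 *\<^sub>R f' (x + t *\<^sub>R v)) (at t)"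
      by (rule vector_diff_chain_at[where f="\<lambda>s. s - t" and g="\<lambda>s. f ((x + t *\<^sub>R v) + s *\<^sub>R v)", unfolded comp_def])
        (auto intro!: derivative_eq_intros d)
    then show "((\<lambda>t. f (x + t *\<^sub>R v)) has_derivative (\<lambda>s. s *\<^sub>R f' (x + t *\<^sub>R v))) (at t)"
      by (simp add: has_vector_derivative_def algebra_simps)
    fix s :: real
    have "norm (t *\<^sub>R v) \<le> norm v" using t by (simp add: mult_left_le_one_le)
    then have "2 ^ CARD('n) * (1 + norm (t *\<^sub>R v)) ^ (2 * CARD('n)) \<le> K"
      unfolding K_def by (intro mult_left_mono power_mono) auto
    then have "pweight (x + t *\<^sub>R v) \<le> K * pweight x"
      using order_trans[OF pweight_shift[of x "t *\<^sub>R v"]] by (simp add: mult_right_mono)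
    then have "norm (f' (x + t *\<^sub>R v)) \<le> C * (K * pweight x)"
      using C by (intro order_trans[OF b(2)] mult_left_mono)
    then show "norm (s *\<^sub>R f' (x + t *\<^sub>R v)) \<le> C * (K * pweight x) * norm s"
      by (simp add: mult.commute[of _ "\<bar>s\<bar>"] mult_left_mono)
  next
    fix t :: real
    show "integrable lborel (\<lambda>x. f (x + t *\<^sub>R v))"
      using lborel_translate(3)[OF _ int, of "t *\<^sub>R v"] by (simp add: add.commute)
  qed (auto intro!: integrable_mult_right integrable_pweight)
  moreover have "(LINT x|lborel. f (x + t *\<^sub>R v)) = integral\<^sup>L lborel f" for t
    using lborel_translate(1)[of f "t *\<^sub>R v"] by (simp add: add.commute)
  ultimately have "((\<lambda>t::real. integral\<^sup>L lborel f) has_derivative (\<lambda>s. LINT x|lborel. s *\<^sub>R f' x)) (at 0)" by simp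
  then have "(\<lambda>s. LINT x|lborel. s *\<^sub>R f' x) = (\<lambda>s::real. 0)"
    by (rule has_derivative_unique) (rule has_derivative_const)
  from fun_cong[OF this, of 1] show ?thesis by simp
qed

subsection \<open>Decaying functions\<close>

text \<open>The weight ignores the order parameter, so all derivatives obey the same bound. For
  \<open>N = 0\<close> this means bounded with all derivatives.\<close>

definition decay :: "nat \<Rightarrow> (real ^ 'n::finite \<Rightarrow> complex) \<Rightarrow> bool" where
  "decay N = weighted_smooth (\<lambda>_ z. pweight z ^ N) (\<lambda>_. 0) 0"

lemma decay_mult: "decay N u \<Longrightarrow> decay M v \<Longrightarrow> decay (N + M) (\<lambda>z. u z * v z)"
  unfolding decay_def
  using weighted_smooth_mult[of "\<lambda>_ z. pweight z ^ N" "\<lambda>_ z. pweight z ^ M" "\<lambda>_ z. pweight z ^ (N + M)" "\<lambda>_. 0" 0 u 0 v]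
  by (simp add: power_add)

lemma decay_mono: "decay N u \<Longrightarrow> M \<le> N \<Longrightarrow> decay M u"
  unfolding decay_def
  using weighted_smooth_weaken[of "\<lambda>_ z. pweight z ^ N" "\<lambda>_ z. pweight z ^ M" 0 "\<lambda>_. 0" 0 u]
  by (simp add: power_decreasing pweight_le_1)

lemma decay_add: "decay N u \<Longrightarrow> decay N v \<Longrightarrow> decay N (\<lambda>z. u z + v z)"
  and decay_diff: "decay N u \<Longrightarrow> decay N v \<Longrightarrow> decay N (\<lambda>z. u z - v z)"
  and decay_cmult: "decay N u \<Longrightarrow> decay N (\<lambda>z. c * u z)"
  unfolding decay_def by (auto intro: weighted_smooth_add weighted_smooth_diff weighted_smooth_cmult)

lemma decay_dir_deriv: "decay N u \<Longrightarrow> decay N (dir_deriv (axis j 1) u)"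
  unfolding decay_def
  using weighted_smooth_dir_deriv[of "\<lambda>_ z. pweight z ^ N" "\<lambda>_. 0" 0 u "axis j 1"] by (simp add: Basis_vec_axis)

lemma decay_continuous: "decay N u \<Longrightarrow> continuous_on UNIV u"
  and decay_differentiable: "decay N u \<Longrightarrow> u differentiable (at z)"
  and decay_bound: "decay N u \<Longrightarrow> \<exists>C. \<forall>z. norm (u z) \<le> C * pweight z ^ N"
  unfolding decay_def by (auto intro: weighted_smooth_continuous weighted_smooth_differentiable dest: weighted_smooth_bound)

lemma decay_boundE:
  assumes "decay N u"
  obtains C where "0 \<le> C" "\<And>z. norm (u z) \<le> C * pweight z ^ N"
proof -
  from decay_bound[OF assms] obtain C where C: "\<And>z. norm (u z) \<le> C * pweight z ^ N" by blast
  show ?thesis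
  proof (rule that[of C])
    show "0 \<le> C" using order_trans[OF norm_ge_zero C[of 0]] by simp
  qed (rule C)
qed

lemma decay_const: "decay 0 (\<lambda>z :: real ^ 'n::finite. c)"
proof -
  have "weighted_Ck (\<lambda>_ z. pweight z ^ 0) (\<lambda>_. 0) k 0 (\<lambda>z :: real ^ 'n. c)" for k
    by (induction k arbitrary: c) (auto intro!: exI[of _ "norm _"])
  then show ?thesis by (simp add: decay_def weighted_smooth_def)
qed

section \<open>Products of resolvents\<close>

definition resolvent :: "real \<Rightarrow> 'n::finite \<Rightarrow> real ^ 'n \<Rightarrow> complex" where
  "resolvent r j z = 1 / (1 + \<i> * complex_of_real (r * z $ j))"

lemma one_plus_i_neq_0 [simp]: "1 + \<i> * complex_of_real x \<noteq> 0"
  by (simp add: complex_eq_iff)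

lemma one_plus_i_mult_neq_0 [simp]: "1 + \<i> * (complex_of_real x * complex_of_real y) \<noteq> 0"
  using one_plus_i_neq_0[of "x * y"] by (simp only: of_real_mult not_False_eq_True)

lemma norm_one_plus_i: "norm (1 + \<i> * complex_of_real x) = sqrt (1 + x\<^sup>2)"
  by (simp add: cmod_def)

lemma norm_one_plus_i_ge_1: "1 \<le> norm (1 + \<i> * complex_of_real x)"
  by (simp add: norm_one_plus_i)

lemma norm_resolvent_le_1: "norm (resolvent r j z) \<le> 1"
  unfolding resolvent_def norm_divide using norm_one_plus_i_ge_1[of "r * z $ j"] by (simp add: divide_le_eq_1)

lemma has_derivative_resolvent:
  "(resolvent r j has_derivative (\<lambda>v. - (\<i> * of_real (r * v $ j)) * (resolvent r j z)\<^sup>2)) (at z)"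
proof -
  have "((\<lambda>z. 1 + \<i> * complex_of_real (r * z $ j)) has_derivative (\<lambda>v. \<i> * of_real (r * v $ j))) (at z)"
    by (auto intro!: derivative_eq_intros bounded_linear.has_derivative[OF bounded_linear_vec_nth])
  from has_derivative_divide[OF has_derivative_const this, of 1]
  show ?thesis unfolding resolvent_def[abs_def]
    by (rule has_derivative_eq_rhs) (auto simp: fun_eq_iff field_simps power2_eq_square)
qed

lemma resolvent_differentiable: "resolvent r j differentiable (at z)"
  using has_derivative_resolvent differentiable_def by blast

lemma dir_deriv_resolvent:
  "dir_deriv (axis k 1) (resolvent r j) = (\<lambda>z. (if k = j then - (\<i> * of_real r) else 0) * (resolvent r j z)\<^sup>2)"
  by (rule ext) (simp add: dir_deriv_eqI[OF has_derivative_resolvent] axis_def)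

lemma decay_resolvent: "decay 0 (resolvent r j)"
proof -
  have "weighted_Ck (\<lambda>_ z. pweight z ^ 0) (\<lambda>_. 0) k 0 (resolvent r j)" for k
  proof (induction k)
    case 0
    show ?case using norm_resolvent_le_1
      by (auto intro!: exI[of _ 1] continuous_if_differentiable resolvent_differentiable)
  next
    case (Suc k)
    have "weighted_Ck (\<lambda>_ z. pweight z ^ 0) (\<lambda>_. 0) k (0 + 0) (\<lambda>z. resolvent r j z * resolvent r j z)"
      by (rule weighted_Ck_mult[OF _ _ _ Suc Suc]) auto
    then have "weighted_Ck (\<lambda>_ z. pweight z ^ 0) (\<lambda>_. 0) k 0 (\<lambda>z. c * (resolvent r j z * resolvent r j z))" for c
      by (intro weighted_Ck_cmult) simp
    then have "weighted_Ck (\<lambda>_ z. pweight z ^ 0) (\<lambda>_. 0) k 0 (dir_deriv b (resolvent r j))" if "b \<in> Basis" for b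
      using that unfolding Basis_vec_axis by (auto simp only: dir_deriv_resolvent power2_eq_square)
    then show ?case using norm_resolvent_le_1 by (auto intro!: exI[of _ 1] resolvent_differentiable)
  qed
  then show ?thesis by (simp add: decay_def weighted_smooth_def)
qed

definition resolvents :: "real \<Rightarrow> 'n list \<Rightarrow> real ^ 'n::finite \<Rightarrow> complex" where
  "resolvents r js z = prod_list (map (\<lambda>j. resolvent r j z) js)"

lemma resolvents_simps [simp]: "resolvents r [] = (\<lambda>z. 1)" "resolvents r (j # js) = (\<lambda>z. resolvent r j z * resolvents r js z)"
  by (auto simp: resolvents_def)

lemma decay_cwp0: "decay 0 (resolvents r js)"
  by (induction js) (use decay_const decay_mult[OF decay_resolvent] in auto)

text \<open>The logarithmic derivative of the product is a sum of multiples of resolvents, hence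
  bounded with all its derivatives. Differentiation therefore keeps whatever decay the product
  itself has.\<close>

lemma dir_deriv_resolvents:
  "\<exists>w. decay 0 w \<and> dir_deriv (axis k 1) (resolvents r js) = (\<lambda>z. resolvents r js z * w z)"
proof (induction js)
  case Nil
  show ?case by (auto intro!: exI[of _ "\<lambda>z. 0"] decay_const)
next
  case (Cons j js)
  then obtain w where w: "decay 0 w" "dir_deriv (axis k 1) (resolvents r js) = (\<lambda>z. resolvents r js z * w z)" by blast
  let ?c = "if k = j then - (\<i> * of_real r) else 0"
  have "dir_deriv (axis k 1) (resolvents r (j # js)) = (\<lambda>z. resolvents r (j # js) z * (w z + ?c * resolvent r j z))"
    by (simp add: dir_deriv_mult' resolvent_differentiable decay_differentiable[OF decay_cwp0] w(2) dir_deriv_resolvent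
        power2_eq_square algebra_simps)
  then show ?case using decay_add[OF w(1) decay_cmult[OF decay_resolvent]] by blast
qed

text \<open>Only the size of the product itself has to be known. The induction carries an additional
  bounded factor \<open>w\<close>, because each derivative is again the product times such a
  factor.\<close>

lemma decay_resolvents:
  assumes le: "\<And>z. norm (resolvents r js z) \<le> C * pweight z ^ N"
  shows "decay N (resolvents r js)"
proof -
  have "weighted_Ck (\<lambda>_ z. pweight z ^ N) (\<lambda>_. 0) k 0 (\<lambda>z. resolvents r js z * w z)" if "decay 0 w" for k w
    using that
  proof (induction k arbitrary: w)
    have *: "\<exists>C. \<forall>z. norm (resolvents r js z * w z) \<le> C * pweight z ^ N" if w: "decay 0 w" for w
    proof -
      from decay_boundE[OF w] obtain D where D: "0 \<le> D" "\<And>z. norm (w z) \<le> D" by auto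
      have "norm (resolvents r js z * w z) \<le> (C * pweight z ^ N) * D" for z
        unfolding norm_mult using le[of z] D order_trans[OF norm_ge_zero le[of z]]
        by (intro mult_mono) auto
      then show ?thesis by (intro exI[of _ "C * D"]) (simp add: ac_simps)
    qed
    {
      case 0
      then show ?case
        using * continuous_on_mult[OF decay_continuous[OF decay_cwp0] decay_continuous[OF 0]] by simp
    next
      case (Suc k)
      have "weighted_Ck (\<lambda>_ z. pweight z ^ N) (\<lambda>_. 0) k 0 (dir_deriv (axis i 1) (\<lambda>z. resolvents r js z * w z))" for i
      proof -
        obtain v where v: "decay 0 v" "dir_deriv (axis i 1) (resolvents r js) = (\<lambda>z. resolvents r js z * v z)"
          using dir_deriv_resolvents by blast
        have d: "decay 0 (\<lambda>z. dir_deriv (axis i 1) w z + v z * w z)"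
          using decay_mult[OF v(1) Suc.prems] by (simp add: decay_add decay_dir_deriv Suc.prems)
        have "dir_deriv (axis i 1) (\<lambda>z. resolvents r js z * w z)
            = (\<lambda>z. resolvents r js z * (dir_deriv (axis i 1) w z + v z * w z))"
          by (simp add: dir_deriv_mult' decay_differentiable[OF decay_cwp0] decay_differentiable[OF Suc.prems]
              v(2) algebra_simps)
        then show ?thesis using Suc.IH[OF d] by simp
      qed
      then show ?case using *[OF Suc.prems]
        by (auto simp: Basis_vec_axis intro!: differentiable_mult decay_differentiable[OF decay_cwp0]
            decay_differentiable[OF Suc.prems])
    }
  qed
  from this[OF decay_const[of 1]] show ?thesis by (simp add: decay_def weighted_smooth_def)
qed

text \<open>The quotient z_j / (1 + i r z_j) equals (1 - resolvent) / (i r). So one resolvent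
  absorbs the factor z_j that a \<theta>-derivative of the phase brings down.\<close>

lemma decay_coord_resolvent:
  assumes "r \<noteq> 0" shows "decay 0 (\<lambda>z. of_real (z $ j) * resolvent r j z)"
proof -
  have "(\<lambda>z. of_real (z $ j) * resolvent r j z) = (\<lambda>z. (1 / (\<i> * of_real r)) * (1 - resolvent r j z))"
    using assms by (auto simp: fun_eq_iff resolvent_def divide_simps)
  then show ?thesis by (simp only:) (intro decay_cmult decay_diff decay_const decay_resolvent)
qed

definition coords_rep :: "nat \<Rightarrow> 'n::finite list" where "coords_rep N = concat (replicate N coords)"

lemma prod_list_coords: "prod_list (map g coords) = (\<Prod>i\<in>UNIV. g i)" for g :: "'n::finite \<Rightarrow> 'a::comm_monoid_mult"
  using prod.distinct_set_conv_list[OF coords(2), of g] by (simp add: coords(1))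

lemma prod_list_coords_rep: "prod_list (map g (coords_rep N)) = (\<Prod>i\<in>UNIV. g i) ^ N" for g :: "'n::finite \<Rightarrow> 'a::comm_monoid_mult"
  unfolding coords_rep_def by (induction N) (auto simp: prod_list_coords)

text \<open>Since |1 + i r z_j|^2 = 1 + (r z_j)^2, two resolvents per coordinate make up one power
  of the weight. This is why the lists are always taken as
  \<open>coords_rep (2 * N)\<close>.\<close>

lemma norm_resolvents_coords_rep: "norm (resolvents r (coords_rep (2 * N)) z) = pweight (r *\<^sub>R z) ^ N"
proof -
  have "norm (resolvents r (coords_rep (2 * N)) z) = norm (\<Prod>i\<in>UNIV. resolvent r i z) ^ (2 * N)"
    by (simp add: resolvents_def prod_list_coords_rep norm_power)
  also have "\<dots> = (\<Prod>i\<in>UNIV. (norm (resolvent r i z))\<^sup>2) ^ N"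
    unfolding power_mult by (simp only: prod_norm[symmetric] prod_power_distrib)
  also have "(\<lambda>i. (norm (resolvent r i z))\<^sup>2) = (\<lambda>i. 1 / (1 + (r * z $ i)\<^sup>2))"
    unfolding resolvent_def norm_divide norm_one_plus_i by (simp add: power_divide add_nonneg_nonneg)
  finally show ?thesis by (simp add: pweight_def)
qed

subsection \<open>The inner oscillatory integral\<close>

text \<open>
  For \<open>p = (y, \<zeta>, \<eta>)\<close> the amplitude is \<open>\<tau> (y + z, \<theta> - \<zeta> - \<eta>, \<eta>)\<close>; the function \<open>u\<close> carries the factors that
  make the integral over \<open>z\<close> converge.
\<close>

definition osc_integrand :: "(real ^ 'n \<Rightarrow> complex) \<Rightarrow> ('n::finite) bisymbol \<Rightarrow>
    'n point \<Rightarrow> real ^ 'n \<Rightarrow> real ^ 'n \<Rightarrow> complex" where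
  "osc_integrand u \<tau> p \<theta> z = iexp (z \<bullet> \<theta>) * u z *
     \<tau> (fst p + z, \<theta> - fst (snd p) - snd (snd p), snd (snd p))"

definition osc_inner :: "(real ^ 'n \<Rightarrow> complex) \<Rightarrow> ('n::finite) bisymbol \<Rightarrow>
    'n point \<Rightarrow> real ^ 'n \<Rightarrow> complex" where
  "osc_inner u \<tau> p \<theta> = (LINT z|lborel. osc_integrand u \<tau> p \<theta> z)"

text \<open>The size of the frequencies at which the amplitude is evaluated, to be compared with the
  size of the frequencies \<zeta>, \<eta> in \<open>p\<close>.\<close>

definition freq_weight :: "'n point \<Rightarrow> real ^ 'n::finite \<Rightarrow> real" where
  "freq_weight p \<theta> = japanese (\<theta> - fst (snd p) - snd (snd p)) (snd (snd p))"

lemma freq_weight_ge_1: "1 \<le> freq_weight p \<theta>" and freq_weight_pos: "0 < freq_weight p \<theta>"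
  by (simp_all add: freq_weight_def japanese_ge_1 japanese_pos)

lemma is_symbol_continuous: "is_symbol \<rho> \<delta> a \<tau> \<Longrightarrow> continuous_on UNIV \<tau>"
  and is_symbol_differentiable: "is_symbol \<rho> \<delta> a \<tau> \<Longrightarrow> \<tau> differentiable (at q)"
  and is_symbol_smooth: "is_symbol \<rho> \<delta> a \<tau> \<Longrightarrow> smooth \<tau>"
  unfolding is_symbol_def by (auto intro: weighted_smooth_continuous weighted_smooth_differentiable weighted_smooth_smooth)

lemma is_symbol_dir_deriv: "is_symbol \<rho> \<delta> a \<tau> \<Longrightarrow> b \<in> Basis \<Longrightarrow> is_symbol \<rho> \<delta> (a + symbol_order \<rho> \<delta> b) (dir_deriv b \<tau>)"
  unfolding is_symbol_def by (rule weighted_smooth_dir_deriv)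

lemma is_symbol_boundE:
  assumes "is_symbol \<rho> \<delta> a \<tau>"
  obtains C where "0 \<le> C" "\<And>q. norm (\<tau> q) \<le> C * symbol_weight a q"
proof -
  from weighted_smooth_bound[OF assms[unfolded is_symbol_def]] obtain C where C: "\<And>q. norm (\<tau> q) \<le> C * symbol_weight a q" by blast
  show ?thesis
  proof (rule that[of C])
    show "0 \<le> C" using order_trans[OF norm_ge_zero C[of 0]] by (simp add: symbol_weight_def japanese_def)
  qed (rule C)
qed

text \<open>The constant is chosen before \<open>r\<close>. This uniformity matters because the
  scale will later depend on \<open>p\<close>.\<close>

lemma osc_integrand_bound_scaled:
  assumes u: "decay 1 u" and t: "is_symbol \<rho> \<delta> a \<tau>"
  shows "\<exists>C\<ge>0. \<forall>p \<theta> r z. norm (osc_integrand (\<lambda>z. u (r *\<^sub>R z)) \<tau> p \<theta> z) \<le> C * pweight (r *\<^sub>R z) * freq_weight p \<theta> powr a"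
proof -
  obtain C1 where C1: "0 \<le> C1" "\<And>z. norm (u z) \<le> C1 * pweight z" using decay_boundE[OF u] by auto
  obtain C2 where C2: "0 \<le> C2" "\<And>q. norm (\<tau> q) \<le> C2 * symbol_weight a q" by (rule is_symbol_boundE[OF t]) blast
  have "norm (osc_integrand (\<lambda>z. u (r *\<^sub>R z)) \<tau> p \<theta> z) \<le> C1 * C2 * pweight (r *\<^sub>R z) * freq_weight p \<theta> powr a" for p r and \<theta> z :: "real ^ 'a"
  proof -
    have "norm (osc_integrand (\<lambda>z. u (r *\<^sub>R z)) \<tau> p \<theta> z)
        = norm (u (r *\<^sub>R z)) * norm (\<tau> (fst p + z, \<theta> - fst (snd p) - snd (snd p), snd (snd p)))"
      by (simp add: osc_integrand_def norm_mult)
    also have "\<dots> \<le> (C1 * pweight (r *\<^sub>R z)) * (C2 * symbol_weight a (fst p + z, \<theta> - fst (snd p) - snd (snd p), snd (snd p)))"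
      using C1 C2 by (intro mult_mono) auto
    also have "symbol_weight a (fst p + z, \<theta> - fst (snd p) - snd (snd p), snd (snd p)) = freq_weight p \<theta> powr a"
      by (simp add: symbol_weight_def freq_weight_def)
    finally show ?thesis by (simp add: ac_simps)
  qed
  then show ?thesis using C1 C2 by (intro exI[of _ "C1 * C2"]) auto
qed

lemma osc_integrand_bound:
  assumes u: "decay 1 u" and t: "is_symbol \<rho> \<delta> a \<tau>"
  shows "\<exists>C\<ge>0. \<forall>p \<theta> z. norm (osc_integrand u \<tau> p \<theta> z) \<le> C * pweight z * freq_weight p \<theta> powr a"
proof -
  from osc_integrand_bound_scaled[OF assms] obtain C where "0 \<le> C"
    "\<And>p \<theta> r z. norm (osc_integrand (\<lambda>z. u (r *\<^sub>R z)) \<tau> p \<theta> z) \<le> C * pweight (r *\<^sub>R z) * freq_weight p \<theta> powr a" by blast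
  from this(1) this(2)[where r=1] show ?thesis by auto
qed

lemma continuous_on_comp_UNIV:
  "continuous_on UNIV u \<Longrightarrow> continuous_on A f \<Longrightarrow> continuous_on A (\<lambda>x. u (f x))"
  by (rule continuous_on_compose2) auto

lemma osc_integrand_continuous:
  assumes "continuous_on UNIV u" "continuous_on UNIV \<tau>" "continuous_on A p" "continuous_on A \<theta>" "continuous_on A z"
  shows "continuous_on A (\<lambda>x. osc_integrand u \<tau> (p x) (\<theta> x) (z x))"
  unfolding osc_integrand_def
  by (intro continuous_intros continuous_on_comp_UNIV[OF assms(1)] continuous_on_comp_UNIV[OF assms(2)] assms)

lemma osc_integrand_measurable:
  assumes "decay N u" "is_symbol \<rho> \<delta> a \<tau>"
  shows "osc_integrand u \<tau> p \<theta> \<in> borel_measurable borel"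
  using osc_integrand_continuous[OF decay_continuous[OF assms(1)] is_symbol_continuous[OF assms(2)], of UNIV "\<lambda>_. p" "\<lambda>_. \<theta>" "\<lambda>z. z"]
  by (intro borel_measurable_continuous_onI) (simp add: continuous_on_const continuous_on_id)

lemma osc_integrand_integrable:
  assumes u: "decay 1 u" and t: "is_symbol \<rho> \<delta> a \<tau>"
  shows "integrable lborel (osc_integrand u \<tau> p \<theta>)"
proof -
  from osc_integrand_bound[OF u t] obtain C where C: "0 \<le> C" "\<And>p \<theta> z. norm (osc_integrand u \<tau> p \<theta> z) \<le> C * pweight z * freq_weight p \<theta> powr a"
    by blast
  have "integrable lborel (\<lambda>z. C * pweight z * freq_weight p \<theta> powr a)" by (intro integrable_mult_left integrable_mult_right integrable_pweight)
  then show ?thesis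
    by (rule Bochner_Integration.integrable_bound)
      (use order_trans[OF C(2) abs_ge_self] osc_integrand_measurable[OF u t] in auto)
qed

lemma osc_inner_measurable:
  assumes u: "decay 1 u" and t: "is_symbol \<rho> \<delta> a \<tau>"
    and "continuous_on UNIV p" "continuous_on UNIV \<theta>"
  shows "(\<lambda>x :: 'x::euclidean_space. osc_inner u \<tau> (p x) (\<theta> x)) \<in> borel_measurable borel"
  unfolding osc_inner_def
  by (rule measurable_integral_param)
    (intro osc_integrand_continuous decay_continuous[OF u] is_symbol_continuous[OF t] continuous_intros
      continuous_on_comp_UNIV[OF assms(3)] continuous_on_comp_UNIV[OF assms(4)])

text \<open>The z_j-derivative of the whole integrand has integral zero. Its three terms come from
  the phase, from \<open>u\<close> and from the amplitude, whose space variable is shifted by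
  z.\<close>

lemma osc_inner_ibp:
  assumes u: "decay 1 u" and t: "is_symbol \<rho> \<delta> a \<tau>"
  shows "\<i> * of_real (\<theta> $ j) * osc_inner u \<tau> p \<theta> = - osc_inner (dir_deriv (axis j 1) u) \<tau> p \<theta> - osc_inner u (dir_deriv (unit_x j) \<tau>) p \<theta>"
proof -
  define S where "S = (\<lambda>z. (fst p + z, \<theta> - fst (snd p) - snd (snd p), snd (snd p)))"
  define E where "E = (\<lambda>z. iexp (z \<bullet> \<theta>))"
  define L where "L = (\<lambda>z :: real ^ 'a. (z, 0 :: real ^ 'a, 0 :: real ^ 'a))"
  let ?u' = "dir_deriv (axis j 1) u" and ?t' = "dir_deriv (unit_x j) \<tau>"
  have u': "decay 1 ?u'" by (rule decay_dir_deriv[OF u])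
  have t': "is_symbol \<rho> \<delta> (a + \<delta>) ?t'" using is_symbol_dir_deriv[OF t, of "unit_x j"] by simp
  let ?f = "\<lambda>z. E z * u z * \<tau> (S z)"
  let ?g1 = "\<lambda>z. E z * ?u' z * \<tau> (S z)"
  let ?g2 = "\<lambda>z. E z * u z * ?t' (S z)"
  let ?g = "\<lambda>z. \<i> * of_real (\<theta> $ j) * ?f z + ?g1 z + ?g2 z"
  have linL: "linear L" by (auto simp: L_def intro!: linearI)
  have SL: "S z = (fst p, \<theta> - fst (snd p) - snd (snd p), snd (snd p)) + L z" for z by (simp add: S_def L_def)
  have Lj: "L (axis j 1) = unit_x j" by (simp add: L_def unit_x_def)
  have dE: "(E has_derivative (\<lambda>v. \<i> * of_real (v \<bullet> \<theta>) * E z)) (at z)" for z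
  proof -
    have "((\<lambda>z. \<i> * complex_of_real (z \<bullet> \<theta>)) has_derivative (\<lambda>v. \<i> * of_real (v \<bullet> \<theta>))) (at z)"
      by (auto intro!: derivative_eq_intros)
    from has_derivative_compose[OF this DERIV_exp[unfolded has_field_derivative_def]]
    show ?thesis unfolding E_def by (simp add: mult.commute)
  qed
  have dS: "(\<lambda>z. \<tau> (S z)) differentiable (at z)" for z
  proof -
    have "S differentiable (at z)" unfolding S_def
      by (intro differentiable_Pair differentiable_add differentiable_const differentiable_ident)
    moreover have "\<tau> differentiable (at (S z))" by (rule is_symbol_differentiable[OF t])
    ultimately show ?thesis using differentiable_chain_at unfolding comp_def by blast
  qed
  have deriv: "((\<lambda>s. ?f (z + s *\<^sub>R axis j 1)) has_vector_derivative ?g z) (at 0)" for z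
  proof -
    have E1: "((\<lambda>s. E (z + s *\<^sub>R axis j 1)) has_vector_derivative \<i> * of_real (\<theta> $ j) * E z) (at 0)"
      using has_vector_derivative_line[of E _ z 0 "axis j 1", OF dE[of "z + 0 *\<^sub>R axis j 1"]]
      by (simp add: inner_axis')
    have U1: "((\<lambda>s. u (z + s *\<^sub>R axis j 1)) has_vector_derivative ?u' z) (at 0)"
      using dir_deriv_line[of u z 0 "axis j 1"] decay_differentiable[OF u] by simp
    have T1: "((\<lambda>s. \<tau> (S (z + s *\<^sub>R axis j 1))) has_vector_derivative ?t' (S z)) (at 0)"
      using dir_deriv_line[of "\<lambda>z. \<tau> (S z)" z 0 "axis j 1"] dS
        dir_deriv_linear_comp[OF linL, of "axis j 1" \<tau> "(fst p, \<theta> - fst (snd p) - snd (snd p), snd (snd p))" z]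
      by (simp add: SL[symmetric] Lj)
    show ?thesis
      by (rule has_vector_derivative_eq_rhs[OF has_vector_derivative_mult[OF has_vector_derivative_mult[OF E1 U1] T1]])
        (simp add: algebra_simps)
  qed
  have fh: "osc_integrand u \<tau> p \<theta> = ?f" "osc_integrand ?u' \<tau> p \<theta> = ?g1" "osc_integrand u ?t' p \<theta> = ?g2"
    by (auto simp: osc_integrand_def E_def S_def)
  from osc_integrand_bound[OF u t] obtain C0 where "0 \<le> C0" "\<And>p \<theta> z. norm (osc_integrand u \<tau> p \<theta> z) \<le> C0 * pweight z * freq_weight p \<theta> powr a"
    by blast
  from this(1) this(2)[of p \<theta>, unfolded fh]
  have C0: "0 \<le> C0" "\<And>z. norm (?f z) \<le> C0 * pweight z * freq_weight p \<theta> powr a" .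
  from osc_integrand_bound[OF u' t] obtain C1 where "0 \<le> C1" "\<And>p \<theta> z. norm (osc_integrand ?u' \<tau> p \<theta> z) \<le> C1 * pweight z * freq_weight p \<theta> powr a"
    by blast
  from this(1) this(2)[of p \<theta>, unfolded fh]
  have C1: "0 \<le> C1" "\<And>z. norm (?g1 z) \<le> C1 * pweight z * freq_weight p \<theta> powr a" .
  from osc_integrand_bound[OF u t'] obtain C2 where "0 \<le> C2" "\<And>p \<theta> z. norm (osc_integrand u ?t' p \<theta> z) \<le> C2 * pweight z * freq_weight p \<theta> powr (a + \<delta>)"
    by blast
  from this(1) this(2)[of p \<theta>, unfolded fh]
  have C2: "0 \<le> C2" "\<And>z. norm (?g2 z) \<le> C2 * pweight z * freq_weight p \<theta> powr (a + \<delta>)" .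
  \<comment> \<open>A common constant for the integrand and its derivative; it may depend on
    \<open>p\<close> and \<theta>, which are fixed here.\<close>
  define K where "K = C0 * freq_weight p \<theta> powr a + \<bar>\<theta> $ j\<bar> * (C0 * freq_weight p \<theta> powr a) + C1 * freq_weight p \<theta> powr a + C2 * freq_weight p \<theta> powr (a + \<delta>)"
  have b: "norm (?f z) \<le> K * pweight z" "norm (?g z) \<le> K * pweight z" for z
  proof -
    have n: "0 \<le> C0 * freq_weight p \<theta> powr a * pweight z" "0 \<le> C1 * freq_weight p \<theta> powr a * pweight z" "0 \<le> C2 * freq_weight p \<theta> powr (a + \<delta>) * pweight z"
      using C0 C1 C2 by simp_all
    have f: "norm (\<i> * of_real (\<theta> $ j) * ?f z) \<le> \<bar>\<theta> $ j\<bar> * (C0 * pweight z * freq_weight p \<theta> powr a)"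
      unfolding norm_mult[of "\<i> * _"] using C0(2)[of z] by (simp add: norm_mult mult_left_mono)
    have n2: "0 \<le> \<bar>\<theta> $ j\<bar> * (C0 * pweight z * freq_weight p \<theta> powr a)" using C0 by simp
    show "norm (?f z) \<le> K * pweight z"
      using C0(2)[of z] n n2 by (simp add: K_def algebra_simps)
    have "norm (?g z) \<le> norm (\<i> * of_real (\<theta> $ j) * ?f z) + norm (?g1 z) + norm (?g2 z)"
      by (intro norm_triangle_le add_mono) auto
    also have "\<dots> \<le> \<bar>\<theta> $ j\<bar> * (C0 * pweight z * freq_weight p \<theta> powr a) + C1 * pweight z * freq_weight p \<theta> powr a + C2 * pweight z * freq_weight p \<theta> powr (a + \<delta>)"
      by (intro add_mono f C1 C2)
    also have "\<dots> \<le> K * pweight z" using n by (simp add: K_def algebra_simps)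
    finally show "norm (?g z) \<le> K * pweight z" .
  qed
  have m: "?f \<in> borel_measurable borel" "?g1 \<in> borel_measurable borel" "?g2 \<in> borel_measurable borel"
    using osc_integrand_measurable[OF u t, of p \<theta>] osc_integrand_measurable[OF u' t, of p \<theta>] osc_integrand_measurable[OF u t', of p \<theta>]
    by (simp_all only: fh)
  have "integral\<^sup>L lborel ?g = 0"
    by (rule integral_dir_deriv_zero[OF deriv b]) (use m in auto)
  moreover have "integral\<^sup>L lborel ?g = \<i> * of_real (\<theta> $ j) * osc_inner u \<tau> p \<theta> + osc_inner ?u' \<tau> p \<theta> + osc_inner u ?t' p \<theta>"
    using osc_integrand_integrable[OF u t, of p \<theta>] osc_integrand_integrable[OF u' t, of p \<theta>] osc_integrand_integrable[OF u t', of p \<theta>]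
    unfolding osc_inner_def fh by simp
  ultimately show ?thesis by (simp add: algebra_simps eq_neg_iff_add_eq_0)
qed

section \<open>Decay of the inner integral by integration by parts in z\<close>

lemma norm_integral_le:
  fixes f :: "'a \<Rightarrow> complex"
  assumes "integrable M g" "\<And>x. norm (f x) \<le> g x"
  shows "norm (integral\<^sup>L M f) \<le> integral\<^sup>L M g"
proof (cases "integrable M f")
  case True
  have "norm (integral\<^sup>L M f) \<le> (LINT x|M. norm (f x))" by (rule integral_norm_bound)
  also have "\<dots> \<le> integral\<^sup>L M g"
    using True assms by (intro integral_mono) auto
  finally show ?thesis .
next
  \<comment> \<open>The integral of a non-integrable function is 0 by convention, and the right-hand
    side is nonnegative because \<open>g\<close> dominates a norm.\<close>
  case False
  have "0 \<le> integral\<^sup>L M g" by (rule integral_nonneg_AE) (use assms(2) order_trans[OF norm_ge_zero] in blast)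
  then show ?thesis using False by (simp add: not_integrable_integral_eq)
qed

lemma dir_deriv_scale:
  fixes u :: "'a::euclidean_space \<Rightarrow> complex"
  assumes "\<And>z. u differentiable (at z)"
  shows "dir_deriv v (\<lambda>z. u (r *\<^sub>R z)) = (\<lambda>z. of_real r * dir_deriv v u (r *\<^sub>R z))"
proof
  fix z
  have "linear (\<lambda>z :: 'a. r *\<^sub>R z)" by (rule linear_scaleR)
  then show "dir_deriv v (\<lambda>z. u (r *\<^sub>R z)) z = of_real r * dir_deriv v u (r *\<^sub>R z)"
    by (simp add: dir_deriv_linear_comp0 dir_deriv_scaleR[OF assms] scaleR_conv_of_real)
qed

lemma pweight_scale_le: "1 \<le> \<bar>r\<bar> \<Longrightarrow> pweight (r *\<^sub>R z) \<le> pweight z"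
  unfolding pweight_def
proof (rule prod_mono)
  fix i assume r: "1 \<le> \<bar>r\<bar>"
  have "1 * (z $ i)\<^sup>2 \<le> r\<^sup>2 * (z $ i)\<^sup>2" using r by (intro mult_right_mono) (auto simp: abs_square_le_1 one_le_power[of "\<bar>r\<bar>" 2, simplified])
  then show "0 \<le> 1 / (1 + ((r *\<^sub>R z) $ i)\<^sup>2) \<and> 1 / (1 + ((r *\<^sub>R z) $ i)\<^sup>2) \<le> 1 / (1 + (z $ i)\<^sup>2)"
    by (auto simp: power_mult_distrib intro!: divide_left_mono mult_pos_pos add_pos_nonneg)
qed

text \<open>Shrinking the argument by \<open>c\<close> enlarges each coordinate factor by at most
  c^(-2).\<close>

lemma pweight_scale_ge:
  fixes z :: "real ^ 'n::finite"
  assumes "0 < c" "c \<le> 1"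
  shows "pweight (c *\<^sub>R z) \<le> (1 / c ^ (2 * CARD('n))) * pweight z"
proof -
  have "(\<Prod>i\<in>UNIV. 1 / (1 + ((c *\<^sub>R z) $ i)\<^sup>2)) \<le> (\<Prod>i\<in>UNIV. (1 / c\<^sup>2) * (1 / (1 + (z $ i)\<^sup>2)))"
  proof (rule prod_mono)
    fix i
    have "c\<^sup>2 \<le> 1" using assms by (simp add: power_le_one)
    then have "c\<^sup>2 * (1 + (z $ i)\<^sup>2) \<le> 1 + ((c *\<^sub>R z) $ i)\<^sup>2" by (simp add: power_mult_distrib algebra_simps)
    then have "1 / (1 + ((c *\<^sub>R z) $ i)\<^sup>2) \<le> 1 / (c\<^sup>2 * (1 + (z $ i)\<^sup>2))"
      using assms by (intro divide_left_mono mult_pos_pos add_pos_nonneg) auto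
    then show "0 \<le> 1 / (1 + ((c *\<^sub>R z) $ i)\<^sup>2) \<and> 1 / (1 + ((c *\<^sub>R z) $ i)\<^sup>2) \<le> (1 / c\<^sup>2) * (1 / (1 + (z $ i)\<^sup>2))"
      by simp
  qed
  then show ?thesis unfolding pweight_def prod.distrib by (simp add: power_mult power_one_over)
qed

lemma decay_scale:
  fixes u :: "real ^ 'n::finite \<Rightarrow> complex"
  assumes "decay 1 u" "1 \<le> r"
  shows "decay 1 (\<lambda>z. u (r *\<^sub>R z))"
proof -
  have "\<forall>z :: real ^ 'n. pweight (0 + r *\<^sub>R z) ^ 1 \<le> 1 * pweight z ^ 1" using assms(2) by (simp add: pweight_scale_le)
  then have "\<exists>K\<ge>0. \<forall>z :: real ^ 'n. pweight (0 + r *\<^sub>R z) ^ 1 \<le> K * pweight z ^ 1" using zero_le_one by blast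
  from weighted_smooth_affine[OF linear_scaleR _ _ this, of UNIV "\<lambda>_. 0" "\<lambda>_. 0" 0 u] assms(1) show ?thesis
    unfolding decay_def by auto
qed

lemma osc_inner_diff:
  assumes "decay 1 u" "is_symbol \<rho> \<delta> a \<tau>" "is_symbol \<rho>' \<delta>' a' \<tau>'"
  shows "osc_inner u (\<lambda>q. \<tau> q - c * \<tau>' q) p \<theta> = osc_inner u \<tau> p \<theta> - c * osc_inner u \<tau>' p \<theta>"
proof -
  have "osc_integrand u (\<lambda>q. \<tau> q - c * \<tau>' q) p \<theta> = (\<lambda>z. osc_integrand u \<tau> p \<theta> z - c * osc_integrand u \<tau>' p \<theta> z)"
    by (simp add: osc_integrand_def fun_eq_iff algebra_simps)
  then show ?thesis
    using osc_integrand_integrable[OF assms(1,2)] osc_integrand_integrable[OF assms(1,3)] by (simp add: osc_inner_def)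
qed

lemma osc_inner_cmult_left: "osc_inner (\<lambda>z. c * u z) \<tau> p \<theta> = c * osc_inner u \<tau> p \<theta>"
proof -
  have "osc_integrand (\<lambda>z. c * u z) \<tau> p \<theta> = (\<lambda>z. c * osc_integrand u \<tau> p \<theta> z)"
    by (simp add: osc_integrand_def fun_eq_iff algebra_simps)
  then show ?thesis by (simp add: osc_inner_def)
qed

lemma osc_inner_add_left:
  assumes "decay 1 u" "decay 1 v" "is_symbol \<rho> \<delta> a \<tau>"
  shows "osc_inner (\<lambda>z. u z + v z) \<tau> p \<theta> = osc_inner u \<tau> p \<theta> + osc_inner v \<tau> p \<theta>"
proof -
  have "osc_integrand (\<lambda>z. u z + v z) \<tau> p \<theta> = (\<lambda>z. osc_integrand u \<tau> p \<theta> z + osc_integrand v \<tau> p \<theta> z)"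
    by (simp add: osc_integrand_def fun_eq_iff algebra_simps)
  then show ?thesis
    using osc_integrand_integrable[OF assms(1,3)] osc_integrand_integrable[OF assms(2,3)] by (simp add: osc_inner_def)
qed

lemma integral_pweight_scale:
  fixes r :: real
  assumes "0 < r"
  shows "integrable lborel (\<lambda>z :: real ^ 'n::finite. pweight (r *\<^sub>R z))"
    and "(LINT z|lborel. pweight (r *\<^sub>R (z :: real ^ 'n))) = integral\<^sup>L lborel (pweight :: real ^ 'n \<Rightarrow> real) / r ^ CARD('n)"
  using lborel_affine_transform[of r "pweight :: real ^ 'n \<Rightarrow> real" 0] integrable_pweight[where 'n='n] assms
  by (auto simp: field_simps)

text \<open>The weight at scale \<open>r\<close> has an integral smaller by r^(-n). This gain has to
  be kept: it compensates the later integration over \<theta> at the same scale.\<close>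

lemma osc_inner_base:
  fixes u :: "real ^ 'n::finite \<Rightarrow> complex"
  assumes u: "decay 1 u" and t: "is_symbol \<rho> \<delta> a \<tau>"
  shows "\<exists>C\<ge>0. \<forall>p \<theta> r. 1 \<le> r \<longrightarrow> norm (osc_inner (\<lambda>z. u (r *\<^sub>R z)) \<tau> p \<theta>) \<le> C * freq_weight p \<theta> powr a / r ^ CARD('n)"
proof -
  from osc_integrand_bound_scaled[OF assms] obtain C where C: "0 \<le> C"
    "\<And>p \<theta> r z. norm (osc_integrand (\<lambda>z. u (r *\<^sub>R z)) \<tau> p \<theta> z) \<le> C * pweight (r *\<^sub>R z) * freq_weight p \<theta> powr a" by blast
  let ?I = "integral\<^sup>L lborel (pweight :: real ^ 'n \<Rightarrow> real)"
  have I: "0 \<le> ?I" by (rule integral_nonneg_AE) simp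
  have "norm (osc_inner (\<lambda>z. u (r *\<^sub>R z)) \<tau> p \<theta>) \<le> (C * ?I) * freq_weight p \<theta> powr a / r ^ CARD('n)" if r: "1 \<le> r" for p \<theta> r
  proof -
    have r0: "0 < r" using r by simp
    have "norm (osc_inner (\<lambda>z. u (r *\<^sub>R z)) \<tau> p \<theta>) \<le> (LINT z :: real ^ 'n|lborel. C * pweight (r *\<^sub>R z) * freq_weight p \<theta> powr a)"
      unfolding osc_inner_def
      by (rule norm_integral_le)
        (use C integral_pweight_scale(1)[OF r0] in \<open>auto intro!: integrable_mult_left integrable_mult_right\<close>)
    also have "\<dots> = C * (?I / r ^ CARD('n)) * freq_weight p \<theta> powr a"
      by (simp only: integral_mult_left_zero integral_mult_right_zero integral_pweight_scale(2)[OF r0])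
    finally show ?thesis by simp
  qed
  moreover have "0 \<le> C * ?I" using I C by simp
  ultimately show ?thesis by blast
qed

text \<open>The reciprocal modulus of \<open>resolvents s js \<theta>\<close>: the weight in
  \<theta> gained by one integration by parts in z for each entry of \<open>js\<close>, at scale
  \<open>s\<close>.\<close>

definition bracket_prod :: "real \<Rightarrow> 'n::finite list \<Rightarrow> real ^ 'n \<Rightarrow> real" where
  "bracket_prod s js \<theta> = prod_list (map (\<lambda>j. norm (1 + \<i> * complex_of_real (s * \<theta> $ j))) js)"

lemma bracket_prod_simps [simp]: "bracket_prod s [] \<theta> = 1"
  "bracket_prod s (j # js) \<theta> = norm (1 + \<i> * complex_of_real (s * \<theta> $ j)) * bracket_prod s js \<theta>"
  by (simp_all add: bracket_prod_def)

lemma bracket_prod_nonneg: "0 \<le> bracket_prod s js \<theta>"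
  by (induction js) auto

text \<open>Multiplying by 1 + i s \<theta>_j and integrating by parts leaves the integral itself, s
  r times the one with \<open>u\<close> differentiated, and s times the one with the amplitude
  differentiated in space. The conditions on \<open>s\<close> make both coefficients harmless. The
  induction has to vary \<open>u\<close>, \<open>\<tau>\<close> and the order, since the derivatives
  replace them.\<close>

lemma osc_inner_decay:
  fixes u :: "real ^ 'n::finite \<Rightarrow> complex"
  assumes "decay 1 u" and "is_symbol \<rho> \<delta> a \<tau>"
  shows "\<exists>C\<ge>0. \<forall>p \<theta> r s. 1 \<le> r \<longrightarrow> 0 \<le> s \<longrightarrow> s * r \<le> 1 \<longrightarrow> s * freq_weight p \<theta> powr \<delta> \<le> 1 \<longrightarrow>
      norm (osc_inner (\<lambda>z. u (r *\<^sub>R z)) \<tau> p \<theta>) * bracket_prod s js \<theta> \<le> C * freq_weight p \<theta> powr a / r ^ CARD('n)"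
  using assms
proof (induction js arbitrary: u a \<tau>)
  case Nil
  from osc_inner_base[OF this] show ?case by auto
next
  case (Cons j js)
  note u = Cons.prems(1) and t = Cons.prems(2)
  let ?u' = "dir_deriv (axis j 1) u" and ?t' = "dir_deriv (unit_x j) \<tau>"
  have u': "decay 1 ?u'" by (rule decay_dir_deriv[OF u])
  have t': "is_symbol \<rho> \<delta> (a + \<delta>) ?t'" using is_symbol_dir_deriv[OF t, of "unit_x j"] by simp
  from Cons.IH[OF u t] obtain C0 where C0: "0 \<le> C0" "\<And>p \<theta> r s. 1 \<le> r \<Longrightarrow> 0 \<le> s \<Longrightarrow> s * r \<le> 1 \<Longrightarrow> s * freq_weight p \<theta> powr \<delta> \<le> 1 \<Longrightarrow>
      norm (osc_inner (\<lambda>z. u (r *\<^sub>R z)) \<tau> p \<theta>) * bracket_prod s js \<theta> \<le> C0 * freq_weight p \<theta> powr a / r ^ CARD('n)" by blast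
  from Cons.IH[OF u' t] obtain C1 where C1: "0 \<le> C1" "\<And>p \<theta> r s. 1 \<le> r \<Longrightarrow> 0 \<le> s \<Longrightarrow> s * r \<le> 1 \<Longrightarrow> s * freq_weight p \<theta> powr \<delta> \<le> 1 \<Longrightarrow>
      norm (osc_inner (\<lambda>z. ?u' (r *\<^sub>R z)) \<tau> p \<theta>) * bracket_prod s js \<theta> \<le> C1 * freq_weight p \<theta> powr a / r ^ CARD('n)" by blast
  from Cons.IH[OF u t'] obtain C2 where C2: "0 \<le> C2" "\<And>p \<theta> r s. 1 \<le> r \<Longrightarrow> 0 \<le> s \<Longrightarrow> s * r \<le> 1 \<Longrightarrow> s * freq_weight p \<theta> powr \<delta> \<le> 1 \<Longrightarrow>
      norm (osc_inner (\<lambda>z. u (r *\<^sub>R z)) ?t' p \<theta>) * bracket_prod s js \<theta> \<le> C2 * freq_weight p \<theta> powr (a + \<delta>) / r ^ CARD('n)" by blast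
  have "norm (osc_inner (\<lambda>z. u (r *\<^sub>R z)) \<tau> p \<theta>) * bracket_prod s (j # js) \<theta> \<le> (C0 + C1 + C2) * freq_weight p \<theta> powr a / r ^ CARD('n)"
    if c: "1 \<le> r" "0 \<le> s" "s * r \<le> 1" "s * freq_weight p \<theta> powr \<delta> \<le> 1" for p \<theta> r s
  proof -
    let ?H = "osc_inner (\<lambda>z. u (r *\<^sub>R z)) \<tau> p \<theta>"
    let ?H1 = "osc_inner (\<lambda>z. ?u' (r *\<^sub>R z)) \<tau> p \<theta>"
    let ?H2 = "osc_inner (\<lambda>z. u (r *\<^sub>R z)) ?t' p \<theta>"
    let ?B = "bracket_prod s js \<theta>"
    have B: "0 \<le> ?B" by (rule bracket_prod_nonneg)
    have A: "\<i> * of_real (\<theta> $ j) * ?H = - (of_real r * ?H1) - ?H2"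
      using osc_inner_ibp[OF decay_scale[OF u c(1)] t, of \<theta> j p]
      unfolding dir_deriv_scale[OF decay_differentiable[OF u]] osc_inner_cmult_left .
    have D: "(1 + \<i> * complex_of_real (s * \<theta> $ j)) * ?H = ?H + of_real s * (\<i> * of_real (\<theta> $ j) * ?H)"
      by (simp add: algebra_simps)
    have "(1 + \<i> * complex_of_real (s * \<theta> $ j)) * ?H = ?H - of_real (s * r) * ?H1 - of_real s * ?H2"
      unfolding D A by (simp add: algebra_simps)
    then have "norm (1 + \<i> * complex_of_real (s * \<theta> $ j)) * norm ?H = norm (?H - of_real (s * r) * ?H1 - of_real s * ?H2)"
      by (metis norm_mult)
    also have "\<dots> \<le> norm ?H + norm (of_real (s * r) * ?H1) + norm (of_real s * ?H2)"
      by (intro order_trans[OF norm_triangle_ineq4] add_right_mono norm_triangle_ineq4)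
    also have "\<dots> \<le> norm ?H + 1 * norm ?H1 + s * norm ?H2"
      using c mult_right_mono[OF c(3), of "norm ?H1"] by (intro add_mono) (auto simp: norm_mult abs_mult)
    finally have "norm (1 + \<i> * complex_of_real (s * \<theta> $ j)) * norm ?H * ?B \<le> (norm ?H + 1 * norm ?H1 + s * norm ?H2) * ?B"
      by (rule mult_right_mono) (rule B)
    also have "\<dots> = norm ?H * ?B + norm ?H1 * ?B + s * (norm ?H2 * ?B)" by (simp add: algebra_simps)
    also have "\<dots> \<le> C0 * freq_weight p \<theta> powr a / r ^ CARD('n) + C1 * freq_weight p \<theta> powr a / r ^ CARD('n)
        + s * (C2 * freq_weight p \<theta> powr (a + \<delta>) / r ^ CARD('n))"
      by (intro add_mono mult_left_mono C0 C1 C2 c)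
    \<comment> \<open>The space derivative has raised the order by \<delta>; the factor
      \<open>s\<close> pays for exactly this surplus.\<close>
    also have "s * (C2 * freq_weight p \<theta> powr (a + \<delta>) / r ^ CARD('n)) =
        (s * freq_weight p \<theta> powr \<delta>) * (C2 * freq_weight p \<theta> powr a / r ^ CARD('n))"
      by (simp add: powr_add)
    also have "\<dots> \<le> 1 * (C2 * freq_weight p \<theta> powr a / r ^ CARD('n))"
      using C2 c by (intro mult_right_mono) auto
    finally show ?thesis by (simp add: algebra_simps add_divide_distrib)
  qed
  then show ?case using C0 C1 C2 by (intro exI[of _ "C0 + C1 + C2"]) auto
qed

section \<open>The first-order operators that accompany the resolvents\<close>

definition xi_op :: "real \<Rightarrow> 'n \<Rightarrow> ('n::finite) bisymbol \<Rightarrow> 'n bisymbol" where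
  "xi_op r j \<tau> = (\<lambda>q. \<tau> q - of_real r * dir_deriv (unit_xi j) \<tau> q)"

definition xi_ops :: "real \<Rightarrow> 'n list \<Rightarrow> ('n::finite) bisymbol \<Rightarrow> 'n bisymbol" where
  "xi_ops r js \<tau> = foldr (xi_op r) js \<tau>"

lemma xi_ops_simps [simp]: "xi_ops r [] \<tau> = \<tau>" "xi_ops r (j # js) \<tau> = xi_op r j (xi_ops r js \<tau>)"
  by (simp_all add: xi_ops_def)

lemma is_symbol_diff: "is_symbol \<rho> \<delta> a \<tau> \<Longrightarrow> is_symbol \<rho> \<delta> a \<tau>' \<Longrightarrow> is_symbol \<rho> \<delta> a (\<lambda>q. \<tau> q - \<tau>' q)"
  and is_symbol_cmult: "is_symbol \<rho> \<delta> a \<tau> \<Longrightarrow> is_symbol \<rho> \<delta> a (\<lambda>q. c * \<tau> q)"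
  unfolding is_symbol_def by (auto intro: weighted_smooth_diff weighted_smooth_cmult)

lemma is_symbol_weaken:
  assumes "is_symbol \<rho> \<delta> a \<tau>" "a \<le> b"
  shows "is_symbol \<rho> \<delta> b \<tau>"
proof -
  have "symbol_weight a' q \<le> symbol_weight (a' + (b - a)) q" for a' and q :: "'a point"
    unfolding symbol_weight_def by (rule powr_mono) (use assms japanese_ge_1 in auto)
  from weighted_smooth_weaken[OF symbol_weight_nonneg this assms(1)[unfolded is_symbol_def]] show ?thesis by (simp add: is_symbol_def)
qed

lemma is_symbol_xi_op: "0 \<le> \<rho> \<Longrightarrow> is_symbol \<rho> \<delta> a \<tau> \<Longrightarrow> is_symbol \<rho> \<delta> a (xi_op r j \<tau>)"
  unfolding xi_op_def
  using is_symbol_weaken[OF is_symbol_dir_deriv[of \<rho> \<delta> a \<tau> "unit_xi j"], of a] by (auto intro!: is_symbol_diff is_symbol_cmult)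

lemma is_symbol_xi_ops: "0 \<le> \<rho> \<Longrightarrow> is_symbol \<rho> \<delta> a \<tau> \<Longrightarrow> is_symbol \<rho> \<delta> a (xi_ops r js \<tau>)"
  by (induction js) (auto intro: is_symbol_xi_op)

lemma dir_deriv_xi_op:
  assumes "is_symbol \<rho> \<delta> a \<tau>" "b \<in> Basis"
  shows "dir_deriv b (xi_op r j \<tau>) = xi_op r j (dir_deriv b \<tau>)"
proof -
  have d: "\<tau> differentiable (at q)" "dir_deriv (unit_xi j) \<tau> differentiable (at q)" for q
    using is_symbol_differentiable[OF assms(1)] is_symbol_differentiable[OF is_symbol_dir_deriv[OF assms(1)]] by auto
  show ?thesis unfolding xi_op_def
    by (simp add: dir_deriv_diff' d dir_deriv_cmult' differentiable_mult
        smooth_dir_deriv_commute[OF is_symbol_smooth[OF assms(1)] assms(2)])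
qed

lemma dir_deriv_xi_ops:
  assumes "0 \<le> \<rho>" "is_symbol \<rho> \<delta> a \<tau>" "b \<in> Basis"
  shows "dir_deriv b (xi_ops r js \<tau>) = xi_ops r js (dir_deriv b \<tau>)"
  by (induction js) (simp_all add: dir_deriv_xi_op[OF is_symbol_xi_ops[OF assms(1,2)] assms(3)])

lemma xi_op_commute:
  assumes "is_symbol \<rho> \<delta> a \<tau>"
  shows "xi_op r j (xi_op s k \<tau>) = xi_op s k (xi_op r j \<tau>)"
proof -
  have "dir_deriv (unit_xi j) (dir_deriv (unit_xi k) \<tau>) = dir_deriv (unit_xi k) (dir_deriv (unit_xi j) \<tau>)"
    by (rule smooth_dir_deriv_commute[OF is_symbol_smooth[OF assms]]) auto
  then show ?thesis
    using dir_deriv_xi_op[OF assms, of "unit_xi j" s k] dir_deriv_xi_op[OF assms, of "unit_xi k" r j]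
    by (simp add: xi_op_def[of r j "xi_op s k \<tau>"] xi_op_def[of s k "xi_op r j \<tau>"]) (simp add: xi_op_def algebra_simps)
qed

lemma xi_ops_xi_op_commute:
  assumes "0 \<le> \<rho>" "is_symbol \<rho> \<delta> a \<tau>"
  shows "xi_ops r js (xi_op s k \<tau>) = xi_op s k (xi_ops r js \<tau>)"
  by (induction js) (simp_all add: xi_op_commute[OF is_symbol_xi_ops[OF assms]])

lemma xi_ops_commute:
  assumes "0 \<le> \<rho>" "is_symbol \<rho> \<delta> a \<tau>"
  shows "xi_ops r js (xi_ops s ks \<tau>) = xi_ops s ks (xi_ops r js \<tau>)"
  by (induction ks) (simp_all add: xi_ops_xi_op_commute[OF assms(1) is_symbol_xi_ops[OF assms]])

text \<open>Each \<open>xi_op\<close> is the identity minus \<open>r\<close> times a derivative that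
  lowers the order by \<rho>, and so costs a factor 1 + r w^(-\<rho>), where w is the frequency
  weight. The factor is kept explicit because w is comparable to the weight of \<open>p\<close> only
  for small \<theta>.\<close>

lemma osc_inner_xi_ops_decay:
  fixes u :: "real ^ 'n::finite \<Rightarrow> complex"
  assumes "0 \<le> \<rho>" "decay 1 u" and "is_symbol \<rho> \<delta> a \<tau>"
  shows "\<exists>C\<ge>0. \<forall>p \<theta> r s. 1 \<le> r \<longrightarrow> 0 \<le> s \<longrightarrow> s * r \<le> 1 \<longrightarrow> s * freq_weight p \<theta> powr \<delta> \<le> 1 \<longrightarrow>
      norm (osc_inner (\<lambda>z. u (r *\<^sub>R z)) (xi_ops r js \<tau>) p \<theta>) * bracket_prod s ks \<theta>
        \<le> C * freq_weight p \<theta> powr a * (1 + r * freq_weight p \<theta> powr - \<rho>) ^ length js / r ^ CARD('n)"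
  using assms(3)
proof (induction js arbitrary: a \<tau>)
  case Nil
  from osc_inner_decay[OF assms(2) this] show ?case by simp
next
  case (Cons j js)
  note t = Cons.prems
  let ?t' = "dir_deriv (unit_xi j) \<tau>"
  have t': "is_symbol \<rho> \<delta> (a - \<rho>) ?t'" using is_symbol_dir_deriv[OF t, of "unit_xi j"] by simp
  from Cons.IH[OF t] obtain C0 where C0: "0 \<le> C0" "\<And>p \<theta> r s. 1 \<le> r \<Longrightarrow> 0 \<le> s \<Longrightarrow> s * r \<le> 1 \<Longrightarrow> s * freq_weight p \<theta> powr \<delta> \<le> 1 \<Longrightarrow>
      norm (osc_inner (\<lambda>z. u (r *\<^sub>R z)) (xi_ops r js \<tau>) p \<theta>) * bracket_prod s ks \<theta>
       \<le> C0 * freq_weight p \<theta> powr a * (1 + r * freq_weight p \<theta> powr - \<rho>) ^ length js / r ^ CARD('n)" by blast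
  from Cons.IH[OF t'] obtain C1 where C1: "0 \<le> C1" "\<And>p \<theta> r s. 1 \<le> r \<Longrightarrow> 0 \<le> s \<Longrightarrow> s * r \<le> 1 \<Longrightarrow> s * freq_weight p \<theta> powr \<delta> \<le> 1 \<Longrightarrow>
      norm (osc_inner (\<lambda>z. u (r *\<^sub>R z)) (xi_ops r js ?t') p \<theta>) * bracket_prod s ks \<theta>
       \<le> C1 * freq_weight p \<theta> powr (a - \<rho>) * (1 + r * freq_weight p \<theta> powr - \<rho>) ^ length js / r ^ CARD('n)" by blast
  have "norm (osc_inner (\<lambda>z. u (r *\<^sub>R z)) (xi_ops r (j # js) \<tau>) p \<theta>) * bracket_prod s ks \<theta> \<le>
      (C0 + C1) * freq_weight p \<theta> powr a * (1 + r * freq_weight p \<theta> powr - \<rho>) ^ length (j # js) / r ^ CARD('n)"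
    if c: "1 \<le> r" "0 \<le> s" "s * r \<le> 1" "s * freq_weight p \<theta> powr \<delta> \<le> 1" for p \<theta> r s
  proof -
    let ?H0 = "osc_inner (\<lambda>z. u (r *\<^sub>R z)) (xi_ops r js \<tau>) p \<theta>"
    let ?H1 = "osc_inner (\<lambda>z. u (r *\<^sub>R z)) (xi_ops r js ?t') p \<theta>"
    let ?B = "bracket_prod s ks \<theta>" and ?w = "freq_weight p \<theta>"
    let ?M = "(1 + r * ?w powr - \<rho>) ^ length js"
    have B: "0 \<le> ?B" by (rule bracket_prod_nonneg)
    have M: "0 \<le> ?M" using c by (intro zero_le_power add_nonneg_nonneg) auto
    have "osc_inner (\<lambda>z. u (r *\<^sub>R z)) (xi_ops r (j # js) \<tau>) p \<theta> = ?H0 - of_real r * ?H1"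
      unfolding xi_ops_simps xi_op_def[of r j "xi_ops r js \<tau>"] dir_deriv_xi_ops[OF assms(1) t in_Basis_triple(2)]
      by (rule osc_inner_diff[OF decay_scale[OF assms(2) c(1)] is_symbol_xi_ops[OF assms(1) t] is_symbol_xi_ops[OF assms(1) t']])
    then have "norm (osc_inner (\<lambda>z. u (r *\<^sub>R z)) (xi_ops r (j # js) \<tau>) p \<theta>) * ?B \<le> (norm ?H0 + r * norm ?H1) * ?B"
      using B c norm_triangle_ineq4[of ?H0 "of_real r * ?H1"] by (simp add: norm_mult mult_right_mono)
    also have "\<dots> = norm ?H0 * ?B + r * (norm ?H1 * ?B)" by (simp add: algebra_simps)
    also have "\<dots> \<le> C0 * ?w powr a * ?M / r ^ CARD('n) + r * (C1 * ?w powr (a - \<rho>) * ?M / r ^ CARD('n))"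
      using c by (intro add_mono mult_left_mono C0 C1) auto
    also have "?w powr (a - \<rho>) = ?w powr a * ?w powr - \<rho>" by (simp add: powr_add[symmetric])
    also have "C0 * ?w powr a * ?M / r ^ CARD('n) + r * (C1 * (?w powr a * ?w powr - \<rho>) * ?M / r ^ CARD('n))
        = ?w powr a * ?M / r ^ CARD('n) * (C0 + C1 * (r * ?w powr - \<rho>))"
      by (simp add: algebra_simps add_divide_distrib)
    also have "\<dots> \<le> ?w powr a * ?M / r ^ CARD('n) * ((C0 + C1) * (1 + r * ?w powr - \<rho>))"
      using C0(1) C1(1) M c by (intro mult_left_mono) (auto simp: algebra_simps)
    finally show ?thesis by (simp add: algebra_simps add_divide_distrib)
  qed
  then show ?case using C0 C1 by (intro exI[of _ "C0 + C1"]) auto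
qed

section \<open>Comparison of the two weights for small and for large \<theta>\<close>

definition base_weight :: "('n::finite) point \<Rightarrow> real" where
  "base_weight p = japanese (fst (snd p)) (snd (snd p))"

lemma base_weight_ge_1: "1 \<le> base_weight p" and base_weight_pos: "0 < base_weight p"
  by (simp_all add: base_weight_def japanese_ge_1 japanese_pos)

text \<open>The relation \<xi> = \<theta> - \<zeta> - \<eta> is symmetric in \<xi> and \<zeta>, so
  this estimate and \<open>base_weight_le\<close> hold with the same constants.\<close>

lemma freq_weight_le: "freq_weight p \<theta> \<le> 2 * base_weight p + norm \<theta>"
proof -
  have "norm (\<theta> - fst (snd p) - snd (snd p)) \<le> norm \<theta> + norm (fst (snd p)) + norm (snd (snd p))"
    by (meson add_right_mono norm_triangle_ineq4 order_trans)
  moreover have "1 + d + c \<le> 2 * (1 + b + c) + a'" if "d \<le> a' + b + c" "0 \<le> b" for a' b c d :: real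
    using that by (simp add: algebra_simps)
  ultimately show ?thesis unfolding freq_weight_def base_weight_def japanese_def using norm_ge_zero by blast
qed

lemma base_weight_le: "base_weight p \<le> 2 * freq_weight p \<theta> + norm \<theta>"
proof -
  let ?x = "\<theta> - fst (snd p) - snd (snd p)"
  have "norm (\<theta> - ?x - snd (snd p)) \<le> norm \<theta> + norm ?x + norm (snd (snd p))"
    by (meson add_right_mono norm_triangle_ineq4 order_trans)
  then have "norm (fst (snd p)) \<le> norm \<theta> + norm ?x + norm (snd (snd p))" by simp
  moreover have "1 + d + c \<le> 2 * (1 + b + c) + a'" if "d \<le> a' + b + c" "0 \<le> b" for a' b c d :: real
    using that by (simp add: algebra_simps)
  ultimately show ?thesis unfolding freq_weight_def base_weight_def japanese_def using norm_ge_zero by blast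
qed

lemma powr_abs_bound:
  fixes x K a :: real
  assumes "0 < x" "x \<le> K" "1 / x \<le> K"
  shows "x powr a \<le> K powr \<bar>a\<bar>"
proof (cases "a \<ge> 0")
  case True then show ?thesis using assms by (simp add: powr_mono2)
next
  case False
  then have "x powr a = (1 / x) powr (- a)" using assms by (simp add: powr_divide powr_minus_divide)
  also have "\<dots> \<le> K powr (- a)" using False assms by (intro powr_mono2) auto
  finally show ?thesis using False by simp
qed

text \<open>For |\<theta>| \<le> l / 4 the weights \<open>w\<close> and \<open>l\<close> are
  comparable, so every factor can be rewritten in terms of \<open>l\<close>. Here \<delta> \<le>
  \<rho> enters: r w^(-\<rho>) \<le> (l / w)^\<rho> \<le> 4, whence the base 5 in the
  constant.\<close>

lemma oscillatory_weight_near: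
  fixes l w t a r \<rho> \<delta> :: real and \<theta> :: "real ^ 'n::finite"
  assumes "0 \<le> \<delta>" "\<delta> \<le> \<rho>" "\<rho> \<le> 1" "1 \<le> l" "1 \<le> w" "w \<le> 2 * l + norm \<theta>" "l \<le> 2 * w + norm \<theta>"
    and r: "1 \<le> r" "r \<le> l powr \<delta>" and near: "4 * norm \<theta> \<le> l" and N: "1 \<le> N"
  shows "w powr a * (1 + r * w powr - \<rho>) ^ M * pweight ((2 * (l + norm \<theta>)) powr - \<delta> *\<^sub>R \<theta>) ^ N
     \<le> (4 powr \<bar>a\<bar> * 5 ^ M * 4 ^ (2 * CARD('n))) * l powr a * pweight (l powr - \<delta> *\<^sub>R \<theta>)"
proof -
  let ?t = "norm \<theta>"
  have t0: "0 \<le> ?t" by simp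
  \<comment> \<open>The condition on \<theta> absorbs |\<theta>| into \<open>l\<close> in both
    comparison inequalities; the resulting 9/4 and 8/3 are rounded up to 4.\<close>
  have wl: "w \<le> 4 * l" "l \<le> 4 * w" "0 < l" "0 < w" using assms t0 by linarith+
  have 1: "w powr a \<le> 4 powr \<bar>a\<bar> * l powr a"
  proof -
    have "w powr a = (w / l) powr a * l powr a" using wl by (simp add: powr_divide)
    also have "(w / l) powr a \<le> 4 powr \<bar>a\<bar>"
      using wl by (intro powr_abs_bound) (auto simp: field_simps)
    finally show ?thesis by (simp add: mult_right_mono)
  qed
  have "r * w powr - \<rho> \<le> l powr \<rho> * w powr - \<rho>"
    using r assms order_trans[OF r(2) powr_mono[OF assms(2) assms(4)]] by (intro mult_right_mono) auto
  also have "\<dots> = (l / w) powr \<rho>" using wl by (simp add: powr_divide powr_minus_divide)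
  also have "\<dots> \<le> 4 powr \<rho>" using wl assms by (intro powr_mono2) (auto simp: field_simps)
  also have "\<dots> \<le> 4 powr 1" using assms by (intro powr_mono) auto
  finally have 2: "(1 + r * w powr - \<rho>) ^ M \<le> 5 ^ M"
    using r by (intro power_mono) auto
  \<comment> \<open>The ratio of the scale with 2 (l + |\<theta>|) to the scale with
    \<open>l\<close>. The quotient inside lies between 1/4 and 1, and raising it to a power in
    [0, 1] keeps it there.\<close>
  define c where "c = (l / (2 * (l + ?t))) powr \<delta>"
  have q: "1 / 4 \<le> l / (2 * (l + ?t))" "l / (2 * (l + ?t)) \<le> 1"
  proof -
    have tl: "?t \<le> l" using near t0 by linarith
    have pos: "0 < 2 * (l + ?t)" using wl t0 by (simp add: add_pos_nonneg)
    show "1 / 4 \<le> l / (2 * (l + ?t))" by (subst pos_le_divide_eq[OF pos]) (use tl in \<open>simp add: algebra_simps\<close>)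
    show "l / (2 * (l + ?t)) \<le> 1" by (subst pos_divide_le_eq[OF pos]) (use wl t0 in simp)
  qed
  have c1: "c \<le> 1"
  proof -
    have "c \<le> 1 powr \<delta>" unfolding c_def using q assms by (intro powr_mono2) auto
    then show ?thesis by simp
  qed
  have c2: "1 / 4 \<le> c"
  proof -
    have "(1 / 4) powr 1 \<le> (1 / 4 :: real) powr \<delta>" using assms by (intro powr_mono') auto
    also have "\<dots> \<le> c" unfolding c_def using q assms by (intro powr_mono2) auto
    finally show ?thesis by simp
  qed
  have eq: "(2 * (l + ?t)) powr - \<delta> *\<^sub>R \<theta> = c *\<^sub>R (l powr - \<delta> *\<^sub>R \<theta>)"
    using wl t0 by (simp add: c_def powr_divide powr_minus_divide)
  have "pweight (c *\<^sub>R (l powr - \<delta> *\<^sub>R \<theta>)) ^ N \<le> pweight (c *\<^sub>R (l powr - \<delta> *\<^sub>R \<theta>)) ^ 1"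
    using N by (intro power_decreasing) (auto simp: pweight_le_1)
  also have "\<dots> \<le> (1 / c ^ (2 * CARD('n))) * pweight (l powr - \<delta> *\<^sub>R \<theta>)"
    using pweight_scale_ge[of c "l powr - \<delta> *\<^sub>R \<theta>"] c1 c2 by simp
  also have "\<dots> \<le> 4 ^ (2 * CARD('n)) * pweight (l powr - \<delta> *\<^sub>R \<theta>)"
  proof (rule mult_right_mono)
    have "1 / c \<le> 4" using c2 by (simp add: field_simps)
    then have "(1 / c) ^ (2 * CARD('n)) \<le> 4 ^ (2 * CARD('n))" using c2 by (intro power_mono) auto
    then show "1 / c ^ (2 * CARD('n)) \<le> 4 ^ (2 * CARD('n))" by (simp add: power_one_over)
  qed simp
  finally have 3: "pweight ((2 * (l + ?t)) powr - \<delta> *\<^sub>R \<theta>) ^ N \<le> 4 ^ (2 * CARD('n)) * pweight (l powr - \<delta> *\<^sub>R \<theta>)"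
    unfolding eq .
  have "w powr a * (1 + r * w powr - \<rho>) ^ M * pweight ((2 * (l + ?t)) powr - \<delta> *\<^sub>R \<theta>) ^ N
     \<le> (4 powr \<bar>a\<bar> * l powr a) * 5 ^ M * (4 ^ (2 * CARD('n)) * pweight (l powr - \<delta> *\<^sub>R \<theta>))"
    using r by (intro mult_mono 1 2 3) (auto intro!: mult_nonneg_nonneg zero_le_power add_nonneg_nonneg)
  then show ?thesis by (simp add: ac_simps)
qed

text \<open>Now |\<theta>| dominates everything. The losses are |a| powers from the weight, M from
  the differential operators and 2 n from restoring the weight at scale l^\<delta>. Each power of
  the oscillatory gain contributes 2 (1 - \<delta>), which is positive by \<delta> < 1; assumption
  \<open>N\<close> is this balance.\<close>

lemma oscillatory_weight_far:
  fixes l w t a r \<rho> \<delta> :: real and \<theta> :: "real ^ 'n::finite"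
  assumes "0 \<le> \<delta>" "\<delta> \<le> \<rho>" "\<rho> \<le> 1" "\<delta> < 1" "1 \<le> l" "1 \<le> w" "w \<le> 2 * l + norm \<theta>" "l \<le> 2 * w + norm \<theta>"
    and r: "1 \<le> r" "r \<le> l powr \<delta>" and far: "l < 4 * norm \<theta>"
    and N: "\<bar>a\<bar> + real M + 2 * CARD('n) \<le> 2 * (1 - \<delta>) * real N"
  shows "w powr a * (1 + r * w powr - \<rho>) ^ M * pweight ((2 * (l + norm \<theta>)) powr - \<delta> *\<^sub>R \<theta>) ^ N
     \<le> (3 powr \<bar>a\<bar> * 2 ^ M * 512 ^ N * 2 ^ (2 * CARD('n))) * l powr a * pweight (l powr - \<delta> *\<^sub>R \<theta>)"
proof -
  let ?t = "norm \<theta>"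
  \<comment> \<open>One quantity that is at least 1 and at least \<open>l\<close>, up to constants
    bounds \<open>w\<close>, \<open>r\<close> and both quotients of the weights, and is proportional
    to |\<theta>|.\<close>
  define Y where "Y = 4 * ?t"
  have Y: "1 \<le> Y" "l \<le> Y" "0 < Y" "0 < l" "0 < w" using assms by (auto simp: Y_def)
  have wY: "w \<le> 3 * Y" using assms Y by (simp add: Y_def)
  have 1: "w powr a \<le> (3 powr \<bar>a\<bar> * Y powr \<bar>a\<bar>) * l powr a"
  proof -
    have "w powr a = (w / l) powr a * l powr a" using Y by (simp add: powr_divide)
    also have "(w / l) powr a \<le> (3 * Y) powr \<bar>a\<bar>"
    proof (rule powr_abs_bound)
      show "w / l \<le> 3 * Y" using wY assms(5) Y mult_mono[of w "3 * Y" 1 l] by (simp add: divide_le_eq)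
      show "1 / (w / l) \<le> 3 * Y" using Y assms(6) mult_mono[of l "3 * Y" 1 w] by (simp add: divide_le_eq)
    qed (use Y in auto)
    finally show ?thesis using Y by (simp add: mult_right_mono powr_mult)
  qed
  have "l powr \<delta> \<le> l powr 1" using assms by (intro powr_mono) auto
  then have "r \<le> Y" using r Y by simp
  moreover have "w powr - \<rho> \<le> 1" using powr_mono[of "-\<rho>" 0 w] assms by simp
  ultimately have "r * w powr - \<rho> \<le> Y * 1" using r Y by (intro mult_mono) auto
  then have 2: "(1 + r * w powr - \<rho>) ^ M \<le> 2 ^ M * Y powr real M"
    using r Y power_mono[of "1 + r * w powr - \<rho>" "2 * Y" M] by (simp add: powr_realpow power_mult_distrib)
  define s where "s = (2 * (l + ?t)) powr - \<delta>"
  have s0: "0 \<le> s" by (simp add: s_def)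
  have "2 * (l + ?t) \<le> 4 * Y" using Y by (simp add: Y_def)
  then have "(4 * Y) powr - \<delta> \<le> s"
    unfolding s_def using assms Y by (intro powr_mono2') auto
  then have "(4 * Y) powr - \<delta> * ?t \<le> s * ?t" by (rule mult_right_mono) simp
  \<comment> \<open>Here |\<theta>| = 4 Y / 16 by the choice of \<open>Y\<close>.\<close>
  moreover have "(4 * Y) powr - \<delta> * ?t = (4 * Y) powr (1 - \<delta>) / 16"
    using Y powr_add[of "4 * Y" 1 "- \<delta>"] by (simp add: Y_def)
  moreover have "Y powr (1 - \<delta>) \<le> (4 * Y) powr (1 - \<delta>)" using Y assms by (intro powr_mono2) auto
  ultimately have st: "Y powr (1 - \<delta>) / 16 \<le> s * ?t" by linarith
  have pos: "0 < Y powr (1 - \<delta>) / 16" using Y by simp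
  have "pweight (s *\<^sub>R \<theta>) * (Y powr (1 - \<delta>) / 16)\<^sup>2 \<le> pweight (s *\<^sub>R \<theta>) * (1 + norm (s *\<^sub>R \<theta>))\<^sup>2"
    using st pos s0 by (intro mult_left_mono power_mono) auto
  also have "\<dots> \<le> 2" by (rule pweight_norm_upper)
  also have "(Y powr (1 - \<delta>) / 16)\<^sup>2 = Y powr (2 * (1 - \<delta>)) / 256"
    by (simp add: power_divide power2_eq_square powr_add[symmetric])
  \<comment> \<open>The constant is 2 from \<open>pweight_norm_upper\<close> times 16^2.\<close>
  finally have "pweight (s *\<^sub>R \<theta>) * Y powr (2 * (1 - \<delta>)) \<le> 512" by simp
  then have "pweight (s *\<^sub>R \<theta>) \<le> 512 / Y powr (2 * (1 - \<delta>))" using Y by (simp add: le_divide_eq)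
  then have "pweight (s *\<^sub>R \<theta>) \<le> 512 * Y powr - (2 * (1 - \<delta>))"
    unfolding powr_minus_divide by simp
  then have "pweight (s *\<^sub>R \<theta>) ^ N \<le> (512 * Y powr - (2 * (1 - \<delta>))) ^ N" by (intro power_mono) auto
  moreover have "(Y powr - (2 * (1 - \<delta>))) ^ N = Y powr (- (2 * (1 - \<delta>) * real N))"
    using Y by (subst powr_power) (auto simp: algebra_simps)
  ultimately have 3: "pweight (s *\<^sub>R \<theta>) ^ N \<le> 512 ^ N * Y powr (- (2 * (1 - \<delta>) * real N))"
    by (simp only: power_mult_distrib)
  let ?y = "l powr - \<delta> *\<^sub>R \<theta>"
  \<comment> \<open>The target weight is at least a negative power of \<open>Y\<close>, so it can be
    inserted at the cost of 2 n further powers.\<close>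
  have 4: "1 \<le> 2 ^ (2 * CARD('n)) * Y powr real (2 * CARD('n)) * pweight ?y"
  proof -
    have "l powr - \<delta> \<le> 1" using powr_mono[of "- \<delta>" 0 l] assms by simp
    then have "norm ?y \<le> Y" using Y mult_mono[of "l powr - \<delta>" 1 ?t Y] by (simp add: Y_def)
    then have "pweight ?y * (1 + norm ?y) ^ (2 * CARD('n)) \<le> pweight ?y * (2 * Y) ^ (2 * CARD('n))"
      using Y by (intro mult_left_mono power_mono) auto
    then have "1 \<le> pweight ?y * (2 * Y) ^ (2 * CARD('n))" using pweight_norm_lower[of ?y] by linarith
    then show ?thesis using Y by (simp only: powr_realpow power_mult_distrib ac_simps)
  qed
  have A: "w powr a * (1 + r * w powr - \<rho>) ^ M * pweight (s *\<^sub>R \<theta>) ^ N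
      \<le> ((3 powr \<bar>a\<bar> * Y powr \<bar>a\<bar>) * l powr a) * (2 ^ M * Y powr real M) * (512 ^ N * Y powr (- (2 * (1 - \<delta>) * real N)))"
    using r Y by (intro mult_mono 1 2 3) (auto intro!: mult_nonneg_nonneg zero_le_power add_nonneg_nonneg)
  also have "\<dots> = (3 powr \<bar>a\<bar> * 2 ^ M * 512 ^ N) * l powr a * Y powr (\<bar>a\<bar> + real M - 2 * (1 - \<delta>) * real N) * 1"
    by (simp add: powr_add powr_diff powr_minus_divide)
  also have "\<dots> \<le> (3 powr \<bar>a\<bar> * 2 ^ M * 512 ^ N) * l powr a * Y powr (\<bar>a\<bar> + real M - 2 * (1 - \<delta>) * real N) *
      (2 ^ (2 * CARD('n)) * Y powr real (2 * CARD('n)) * pweight ?y)"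
    by (intro mult_left_mono 4) auto
  also have "\<dots> = (3 powr \<bar>a\<bar> * 2 ^ M * 512 ^ N * 2 ^ (2 * CARD('n))) * l powr a *
      Y powr (\<bar>a\<bar> + real M - 2 * (1 - \<delta>) * real N + real (2 * CARD('n))) * pweight ?y"
    by (simp only: powr_add ac_simps)
  also have "\<dots> \<le> (3 powr \<bar>a\<bar> * 2 ^ M * 512 ^ N * 2 ^ (2 * CARD('n))) * l powr a * 1 * pweight ?y"
  proof (intro mult_right_mono mult_left_mono)
    show "Y powr (\<bar>a\<bar> + real M - 2 * (1 - \<delta>) * real N + real (2 * CARD('n))) \<le> 1"
      using powr_mono[of "\<bar>a\<bar> + real M - 2 * (1 - \<delta>) * real N + real (2 * CARD('n))" 0 Y] N Y by simp
  qed auto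
  finally show ?thesis by (simp add: s_def)
qed

lemma oscillatory_weight:
  fixes a \<rho> \<delta> :: real and M :: nat
  assumes "0 \<le> \<delta>" "\<delta> \<le> \<rho>" "\<rho> \<le> 1" "\<delta> < 1"
  shows "\<exists>N C. 0 \<le> C \<and> (\<forall>p (\<theta> :: real ^ 'n::finite) r. 1 \<le> r \<longrightarrow> r \<le> base_weight p powr \<delta> \<longrightarrow>
    freq_weight p \<theta> powr a * (1 + r * freq_weight p \<theta> powr - \<rho>) ^ M * pweight ((2 * (base_weight p + norm \<theta>)) powr - \<delta> *\<^sub>R \<theta>) ^ N
     \<le> C * base_weight p powr a * pweight (base_weight p powr - \<delta> *\<^sub>R \<theta>))"
proof -
  \<comment> \<open>Solves the balance of the far region for the number of integrations by parts;
    the quotient makes sense since \<delta> < 1. The maximum with 1 below serves the near region,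
    which uses one power of the weight.\<close>
  obtain N0 :: nat where N0: "(\<bar>a\<bar> + real M + 2 * CARD('n)) / (2 * (1 - \<delta>)) \<le> real N0"
    using real_arch_simple by blast
  define N where "N = max 1 N0"
  have "(\<bar>a\<bar> + real M + 2 * CARD('n)) / (2 * (1 - \<delta>)) \<le> real N" using N0 by (simp add: N_def)
  then have N: "\<bar>a\<bar> + real M + 2 * CARD('n) \<le> 2 * (1 - \<delta>) * real N" "1 \<le> N"
    using assms by (simp_all add: field_simps N_def)
  let ?C1 = "4 powr \<bar>a\<bar> * 5 ^ M * 4 ^ (2 * CARD('n))"
  let ?C2 = "3 powr \<bar>a\<bar> * 2 ^ M * 512 ^ N * 2 ^ (2 * CARD('n))"
  have "freq_weight p \<theta> powr a * (1 + r * freq_weight p \<theta> powr - \<rho>) ^ M * pweight ((2 * (base_weight p + norm \<theta>)) powr - \<delta> *\<^sub>R \<theta>) ^ N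
     \<le> (?C1 + ?C2) * base_weight p powr a * pweight (base_weight p powr - \<delta> *\<^sub>R \<theta>)"
    if r: "1 \<le> r" "r \<le> base_weight p powr \<delta>" for p r and \<theta> :: "real ^ 'n"
  proof (cases "4 * norm \<theta> \<le> base_weight p")
    case True
    have "?C1 * base_weight p powr a * pweight (base_weight p powr - \<delta> *\<^sub>R \<theta>) \<le> (?C1 + ?C2) * base_weight p powr a * pweight (base_weight p powr - \<delta> *\<^sub>R \<theta>)"
      by (intro mult_right_mono) auto
    with oscillatory_weight_near[OF assms(1-3) base_weight_ge_1 freq_weight_ge_1 freq_weight_le base_weight_le r True N(2), of a M]
    show ?thesis by (rule order_trans)
  next
    case False
    then have far: "base_weight p < 4 * norm \<theta>" by simp
    have "?C2 * base_weight p powr a * pweight (base_weight p powr - \<delta> *\<^sub>R \<theta>) \<le> (?C1 + ?C2) * base_weight p powr a * pweight (base_weight p powr - \<delta> *\<^sub>R \<theta>)"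
      by (intro mult_right_mono) auto
    with oscillatory_weight_far[OF assms base_weight_ge_1 freq_weight_ge_1 freq_weight_le base_weight_le r far N(1)]
    show ?thesis by (rule order_trans)
  qed
  moreover have "0 \<le> ?C1 + ?C2" by simp
  ultimately show ?thesis by blast
qed

lemma bracket_prod_resolvents: "bracket_prod s js \<theta> * norm (resolvents s js \<theta>) = 1"
proof (induction js)
  case (Cons j js)
  have "norm (1 + \<i> * complex_of_real (s * \<theta> $ j)) * norm (resolvent s j \<theta>) = 1"
    by (simp add: resolvent_def norm_divide)
  moreover have "bracket_prod s (j # js) \<theta> * norm (resolvents s (j # js) \<theta>) =
     (norm (1 + \<i> * complex_of_real (s * \<theta> $ j)) * norm (resolvent s j \<theta>)) * (bracket_prod s js \<theta> * norm (resolvents s js \<theta>))"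
    by (simp only: bracket_prod_simps resolvents_simps norm_mult ac_simps)
  ultimately show ?case using Cons by simp
qed simp

text \<open>Trades the gain in \<theta>, made at a scale adapted to \<theta>, for the weight at the
  scale of \<open>p\<close> alone. The resulting majorant is integrable over \<theta>, and its
  integral is explicitly computable by rescaling.\<close>

lemma osc_inner_xi_ops_bound:
  fixes u :: "real ^ 'n::finite \<Rightarrow> complex"
  assumes par: "0 \<le> \<delta>" "\<delta> \<le> \<rho>" "\<rho> \<le> 1" "\<delta> < 1" and u: "decay 1 u" and t: "is_symbol \<rho> \<delta> a \<tau>"
  shows "\<exists>C\<ge>0. \<forall>p \<theta> r. 1 \<le> r \<longrightarrow> r \<le> base_weight p powr \<delta> \<longrightarrow>
      norm (osc_inner (\<lambda>z. u (r *\<^sub>R z)) (xi_ops r js \<tau>) p \<theta>) \<le> C * base_weight p powr a / r ^ CARD('n) * pweight (base_weight p powr - \<delta> *\<^sub>R \<theta>)"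
proof -
  have rho: "0 \<le> \<rho>" using par by simp
  obtain N C1 where C1: "0 \<le> C1" "\<And>p (\<theta> :: real ^ 'n) r. 1 \<le> r \<Longrightarrow> r \<le> base_weight p powr \<delta> \<Longrightarrow>
    freq_weight p \<theta> powr a * (1 + r * freq_weight p \<theta> powr - \<rho>) ^ length js * pweight ((2 * (base_weight p + norm \<theta>)) powr - \<delta> *\<^sub>R \<theta>) ^ N
     \<le> C1 * base_weight p powr a * pweight (base_weight p powr - \<delta> *\<^sub>R \<theta>)"
    using oscillatory_weight[OF par, where 'n='n, of a "length js"] by blast
  obtain C2 where C2: "0 \<le> C2" "\<And>p \<theta> r s. 1 \<le> r \<Longrightarrow> 0 \<le> s \<Longrightarrow> s * r \<le> 1 \<Longrightarrow> s * freq_weight p \<theta> powr \<delta> \<le> 1 \<Longrightarrow>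
      norm (osc_inner (\<lambda>z. u (r *\<^sub>R z)) (xi_ops r js \<tau>) p \<theta>) * bracket_prod s (coords_rep (2 * N)) \<theta>
        \<le> C2 * freq_weight p \<theta> powr a * (1 + r * freq_weight p \<theta> powr - \<rho>) ^ length js / r ^ CARD('n)"
    using osc_inner_xi_ops_decay[OF rho u t, of js "coords_rep (2 * N)"] by blast
  have "norm (osc_inner (\<lambda>z. u (r *\<^sub>R z)) (xi_ops r js \<tau>) p \<theta>) \<le> (C2 * C1) * base_weight p powr a / r ^ CARD('n) * pweight (base_weight p powr - \<delta> *\<^sub>R \<theta>)"
    if r: "1 \<le> r" "r \<le> base_weight p powr \<delta>" for p \<theta> r
  proof -
    let ?H = "norm (osc_inner (\<lambda>z. u (r *\<^sub>R z)) (xi_ops r js \<tau>) p \<theta>)"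
    \<comment> \<open>An upper bound for both weights at once. Hence s = \<mu>^(-\<delta>) satisfies
      s r \<le> 1 as well as the condition involving the frequency weight.\<close>
    define \<mu> where "\<mu> = 2 * (base_weight p + norm \<theta>)"
    define s where "s = \<mu> powr - \<delta>"
    have \<mu>: "base_weight p \<le> \<mu>" "freq_weight p \<theta> \<le> \<mu>" "0 < \<mu>"
      using freq_weight_le[of p \<theta>] base_weight_pos[of p] norm_ge_zero[of \<theta>] by (simp_all add: \<mu>_def del: norm_ge_zero)
    have s\<mu>: "s * \<mu> powr \<delta> = 1" using \<mu> by (simp add: s_def powr_minus_divide)
    have s0: "0 \<le> s" by (simp add: s_def)
    have "r \<le> \<mu> powr \<delta>"
      using r(2) powr_mono2[OF par(1) _ \<mu>(1)] base_weight_pos[of p] by simp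
    then have s1: "s * r \<le> 1" using s\<mu> mult_left_mono[OF _ s0, of r "\<mu> powr \<delta>"] by simp
    have "freq_weight p \<theta> powr \<delta> \<le> \<mu> powr \<delta>" using powr_mono2[OF par(1) _ \<mu>(2)] freq_weight_pos[of p \<theta>] by simp
    then have s2: "s * freq_weight p \<theta> powr \<delta> \<le> 1" using s\<mu> mult_left_mono[OF _ s0, of "freq_weight p \<theta> powr \<delta>" "\<mu> powr \<delta>"] by simp
    have "?H = ?H * bracket_prod s (coords_rep (2 * N)) \<theta> * norm (resolvents s (coords_rep (2 * N)) \<theta>)"
      using bracket_prod_resolvents[of s "coords_rep (2 * N)" \<theta>] by (simp add: mult.assoc)
    also have "\<dots> \<le> C2 * freq_weight p \<theta> powr a * (1 + r * freq_weight p \<theta> powr - \<rho>) ^ length js / r ^ CARD('n) * norm (resolvents s (coords_rep (2 * N)) \<theta>)"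
      by (intro mult_right_mono C2 r s0 s1 s2) auto
    also have "\<dots> = C2 / r ^ CARD('n) * (freq_weight p \<theta> powr a * (1 + r * freq_weight p \<theta> powr - \<rho>) ^ length js * pweight (s *\<^sub>R \<theta>) ^ N)"
      unfolding norm_resolvents_coords_rep by simp
    also have "\<dots> \<le> C2 / r ^ CARD('n) * (C1 * base_weight p powr a * pweight (base_weight p powr - \<delta> *\<^sub>R \<theta>))"
      using C2(1) r unfolding s_def \<mu>_def by (intro mult_left_mono C1) auto
    finally show ?thesis by simp
  qed
  then show ?thesis using C1(1) C2(1) by (intro exI[of _ "C2 * C1"]) auto
qed

lemma osc_inner_bound:
  fixes u :: "real ^ 'n::finite \<Rightarrow> complex"
  assumes par: "0 \<le> \<delta>" "\<delta> \<le> \<rho>" "\<rho> \<le> 1" "\<delta> < 1" and u: "decay 1 u" and t: "is_symbol \<rho> \<delta> a \<tau>"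
  shows "\<exists>C\<ge>0. \<forall>p \<theta>. norm (osc_inner u \<tau> p \<theta>) \<le> C * base_weight p powr (\<bar>a\<bar> + 2 * CARD('n)) * pweight \<theta>"
proof -
  obtain C where C: "0 \<le> C" "\<And>p \<theta> r. 1 \<le> r \<Longrightarrow> r \<le> base_weight p powr \<delta> \<Longrightarrow>
      norm (osc_inner (\<lambda>z. u (r *\<^sub>R z)) (xi_ops r [] \<tau>) p \<theta>) \<le> C * base_weight p powr a / r ^ CARD('n) * pweight (base_weight p powr - \<delta> *\<^sub>R \<theta>)"
    using osc_inner_xi_ops_bound[OF assms, of "[]"] by blast
  have "norm (osc_inner u \<tau> p \<theta>) \<le> C * base_weight p powr (\<bar>a\<bar> + 2 * CARD('n)) * pweight \<theta>" for p \<theta>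
  proof -
    let ?l = "base_weight p"
    have l: "1 \<le> ?l" "0 < ?l" by (auto simp: base_weight_ge_1 base_weight_pos)
    have "1 \<le> ?l powr \<delta>" using powr_mono[OF par(1) l(1)] l by simp
    from C(2)[OF order_refl this, of \<theta>]
    have "norm (osc_inner u \<tau> p \<theta>) \<le> C * ?l powr a * pweight (?l powr - \<delta> *\<^sub>R \<theta>)" by simp
    also have "\<dots> \<le> C * ?l powr a * (1 / (?l powr - \<delta>) ^ (2 * CARD('n)) * pweight \<theta>)"
      using C(1) l powr_mono[of "-\<delta>" 0 ?l] par by (intro mult_left_mono pweight_scale_ge) auto
    also have "1 / (?l powr - \<delta>) ^ (2 * CARD('n)) = ?l powr (\<delta> * (2 * CARD('n)))"
    proof -
      have "(?l powr - \<delta>) ^ (2 * CARD('n)) = ?l powr - (\<delta> * (2 * CARD('n)))"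
        using l by (subst powr_power) (auto simp: ac_simps)
      then show ?thesis by (simp add: powr_minus_divide)
    qed
    also have "C * ?l powr a * (?l powr (\<delta> * (2 * CARD('n))) * pweight \<theta>) \<le> C * ?l powr \<bar>a\<bar> * (?l powr (2 * CARD('n)) * pweight \<theta>)"
      using C(1) l par by (intro mult_mono mult_left_mono mult_right_mono powr_mono) (auto simp: mult_left_le_one_le)
    also have "\<dots> = C * ?l powr (\<bar>a\<bar> + 2 * CARD('n)) * pweight \<theta>" by (simp add: powr_add)
    finally show ?thesis .
  qed
  then show ?thesis using C(1) by blast
qed

subsection \<open>The oscillatory integral and its independence of the regularisation\<close>

definition osc :: "(real ^ 'n \<Rightarrow> complex) \<Rightarrow> ('n::finite) bisymbol \<Rightarrow>
    'n point \<Rightarrow> complex" where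
  "osc u \<tau> p = (LINT \<theta>|lborel. osc_inner u \<tau> p \<theta>)"

lemma osc_inner_integrable:
  fixes u :: "real ^ 'n::finite \<Rightarrow> complex"
  assumes par: "0 \<le> \<delta>" "\<delta> \<le> \<rho>" "\<rho> \<le> 1" "\<delta> < 1" and u: "decay 1 u" and t: "is_symbol \<rho> \<delta> a \<tau>"
  shows "integrable lborel (osc_inner u \<tau> p)"
proof -
  from osc_inner_bound[OF assms] obtain C where
    C: "\<And>p \<theta>. norm (osc_inner u \<tau> p \<theta>) \<le> C * base_weight p powr (\<bar>a\<bar> + 2 * CARD('n)) * pweight \<theta>" by blast
  have "integrable lborel (\<lambda>\<theta> :: real ^ 'n. C * base_weight p powr (\<bar>a\<bar> + 2 * CARD('n)) * pweight \<theta>)"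
    by (intro integrable_mult_right integrable_pweight)
  moreover have "osc_inner u \<tau> p \<in> borel_measurable lborel"
    using osc_inner_measurable[OF u t, of "\<lambda>_. p" "\<lambda>\<theta>. \<theta>"] by (simp add: continuous_on_const continuous_on_id)
  ultimately show ?thesis
    by (rule Bochner_Integration.integrable_bound) (use order_trans[OF C abs_ge_self] in auto)
qed

text \<open>At r = lambda^\<delta> the factor r^(-n) from the z-integral cancels against the factor
  r^n from integrating the weight at scale r over \<theta>. This yields the exact order
  \<open>a\<close>.\<close>

lemma osc_bound:
  fixes u :: "real ^ 'n::finite \<Rightarrow> complex"
  assumes par: "0 \<le> \<delta>" "\<delta> \<le> \<rho>" "\<rho> \<le> 1" "\<delta> < 1" and u: "decay 1 u" and t: "is_symbol \<rho> \<delta> a \<tau>"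
  shows "\<exists>C. \<forall>p. norm (osc (\<lambda>z. u (base_weight p powr \<delta> *\<^sub>R z)) (xi_ops (base_weight p powr \<delta>) js \<tau>) p) \<le> C * base_weight p powr a"
proof -
  from osc_inner_xi_ops_bound[OF assms, of js] obtain C where C: "\<And>p \<theta> r. 1 \<le> r \<Longrightarrow> r \<le> base_weight p powr \<delta> \<Longrightarrow>
      norm (osc_inner (\<lambda>z. u (r *\<^sub>R z)) (xi_ops r js \<tau>) p \<theta>) \<le> C * base_weight p powr a / r ^ CARD('n) * pweight (base_weight p powr - \<delta> *\<^sub>R \<theta>)"
    by blast
  let ?I = "integral\<^sup>L lborel (pweight :: real ^ 'n \<Rightarrow> real)"
  have "norm (osc (\<lambda>z. u (base_weight p powr \<delta> *\<^sub>R z)) (xi_ops (base_weight p powr \<delta>) js \<tau>) p) \<le> (C * ?I) * base_weight p powr a" for p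
  proof -
    define r where "r = base_weight p powr \<delta>"
    have r1: "1 \<le> r" using powr_mono[OF par(1) base_weight_ge_1[of p]] base_weight_pos[of p] by (simp add: r_def)
    have r': "base_weight p powr - \<delta> = 1 / r" "0 < 1 / r" using r1 by (simp add: r_def powr_minus_divide, simp)
    have "norm (osc (\<lambda>z. u (r *\<^sub>R z)) (xi_ops r js \<tau>) p) \<le>
        (LINT \<theta> :: real ^ 'n|lborel. C * base_weight p powr a / r ^ CARD('n) * pweight ((1 / r) *\<^sub>R \<theta>))"
      unfolding osc_def
    proof (rule norm_integral_le)
      show "integrable lborel (\<lambda>\<theta> :: real ^ 'n. C * base_weight p powr a / r ^ CARD('n) * pweight ((1 / r) *\<^sub>R \<theta>))"
        by (intro integrable_mult_right integral_pweight_scale r')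
      show "norm (osc_inner (\<lambda>z. u (r *\<^sub>R z)) (xi_ops r js \<tau>) p \<theta>) \<le> C * base_weight p powr a / r ^ CARD('n) * pweight ((1 / r) *\<^sub>R \<theta>)" for \<theta>
        using C[OF r1 eq_refl[OF r_def], of \<theta>] unfolding r'(1) .
    qed
    also have "\<dots> = C * base_weight p powr a / r ^ CARD('n) * (?I / (1 / r) ^ CARD('n))"
      by (simp only: integral_mult_right_zero integral_pweight_scale(2)[OF r'(2)])
    also have "\<dots> = (C * ?I) * base_weight p powr a" using r1 by (simp add: power_one_over)
    finally show ?thesis by (simp add: r_def)
  qed
  then show ?thesis by blast
qed

section \<open>Differentiation in \<theta> and removal of inserted factors\<close>

lemma freq_weight_powr_bound:
  assumes "2 * base_weight p + norm \<theta> \<le> K"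
  shows "freq_weight p \<theta> powr a \<le> K powr \<bar>a\<bar>"
proof -
  have "freq_weight p \<theta> powr a \<le> freq_weight p \<theta> powr \<bar>a\<bar>" using freq_weight_ge_1[of p \<theta>] by (intro powr_mono) auto
  also have "\<dots> \<le> K powr \<bar>a\<bar>"
    using freq_weight_le[of p \<theta>] freq_weight_pos[of p \<theta>] assms by (intro powr_mono2) auto
  finally show ?thesis .
qed

lemma osc_integrand_theta_deriv:
  assumes t: "is_symbol \<rho> \<delta> a \<tau>"
  shows "((\<lambda>t. osc_integrand v \<tau> p (\<theta> + t *\<^sub>R axis j 1) z) has_vector_derivative
     (\<i> * osc_integrand (\<lambda>z. of_real (z $ j) * v z) \<tau> p (\<theta> + t *\<^sub>R axis j 1) z
       + osc_integrand v (dir_deriv (unit_xi j) \<tau>) p (\<theta> + t *\<^sub>R axis j 1) z)) (at t)"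
proof -
  define E where "E = (\<lambda>t. iexp (z \<bullet> (\<theta> + t *\<^sub>R axis j 1)))"
  define q where "q = (fst p + z, \<theta> - fst (snd p) - snd (snd p), snd (snd p))"
  have q: "(fst p + z, \<theta> + t *\<^sub>R axis j 1 - fst (snd p) - snd (snd p), snd (snd p)) = q + t *\<^sub>R unit_xi j" for t
    by (simp add: q_def unit_xi_def algebra_simps)
  have "(\<lambda>t. \<i> * complex_of_real (z \<bullet> (\<theta> + t *\<^sub>R axis j 1))) = (\<lambda>t. \<i> * of_real (z \<bullet> \<theta>) + t *\<^sub>R (\<i> * of_real (z $ j)))"
    by (rule ext) (simp add: inner_add_right inner_axis, simp add: scaleR_conv_of_real algebra_simps)
  then have "((\<lambda>t. \<i> * complex_of_real (z \<bullet> (\<theta> + t *\<^sub>R axis j 1))) has_vector_derivative \<i> * of_real (z $ j)) (at t)"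
    by (simp only:) (auto intro!: derivative_eq_intros simp: has_vector_derivative_def)
  from field_vector_diff_chain_at[OF this DERIV_exp]
  have E1: "(E has_vector_derivative \<i> * of_real (z $ j) * E t) (at t)" by (simp add: E_def comp_def)
  have T1: "((\<lambda>t. \<tau> (q + t *\<^sub>R unit_xi j)) has_vector_derivative dir_deriv (unit_xi j) \<tau> (q + t *\<^sub>R unit_xi j)) (at t)"
    by (rule dir_deriv_line) (rule is_symbol_differentiable[OF t])
  have "((\<lambda>t. E t * v z * \<tau> (q + t *\<^sub>R unit_xi j)) has_vector_derivative
      (\<i> * of_real (z $ j) * E t * v z * \<tau> (q + t *\<^sub>R unit_xi j) + E t * v z * dir_deriv (unit_xi j) \<tau> (q + t *\<^sub>R unit_xi j))) (at t)"
    by (rule has_vector_derivative_eq_rhs[OF has_vector_derivative_mult[OF has_vector_derivative_mult[OF E1 has_vector_derivative_const] T1]])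
      (simp add: algebra_simps)
  then show ?thesis by (simp add: osc_integrand_def q E_def mult.assoc mult.left_commute)
qed

text \<open>The phase brings down a factor i z_j, which is why the decay of z_j times
  \<open>v\<close> is required besides that of \<open>v\<close>.\<close>

lemma osc_inner_theta_deriv:
  fixes v :: "real ^ 'n::finite \<Rightarrow> complex"
  assumes v: "decay 1 v" and zv: "decay 1 (\<lambda>z. of_real (z $ j) * v z)" and t: "is_symbol \<rho> \<delta> a \<tau>"
  shows "((\<lambda>t. osc_inner v \<tau> p (\<theta> + t *\<^sub>R axis j 1)) has_vector_derivative
     (\<i> * osc_inner (\<lambda>z. of_real (z $ j) * v z) \<tau> p \<theta> + osc_inner v (dir_deriv (unit_xi j) \<tau>) p \<theta>)) (at 0)"
proof -
  let ?zv = "\<lambda>z. of_real (z $ j) * v z" and ?t' = "dir_deriv (unit_xi j) \<tau>"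
  have t': "is_symbol \<rho> \<delta> (a - \<rho>) ?t'" using is_symbol_dir_deriv[OF t, of "unit_xi j"] by simp
  define D where "D = (\<lambda>t z. \<i> * osc_integrand ?zv \<tau> p (\<theta> + t *\<^sub>R axis j 1) z + osc_integrand v ?t' p (\<theta> + t *\<^sub>R axis j 1) z)"
  from osc_integrand_bound[OF zv t] obtain C1 where C1: "0 \<le> C1" "\<And>p \<theta> z. norm (osc_integrand ?zv \<tau> p \<theta> z) \<le> C1 * pweight z * freq_weight p \<theta> powr a"
    by blast
  from osc_integrand_bound[OF v t'] obtain C2 where C2: "0 \<le> C2" "\<And>p \<theta> z. norm (osc_integrand v ?t' p \<theta> z) \<le> C2 * pweight z * freq_weight p \<theta> powr (a - \<rho>)"
    by blast
  define K where "K = 2 * base_weight p + (norm \<theta> + 1)"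
  have hwK: "freq_weight p (\<theta> + t *\<^sub>R axis j 1) powr x \<le> K powr \<bar>x\<bar>" if "t \<in> ball 0 1" for t x
  proof (rule freq_weight_powr_bound)
    show "2 * base_weight p + norm (\<theta> + t *\<^sub>R axis j 1) \<le> K"
      using that norm_triangle_ineq[of \<theta> "t *\<^sub>R axis j 1"] by (simp add: K_def)
  qed
  have "((\<lambda>t. osc_inner v \<tau> p (\<theta> + t *\<^sub>R axis j 1)) has_derivative (\<lambda>s. LINT z|lborel. s *\<^sub>R D 0 z)) (at (0::real))"
    unfolding osc_inner_def
  proof (rule leibniz_frechet[where e=1 and B="\<lambda>z. C1 * pweight z * K powr \<bar>a\<bar> + C2 * pweight z * K powr \<bar>a - \<rho>\<bar>" and g'="\<lambda>t z s. s *\<^sub>R D t z"])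
    fix t :: real and z assume tb: "t \<in> ball 0 1"
    show "((\<lambda>t. osc_integrand v \<tau> p (\<theta> + t *\<^sub>R axis j 1) z) has_derivative (\<lambda>s. s *\<^sub>R D t z)) (at t)"
      using osc_integrand_theta_deriv[OF t, of v p \<theta> j z t] by (simp add: has_vector_derivative_def D_def)
    fix s :: real
    have "norm (D t z) \<le> norm (osc_integrand ?zv \<tau> p (\<theta> + t *\<^sub>R axis j 1) z) + norm (osc_integrand v ?t' p (\<theta> + t *\<^sub>R axis j 1) z)"
      unfolding D_def by (rule norm_triangle_le) (simp add: norm_mult)
    also have "\<dots> \<le> C1 * pweight z * freq_weight p (\<theta> + t *\<^sub>R axis j 1) powr a + C2 * pweight z * freq_weight p (\<theta> + t *\<^sub>R axis j 1) powr (a - \<rho>)"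
      by (intro add_mono C1 C2)
    also have "\<dots> \<le> C1 * pweight z * K powr \<bar>a\<bar> + C2 * pweight z * K powr \<bar>a - \<rho>\<bar>"
      using C1(1) C2(1) by (intro add_mono mult_left_mono hwK tb) auto
    finally show "norm (s *\<^sub>R D t z) \<le> (C1 * pweight z * K powr \<bar>a\<bar> + C2 * pweight z * K powr \<bar>a - \<rho>\<bar>) * norm s"
      by (simp add: mult.commute[of _ "\<bar>s\<bar>"] mult_left_mono)
  next
    show "integrable lborel (osc_integrand v \<tau> p (\<theta> + t *\<^sub>R axis j 1))" for t by (rule osc_integrand_integrable[OF v t])
    show "integrable lborel (\<lambda>z :: real ^ 'n. C1 * pweight z * K powr \<bar>a\<bar> + C2 * pweight z * K powr \<bar>a - \<rho>\<bar>)"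
      by (intro Bochner_Integration.integrable_add integrable_mult_left integrable_mult_right integrable_pweight)
    show "(\<lambda>z. s *\<^sub>R D 0 z) \<in> borel_measurable lborel" for s
      using osc_integrand_measurable[OF zv t, of p "\<theta> + 0 *\<^sub>R axis j 1"] osc_integrand_measurable[OF v t', of p "\<theta> + 0 *\<^sub>R axis j 1"]
      unfolding D_def by simp
  qed auto
  moreover have "(LINT z|lborel. s *\<^sub>R D 0 z) = s *\<^sub>R (\<i> * osc_inner ?zv \<tau> p \<theta> + osc_inner v ?t' p \<theta>)" for s
    using osc_integrand_integrable[OF zv t, of p \<theta>] osc_integrand_integrable[OF v t', of p \<theta>] by (simp add: D_def osc_inner_def)
  ultimately show ?thesis unfolding has_vector_derivative_def by (simp only:)
qed

lemma osc_diff: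
  assumes par: "0 \<le> \<delta>" "\<delta> \<le> \<rho>" "\<rho> \<le> 1" "\<delta> < 1" and u: "decay 1 u" and t: "is_symbol \<rho> \<delta> a \<tau>" "is_symbol \<rho> \<delta> b \<tau>'"
  shows "osc u (\<lambda>q. \<tau> q - c * \<tau>' q) p = osc u \<tau> p - c * osc u \<tau>' p"
proof -
  have "osc_inner u (\<lambda>q. \<tau> q - c * \<tau>' q) p = (\<lambda>\<theta>. osc_inner u \<tau> p \<theta> - c * osc_inner u \<tau>' p \<theta>)"
    by (rule ext) (rule osc_inner_diff[OF u t])
  then show ?thesis
    using osc_inner_integrable[OF par u t(1), of p] osc_inner_integrable[OF par u t(2), of p] by (simp add: osc_def)
qed

text \<open>The integral over \<theta> of a \<theta>_j-derivative vanishes. So -r d/d\<xi>_j on the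
  amplitude turns into the factor i r z_j; together with the identity this is 1 + i r z_j, which
  cancels the resolvent. In other words, 1 - r d/d\<theta>_j on the amplitude is the transpose of 1
  + r d/d\<theta>_j on the phase.\<close>

lemma osc_remove:
  fixes u :: "real ^ 'n::finite \<Rightarrow> complex"
  assumes par: "0 \<le> \<delta>" "\<delta> \<le> \<rho>" "\<rho> \<le> 1" "\<delta> < 1" and u: "decay 1 u" and t: "is_symbol \<rho> \<delta> a \<tau>" and r: "r \<noteq> 0"
  shows "osc (\<lambda>z. u z * resolvent r j z) (xi_op r j \<tau>) p = osc u \<tau> p"
proof -
  define v where "v = (\<lambda>z. u z * resolvent r j z)"
  let ?zv = "\<lambda>z. of_real (z $ j) * v z" and ?t' = "dir_deriv (unit_xi j) \<tau>"
  have v: "decay 1 v" using decay_mult[OF u decay_resolvent[of r j]] by (simp add: v_def)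
  have zv: "decay 1 ?zv"
    using decay_mult[OF u decay_coord_resolvent[OF r, of j]] by (simp add: v_def mult.left_commute)
  have t': "is_symbol \<rho> \<delta> (a - \<rho>) ?t'" using is_symbol_dir_deriv[OF t, of "unit_xi j"] by simp
  note i1 = osc_inner_integrable[OF par zv t, of p] and i2 = osc_inner_integrable[OF par v t', of p]
    and i3 = osc_inner_integrable[OF par v t, of p]
  obtain C0 where C0: "0 \<le> C0" "\<And>p \<theta>. norm (osc_inner v \<tau> p \<theta>) \<le> C0 * base_weight p powr (\<bar>a\<bar> + 2 * CARD('n)) * pweight \<theta>"
    using osc_inner_bound[OF par v t] by blast
  obtain C1 where C1: "0 \<le> C1" "\<And>p \<theta>. norm (osc_inner ?zv \<tau> p \<theta>) \<le> C1 * base_weight p powr (\<bar>a\<bar> + 2 * CARD('n)) * pweight \<theta>"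
    using osc_inner_bound[OF par zv t] by blast
  obtain C2 where C2: "0 \<le> C2" "\<And>p \<theta>. norm (osc_inner v ?t' p \<theta>) \<le> C2 * base_weight p powr (\<bar>a - \<rho>\<bar> + 2 * CARD('n)) * pweight \<theta>"
    using osc_inner_bound[OF par v t'] by blast
  let ?K0 = "C0 * base_weight p powr (\<bar>a\<bar> + 2 * CARD('n))" and ?K1 = "C1 * base_weight p powr (\<bar>a\<bar> + 2 * CARD('n))"
    and ?K2 = "C2 * base_weight p powr (\<bar>a - \<rho>\<bar> + 2 * CARD('n))"
  have K: "0 \<le> ?K0" "0 \<le> ?K1" "0 \<le> ?K2" using C0 C1 C2 by simp_all
  have "(LINT \<theta>|lborel. \<i> * osc_inner ?zv \<tau> p \<theta> + osc_inner v ?t' p \<theta>) = 0"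
  proof (rule integral_dir_deriv_zero[where f="osc_inner v \<tau> p" and v="axis j 1" and C="?K0 + ?K1 + ?K2"])
    show "((\<lambda>t. osc_inner v \<tau> p (\<theta> + t *\<^sub>R axis j 1)) has_vector_derivative \<i> * osc_inner ?zv \<tau> p \<theta> + osc_inner v ?t' p \<theta>) (at 0)" for \<theta>
      by (rule osc_inner_theta_deriv[OF v zv t])
    show "norm (osc_inner v \<tau> p \<theta>) \<le> (?K0 + ?K1 + ?K2) * pweight \<theta>" for \<theta>
      by (rule order_trans[OF C0(2)]) (use K in \<open>auto intro!: mult_right_mono\<close>)
    show "norm (\<i> * osc_inner ?zv \<tau> p \<theta> + osc_inner v ?t' p \<theta>) \<le> (?K0 + ?K1 + ?K2) * pweight \<theta>" for \<theta>
    proof -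
      have "norm (\<i> * osc_inner ?zv \<tau> p \<theta> + osc_inner v ?t' p \<theta>) \<le> ?K1 * pweight \<theta> + ?K2 * pweight \<theta>"
        by (rule norm_triangle_le) (use add_mono[OF C1(2)[of p \<theta>] C2(2)[of p \<theta>]] in \<open>simp add: norm_mult\<close>)
      also have "\<dots> \<le> (?K0 + ?K1 + ?K2) * pweight \<theta>"
        unfolding distrib_right using mult_nonneg_nonneg[OF K(1) pweight_nonneg[of \<theta>]] by simp
      finally show ?thesis .
    qed
  qed (use i1 i2 i3 in \<open>auto simp: integrable_iff_bounded\<close>)
  then have "\<i> * osc ?zv \<tau> p + osc v ?t' p = 0" using i1 i2 by (simp add: osc_def)
  then have e: "osc v ?t' p = - (\<i> * osc ?zv \<tau> p)" by (simp add: eq_neg_iff_add_eq_0 add.commute)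
  have "osc v (xi_op r j \<tau>) p = osc v \<tau> p + of_real r * \<i> * osc ?zv \<tau> p"
    unfolding xi_op_def osc_diff[OF par v t t'] e by simp
  also have "\<dots> = (LINT \<theta>|lborel. osc_inner v \<tau> p \<theta> + of_real r * \<i> * osc_inner ?zv \<tau> p \<theta>)"
    using i1 i3 by (simp add: osc_def)
  also have "\<dots> = (LINT \<theta>|lborel. osc_inner (\<lambda>z. v z + (of_real r * \<i>) * ?zv z) \<tau> p \<theta>)"
    by (subst osc_inner_add_left[OF v decay_cmult[OF zv] t]) (simp only: osc_inner_cmult_left)
  \<comment> \<open>Here 1 + i r z_j meets the resolvent hidden in \<open>v\<close>.\<close>
  also have "(\<lambda>z. v z + (of_real r * \<i>) * ?zv z) = u"
  proof
    fix z
    have "v z + (of_real r * \<i>) * ?zv z = u z * ((1 + \<i> * complex_of_real (r * z $ j)) * resolvent r j z)"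
      by (simp add: v_def algebra_simps)
    then show "v z + (of_real r * \<i>) * ?zv z = u z" by (simp add: resolvent_def)
  qed
  finally show ?thesis by (simp add: v_def osc_def)
qed

lemma osc_remove_list:
  fixes u :: "real ^ 'n::finite \<Rightarrow> complex"
  assumes par: "0 \<le> \<delta>" "\<delta> \<le> \<rho>" "\<rho> \<le> 1" "\<delta> < 1" and u: "decay 1 u" and t: "is_symbol \<rho> \<delta> a \<tau>" and r: "r \<noteq> 0"
  shows "osc (\<lambda>z. u z * resolvents r js z) (xi_ops r js \<tau>) p = osc u \<tau> p"
proof (induction js)
  case (Cons j js)
  have v: "decay 1 (\<lambda>z. u z * resolvents r js z)" using decay_mult[OF u decay_cwp0] by simp
  have "osc (\<lambda>z. u z * resolvents r (j # js) z) (xi_ops r (j # js) \<tau>) p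
      = osc (\<lambda>z. (u z * resolvents r js z) * resolvent r j z) (xi_op r j (xi_ops r js \<tau>)) p" by (simp add: ac_simps)
  also have "\<dots> = osc (\<lambda>z. u z * resolvents r js z) (xi_ops r js \<tau>) p"
    by (rule osc_remove[OF par v is_symbol_xi_ops[OF _ t] r]) (use par in simp)
  finally show ?case using Cons by simp
qed simp

lemma resolvents_scale: "resolvents r js z = resolvents 1 js (r *\<^sub>R z)"
  by (simp add: resolvents_def resolvent_def)

lemma decay_resolvents_coords_rep: "1 \<le> \<bar>r\<bar> \<Longrightarrow> decay N (resolvents r (coords_rep (2 * N)))"
  by (rule decay_resolvents[where C=1]) (simp add: norm_resolvents_coords_rep power_mono pweight_scale_le)

text \<open>Inserting the factors for both scales shows that the scale \<open>r\<close> is immaterial.\<close>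

lemma osc_scale_independent:
  fixes \<tau> :: "('n::finite) bisymbol"
  assumes par: "0 \<le> \<delta>" "\<delta> \<le> \<rho>" "\<rho> \<le> 1" "\<delta> < 1" and t: "is_symbol \<rho> \<delta> a \<tau>" and r: "1 \<le> r" and N: "1 \<le> N"
  shows "osc (resolvents r (coords_rep (2 * N))) (xi_ops r (coords_rep (2 * N)) \<tau>) p = osc (resolvents 1 (coords_rep (2 * N))) (xi_ops 1 (coords_rep (2 * N)) \<tau>) p"
proof -
  let ?J = "coords_rep (2 * N) :: 'n list"
  have rho: "0 \<le> \<rho>" using par by simp
  have d: "decay 1 (resolvents r ?J)" "decay 1 (resolvents 1 ?J)"
    using decay_resolvents_coords_rep[of r N] decay_resolvents_coords_rep[of 1 N] r N by (auto intro: decay_mono)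
  have "osc (resolvents r ?J) (xi_ops r ?J \<tau>) p = osc (\<lambda>z. resolvents r ?J z * resolvents 1 ?J z) (xi_ops 1 ?J (xi_ops r ?J \<tau>)) p"
    by (rule osc_remove_list[OF par d(1) is_symbol_xi_ops[OF rho t], symmetric]) simp
  also have "\<dots> = osc (\<lambda>z. resolvents 1 ?J z * resolvents r ?J z) (xi_ops r ?J (xi_ops 1 ?J \<tau>)) p"
    by (simp only: xi_ops_commute[OF rho t] mult.commute)
  also have "\<dots> = osc (resolvents 1 ?J) (xi_ops 1 ?J \<tau>) p"
    by (rule osc_remove_list[OF par d(2) is_symbol_xi_ops[OF rho t]]) (use r in simp)
  finally show ?thesis .
qed

subsection \<open>The transposed symbol\<close>

text \<open>Taken at scale 1, so that the inserted factors do not depend on \<open>p\<close> and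
  differentiation in \<open>p\<close> only affects the amplitude. The normalising factor (2 pi)^(-n)
  is added only in \<open>transpose1\<close>.\<close>

definition transposed_symbol :: "nat \<Rightarrow> ('n::finite) bisymbol \<Rightarrow> 'n bisymbol" where
  "transposed_symbol N \<tau> = osc (resolvents 1 (coords_rep (2 * N))) (xi_ops 1 (coords_rep (2 * N)) \<tau>)"

text \<open>For each \<open>p\<close> separately, the scale 1 of the definition is replaced by the
  scale lambda^\<delta> belonging to \<open>p\<close>. This leaves the value unchanged and makes
  \<open>osc_bound\<close> applicable.\<close>

lemma transposed_symbol_bound:
  fixes \<tau> :: "('n::finite) bisymbol"
  assumes par: "0 \<le> \<delta>" "\<delta> \<le> \<rho>" "\<rho> \<le> 1" "\<delta> < 1" and t: "is_symbol \<rho> \<delta> a \<tau>" and N: "1 \<le> N"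
  shows "\<exists>C. \<forall>p. norm (transposed_symbol N \<tau> p) \<le> C * symbol_weight a p"
proof -
  let ?J = "coords_rep (2 * N) :: 'n list"
  have "decay 1 (resolvents 1 ?J)" using decay_resolvents_coords_rep[of 1 N] N by (auto intro: decay_mono)
  from osc_bound[OF par this t, of ?J] obtain C where
    C: "\<And>p. norm (osc (\<lambda>z. resolvents 1 ?J (base_weight p powr \<delta> *\<^sub>R z)) (xi_ops (base_weight p powr \<delta>) ?J \<tau>) p) \<le> C * base_weight p powr a" by blast
  have "norm (transposed_symbol N \<tau> p) \<le> C * symbol_weight a p" for p
  proof -
    have r1: "1 \<le> base_weight p powr \<delta>" using powr_mono[OF par(1) base_weight_ge_1[of p]] base_weight_pos[of p] by simp
    have "resolvents (base_weight p powr \<delta>) ?J = (\<lambda>z. resolvents 1 ?J (base_weight p powr \<delta> *\<^sub>R z))"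
      by (rule ext) (rule resolvents_scale)
    then have "norm (transposed_symbol N \<tau> p) \<le> C * base_weight p powr a"
      using C[of p] osc_scale_independent[OF par t r1 N, of p] by (simp add: transposed_symbol_def)
    then show ?thesis by (simp add: symbol_weight_def base_weight_def)
  qed
  then show ?thesis by blast
qed

text \<open>The argument of the amplitude is \<open>(z, \<theta>, 0) + phase_map p\<close>.\<close>

definition phase_map :: "('n::finite) point \<Rightarrow> 'n point" where
  "phase_map v = (fst v, - fst (snd v) - snd (snd v), snd (snd v))"

lemma linear_phase_map: "linear phase_map"
  by (rule linearI) (auto simp: phase_map_def algebra_simps)

section \<open>Differentiation of the oscillatory integral in the parameter \<open>p\<close>\<close>

lemma base_weight_ball: "p \<in> ball p0 1 \<Longrightarrow> base_weight p \<le> base_weight p0 + 2"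
proof -
  assume p: "p \<in> ball p0 1"
  have n: "norm (fst (snd (p - p0))) \<le> norm (p - p0)" "norm (snd (snd (p - p0))) \<le> norm (p - p0)"
  proof -
    have f: "norm (fst x) \<le> norm x" "norm (snd x) \<le> norm x" for x :: "'b::real_normed_vector \<times> 'c::real_normed_vector"
      using norm_fst_le[of "fst x" "snd x"] norm_snd_le[of "snd x" "fst x"] by simp_all
    show "norm (fst (snd (p - p0))) \<le> norm (p - p0)" "norm (snd (snd (p - p0))) \<le> norm (p - p0)"
      by (rule order_trans[OF f(1) f(2)], rule order_trans[OF f(2) f(2)])
  qed
  have "norm (p - p0) \<le> 1" using p by (simp add: dist_norm norm_minus_commute)
  then have "norm (fst (snd p)) \<le> norm (fst (snd p0)) + 1" "norm (snd (snd p)) \<le> norm (snd (snd p0)) + 1"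
    using n norm_triangle_sub[of "fst (snd p)" "fst (snd p0)"] norm_triangle_sub[of "snd (snd p)" "snd (snd p0)"] by auto
  then show ?thesis by (simp add: base_weight_def japanese_def)
qed

text \<open>The phase and the factor \<open>u\<close> do not involve \<open>p\<close>, so no power
  of z or \<theta> is produced; the chain rule through \<open>phase_map\<close> only differentiates
  the amplitude.\<close>

lemma osc_integrand_param_deriv:
  assumes t: "is_symbol \<rho> \<delta> a \<tau>"
  shows "((\<lambda>p. osc_integrand u \<tau> p \<theta> z) has_derivative (\<lambda>v. \<Sum>b\<in>Basis. (phase_map v \<bullet> b) *\<^sub>R osc_integrand u (dir_deriv b \<tau>) p \<theta> z)) (at p)"
proof -
  define S where "S = (\<lambda>p :: 'a point. (fst p + z, \<theta> - fst (snd p) - snd (snd p), snd (snd p)))"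
  have "S p = (z, \<theta>, 0) + phase_map p" for p by (simp add: S_def phase_map_def)
  then have "(S has_derivative phase_map) (at p)"
    using linear_phase_map by (auto intro!: derivative_eq_intros linear_imp_has_derivative simp: fun_eq_iff[of S] S_def[symmetric] ext[of S "\<lambda>p. (z, \<theta>, 0) + phase_map p"])
  from has_derivative_compose[OF this has_derivative_dir_deriv[OF is_symbol_differentiable[OF t]]]
  have "((\<lambda>p. \<tau> (S p)) has_derivative (\<lambda>v. \<Sum>b\<in>Basis. (phase_map v \<bullet> b) *\<^sub>R dir_deriv b \<tau> (S p))) (at p)"
    by (rule has_derivative_eq_rhs) (rule ext, rule dir_deriv_lin[OF is_symbol_differentiable[OF t]])
  then have "((\<lambda>p. (iexp (z \<bullet> \<theta>) * u z) * \<tau> (S p)) has_derivative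
      (\<lambda>v. (iexp (z \<bullet> \<theta>) * u z) * (\<Sum>b\<in>Basis. (phase_map v \<bullet> b) *\<^sub>R dir_deriv b \<tau> (S p)))) (at p)"
    by (rule has_derivative_mult_right)
  then show ?thesis by (simp add: osc_integrand_def S_def sum_distrib_left mult.assoc)
qed

lemma phase_map_bound: "\<exists>K>0. \<forall>(v :: ('n::finite) point) b. b \<in> Basis \<longrightarrow> \<bar>phase_map v \<bullet> b\<bar> \<le> K * norm v"
proof -
  obtain K where K: "0 < K" "\<And>v :: 'n point. norm (phase_map v) \<le> K * norm v"
    using linear_bounded_pos[OF linear_phase_map] by blast
  have "\<bar>phase_map v \<bullet> b\<bar> \<le> K * norm v" if "b \<in> Basis" for v b :: "'n point"
    by (rule order_trans[OF Basis_le_norm[OF that] K(2)])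
  with K(1) show ?thesis by blast
qed

lemma norm_sum_phase_map_le:
  fixes v :: "('n::finite) point"
  assumes K: "\<And>v b. b \<in> Basis \<Longrightarrow> \<bar>phase_map v \<bullet> b\<bar> \<le> K * norm (v :: 'n point)"
    and X: "\<And>b. b \<in> Basis \<Longrightarrow> norm (X b :: complex) \<le> Y b"
  shows "norm (\<Sum>b\<in>Basis. (phase_map v \<bullet> b) *\<^sub>R X b) \<le> (\<Sum>b\<in>Basis. K * Y b) * norm v"
proof -
  have "norm (\<Sum>b\<in>Basis. (phase_map v \<bullet> b) *\<^sub>R X b) \<le> (\<Sum>b\<in>Basis. (K * norm v) * Y b)"
  proof (rule sum_norm_le)
    fix b :: "'n point" assume b: "b \<in> Basis"
    show "norm ((phase_map v \<bullet> b) *\<^sub>R X b) \<le> (K * norm v) * Y b"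
      unfolding norm_scaleR using K[OF b, of v] by (intro mult_mono K X b) (auto intro: order_trans[OF abs_ge_zero K[OF b]])
  qed
  also have "\<dots> = (\<Sum>b\<in>Basis. K * Y b) * norm v" by (simp add: sum_distrib_left ac_simps)
  finally show ?thesis .
qed

lemma osc_inner_param_deriv:
  assumes u: "decay 1 u" and t: "is_symbol \<rho> \<delta> a \<tau>"
  shows "((\<lambda>p. osc_inner u \<tau> p \<theta>) has_derivative (\<lambda>v. \<Sum>b\<in>Basis. (phase_map v \<bullet> b) *\<^sub>R osc_inner u (dir_deriv b \<tau>) p \<theta>)) (at p)"
proof -
  have tb: "is_symbol \<rho> \<delta> (a + symbol_order \<rho> \<delta> b) (dir_deriv b \<tau>)" if "b \<in> Basis" for b by (rule is_symbol_dir_deriv[OF t that])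
  have "\<forall>b\<in>Basis. \<exists>C. 0 \<le> C \<and> (\<forall>p \<theta> z. norm (osc_integrand u (dir_deriv b \<tau>) p \<theta> z) \<le> C * pweight z * freq_weight p \<theta> powr (a + symbol_order \<rho> \<delta> b))"
    using osc_integrand_bound[OF u tb] by blast
  then obtain C where C: "\<And>b. b \<in> Basis \<Longrightarrow> 0 \<le> C b"
    "\<And>b p \<theta> z. b \<in> Basis \<Longrightarrow> norm (osc_integrand u (dir_deriv b \<tau>) p \<theta> z) \<le> C b * pweight z * freq_weight p \<theta> powr (a + symbol_order \<rho> \<delta> b)"
    by (metis (no_types) bchoice)
  obtain K where K: "0 < K" "\<And>v b. b \<in> Basis \<Longrightarrow> \<bar>phase_map v \<bullet> b\<bar> \<le> K * norm (v :: 'a point)"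
    using phase_map_bound by blast
  \<comment> \<open>Bounds the frequency weight for all parameters in the unit ball around
    \<open>p\<close>: the weight of the parameter grows there by at most 2, one unit for each of the
    two frequencies.\<close>
  define W where "W = 2 * (base_weight p + 2) + norm \<theta>"
  let ?Y = "\<lambda>b z. C b * pweight z * W powr \<bar>a + symbol_order \<rho> \<delta> b\<bar>"
  have "((\<lambda>p. osc_inner u \<tau> p \<theta>) has_derivative (\<lambda>v. LINT z|lborel. (\<Sum>b\<in>Basis. (phase_map v \<bullet> b) *\<^sub>R osc_integrand u (dir_deriv b \<tau>) p \<theta> z))) (at p)"
    unfolding osc_inner_def
  proof (rule leibniz_frechet[where e=1 and B="\<lambda>z. \<Sum>b\<in>Basis. K * ?Y b z"])
    fix q z assume q: "q \<in> ball p 1"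
    show "((\<lambda>p. osc_integrand u \<tau> p \<theta> z) has_derivative (\<lambda>v. \<Sum>b\<in>Basis. (phase_map v \<bullet> b) *\<^sub>R osc_integrand u (dir_deriv b \<tau>) q \<theta> z)) (at q)"
      by (rule osc_integrand_param_deriv[OF t])
    have "freq_weight q \<theta> powr x \<le> W powr \<bar>x\<bar>" for x
      by (rule freq_weight_powr_bound) (use base_weight_ball[OF q] in \<open>simp add: W_def\<close>)
    then have "norm (osc_integrand u (dir_deriv b \<tau>) q \<theta> z) \<le> ?Y b z" if "b \<in> Basis" for b
      using C(1)[OF that] by (intro order_trans[OF C(2)[OF that]] mult_left_mono) auto
    from norm_sum_phase_map_le[OF K(2) this]
    show "norm (\<Sum>b\<in>Basis. (phase_map v \<bullet> b) *\<^sub>R osc_integrand u (dir_deriv b \<tau>) q \<theta> z) \<le> (\<Sum>b\<in>Basis. K * ?Y b z) * norm v" for v .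
  next
    show "integrable lborel (osc_integrand u \<tau> q \<theta>)" for q by (rule osc_integrand_integrable[OF u t])
    show "integrable lborel (\<lambda>z :: real ^ 'a. \<Sum>b\<in>Basis. K * ?Y b z)"
      by (intro Bochner_Integration.integrable_sum integrable_mult_left integrable_mult_right integrable_pweight)
    show "(\<lambda>z. \<Sum>b\<in>Basis. (phase_map v \<bullet> b) *\<^sub>R osc_integrand u (dir_deriv b \<tau>) p \<theta> z) \<in> borel_measurable lborel" for v
      using osc_integrand_measurable[OF u tb, of _ p \<theta>] by (intro borel_measurable_sum borel_measurable_scaleR) auto
  qed simp
  moreover have "(LINT z|lborel. (\<Sum>b\<in>Basis. (phase_map v \<bullet> b) *\<^sub>R osc_integrand u (dir_deriv b \<tau>) p \<theta> z)) = (\<Sum>b\<in>Basis. (phase_map v \<bullet> b) *\<^sub>R osc_inner u (dir_deriv b \<tau>) p \<theta>)" for v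
    unfolding osc_inner_def using osc_integrand_integrable[OF u tb, of _ p \<theta>]
    by (subst Bochner_Integration.integral_sum) (auto intro!: sum.cong)
  ultimately show ?thesis by simp
qed

text \<open>The second of two differentiations under the integral sign, now over \<theta>. The
  majorant is \<open>osc_inner_bound\<close> for the differentiated symbols, whose growth in the
  parameter is bounded on a unit ball.\<close>

lemma osc_param_deriv:
  fixes u :: "real ^ 'n::finite \<Rightarrow> complex"
  assumes par: "0 \<le> \<delta>" "\<delta> \<le> \<rho>" "\<rho> \<le> 1" "\<delta> < 1" and u: "decay 1 u" and t: "is_symbol \<rho> \<delta> a \<tau>"
  shows "(osc u \<tau> has_derivative (\<lambda>v. \<Sum>b\<in>Basis. (phase_map v \<bullet> b) *\<^sub>R osc u (dir_deriv b \<tau>) p)) (at p)"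
proof -
  have tb: "is_symbol \<rho> \<delta> (a + symbol_order \<rho> \<delta> b) (dir_deriv b \<tau>)" if "b \<in> Basis" for b by (rule is_symbol_dir_deriv[OF t that])
  let ?e = "\<lambda>b. \<bar>a + symbol_order \<rho> \<delta> b\<bar> + 2 * CARD('n)"
  have "\<forall>b\<in>Basis. \<exists>C. 0 \<le> C \<and> (\<forall>p \<theta>. norm (osc_inner u (dir_deriv b \<tau>) p \<theta>) \<le> C * base_weight p powr ?e b * pweight \<theta>)"
    using osc_inner_bound[OF par u tb] by blast
  then obtain C where C: "\<And>b. b \<in> Basis \<Longrightarrow> 0 \<le> C b"
    "\<And>b p \<theta>. b \<in> Basis \<Longrightarrow> norm (osc_inner u (dir_deriv b \<tau>) p \<theta>) \<le> C b * base_weight p powr ?e b * pweight \<theta>"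
    by (metis (no_types) bchoice)
  obtain K where K: "0 < K" "\<And>v b. b \<in> Basis \<Longrightarrow> \<bar>phase_map v \<bullet> b\<bar> \<le> K * norm (v :: 'n point)"
    using phase_map_bound by blast
  let ?Y = "\<lambda>b \<theta>. C b * (base_weight p + 2) powr ?e b * pweight \<theta>"
  have "((\<lambda>p. osc u \<tau> p) has_derivative (\<lambda>v. LINT \<theta>|lborel. (\<Sum>b\<in>Basis. (phase_map v \<bullet> b) *\<^sub>R osc_inner u (dir_deriv b \<tau>) p \<theta>))) (at p)"
    unfolding osc_def
  proof (rule leibniz_frechet[where e=1 and B="\<lambda>\<theta>. \<Sum>b\<in>Basis. K * ?Y b \<theta>"])
    fix q \<theta> assume q: "q \<in> ball p 1"
    show "((\<lambda>p. osc_inner u \<tau> p \<theta>) has_derivative (\<lambda>v. \<Sum>b\<in>Basis. (phase_map v \<bullet> b) *\<^sub>R osc_inner u (dir_deriv b \<tau>) q \<theta>)) (at q)"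
      by (rule osc_inner_param_deriv[OF u t])
    have "norm (osc_inner u (dir_deriv b \<tau>) q \<theta>) \<le> ?Y b \<theta>" if "b \<in> Basis" for b
      using C(1)[OF that] base_weight_ball[OF q] base_weight_pos[of q]
      by (intro order_trans[OF C(2)[OF that]] mult_left_mono mult_right_mono powr_mono2) auto
    from norm_sum_phase_map_le[OF K(2) this]
    show "norm (\<Sum>b\<in>Basis. (phase_map v \<bullet> b) *\<^sub>R osc_inner u (dir_deriv b \<tau>) q \<theta>) \<le> (\<Sum>b\<in>Basis. K * ?Y b \<theta>) * norm v" for v .
  next
    show "integrable lborel (osc_inner u \<tau> q)" for q by (rule osc_inner_integrable[OF par u t])
    show "integrable lborel (\<lambda>\<theta> :: real ^ 'n. \<Sum>b\<in>Basis. K * ?Y b \<theta>)"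
      by (intro Bochner_Integration.integrable_sum integrable_mult_right integrable_pweight)
    show "(\<lambda>\<theta>. \<Sum>b\<in>Basis. (phase_map v \<bullet> b) *\<^sub>R osc_inner u (dir_deriv b \<tau>) p \<theta>) \<in> borel_measurable lborel" for v
      using osc_inner_integrable[OF par u tb, of _ p] by (intro borel_measurable_sum borel_measurable_scaleR) auto
  qed simp
  moreover have "(LINT \<theta>|lborel. (\<Sum>b\<in>Basis. (phase_map v \<bullet> b) *\<^sub>R osc_inner u (dir_deriv b \<tau>) p \<theta>)) = (\<Sum>b\<in>Basis. (phase_map v \<bullet> b) *\<^sub>R osc u (dir_deriv b \<tau>) p)" for v
    unfolding osc_def using osc_inner_integrable[OF par u tb, of _ p]
    by (subst Bochner_Integration.integral_sum) (auto intro!: sum.cong)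
  ultimately show ?thesis by simp
qed

text \<open>The map sends x-directions to x-directions and mixes \<xi> and \<eta> only with each
  other. As both frequencies have the same order -\<rho>, the chain rule respects orders.\<close>

lemma symbol_order_phase_map:
  assumes "v \<in> Basis" "b \<in> Basis" "phase_map v \<bullet> b \<noteq> 0"
  shows "symbol_order \<rho> \<delta> b = symbol_order \<rho> \<delta> v"
proof -
  have "(\<exists>i. v = unit_x i) \<or> (\<exists>i. v = unit_xi i) \<or> (\<exists>i. v = unit_eta i)"
    "(\<exists>i. b = unit_x i) \<or> (\<exists>i. b = unit_xi i) \<or> (\<exists>i. b = unit_eta i)"
    using assms(1,2) by (auto simp: Basis_triple)
  then show ?thesis
    using assms(3) by (elim disjE exE) (simp_all add: phase_map_def, simp_all add: unit_x_def unit_xi_def unit_eta_def)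
qed

text \<open>A basis derivative of the transposed symbol is a combination of transposed symbols of
  basis derivatives of \<open>\<tau>\<close>, and every term with nonzero coefficient has the right
  order. So the bound for the value, available for all symbols and orders at once, carries the
  induction, with \<open>N\<close> fixed.\<close>

lemma is_symbol_transposed_symbol:
  fixes \<tau> :: "('n::finite) bisymbol"
  assumes par: "0 \<le> \<delta>" "\<delta> \<le> \<rho>" "\<rho> \<le> 1" "\<delta> < 1" and N: "1 \<le> N" and t: "is_symbol \<rho> \<delta> a \<tau>"
  shows "is_symbol \<rho> \<delta> a (transposed_symbol N \<tau>)"
proof -
  let ?J = "coords_rep (2 * N) :: 'n list"
  have rho: "0 \<le> \<rho>" using par by simp
  have u: "decay 1 (resolvents 1 ?J)" using decay_resolvents_coords_rep[of 1 N] N by (auto intro: decay_mono)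
  have der: "(transposed_symbol N \<tau> has_derivative (\<lambda>v. \<Sum>b\<in>Basis. (phase_map v \<bullet> b) *\<^sub>R transposed_symbol N (dir_deriv b \<tau>) p)) (at p)"
    if t: "is_symbol \<rho> \<delta> a \<tau>" for a p and \<tau> :: "'n bisymbol"
    using osc_param_deriv[OF par u is_symbol_xi_ops[OF rho t, of 1 ?J], of p]
    by (simp add: transposed_symbol_def dir_deriv_xi_ops[OF rho t])
  have "weighted_Ck symbol_weight (symbol_order \<rho> \<delta>) k a (transposed_symbol N \<tau>)" for k
    using t
  proof (induction k arbitrary: a \<tau>)
    case 0
    have "transposed_symbol N \<tau> differentiable (at p)" for p using der[OF 0] differentiable_def by blast
    then show ?case using transposed_symbol_bound[OF par 0 N] by (simp add: continuous_if_differentiable)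
  next
    case (Suc k)
    have "transposed_symbol N \<tau> differentiable (at p)" for p using der[OF Suc.prems] differentiable_def by blast
    moreover have "weighted_Ck symbol_weight (symbol_order \<rho> \<delta>) k (a + symbol_order \<rho> \<delta> v) (dir_deriv v (transposed_symbol N \<tau>))" if v: "v \<in> Basis" for v
    proof -
      have "dir_deriv v (transposed_symbol N \<tau>) = (\<lambda>p. \<Sum>b\<in>Basis. of_real (phase_map v \<bullet> b) * transposed_symbol N (dir_deriv b \<tau>) p)"
        by (rule ext, subst dir_deriv_eqI[OF der[OF Suc.prems]]) (simp add: scaleR_conv_of_real)
      moreover have "weighted_Ck symbol_weight (symbol_order \<rho> \<delta>) k (a + symbol_order \<rho> \<delta> v) (\<lambda>p. of_real (phase_map v \<bullet> b) * transposed_symbol N (dir_deriv b \<tau>) p)"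
        if b: "b \<in> Basis" for b
      proof (cases "phase_map v \<bullet> b = 0")
        case True then show ?thesis by (simp add: weighted_Ck_zero symbol_weight_nonneg)
      next
        case False
        from symbol_order_phase_map[OF v b this] Suc.IH[OF is_symbol_dir_deriv[OF Suc.prems b]]
        show ?thesis by (intro weighted_Ck_cmult) simp
      qed
      ultimately show ?thesis by (simp only:) (rule weighted_Ck_sum[OF symbol_weight_nonneg])
    qed
    ultimately show ?case using transposed_symbol_bound[OF par Suc.prems N] by simp
  qed
  then show ?thesis by (simp add: is_symbol_def weighted_smooth_def)
qed

subsection \<open>Schwartz functions and the Fourier transform\<close>

text \<open>Schwartz seminorms bound monomials times derivatives, whereas the weight needs a product
  of powers of 1 + x_i^2. At each point this product is at most a constant times a single monomial,
  selected by which coordinates exceed 1.\<close>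

lemma schwartz_decay:
  fixes f :: "real ^ 'n::finite \<Rightarrow> complex"
  assumes "f \<in> schwartz" shows "decay N f"
  unfolding decay_def
proof (rule weighted_smooth_if_dir_derivs_bounds)
  show sm: "smooth f" using assms by (simp add: schwartz_def)
  fix vs :: "(real ^ 'n) list" assume vs: "set vs \<subseteq> Basis"
  let ?e = "\<lambda>i :: 'n. axis i (1::real)"
  define \<beta> where "\<beta> = (\<lambda>i. count (mset vs) (?e i))"
  have "mset (dir_list ?e \<beta>) = mset vs"
    unfolding \<beta>_def by (rule mset_dir_list[OF inj_axes(4)]) (use vs in \<open>simp add: Basis_vec_axis\<close>)
  then have D: "dir_derivs vs f = multi_deriv ?e \<beta> f"
    unfolding multi_deriv_dir_list by (intro dir_derivs_perm[OF sm vs]) simp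
  \<comment> \<open>The selected monomial varies with the point, but only through this finite set of
    exponents; summing over it gives a constant independent of the point.\<close>
  define F where "F = {\<alpha> :: 'n \<Rightarrow> nat. \<forall>i. \<alpha> i \<in> {0, 2 * N}}"
  have finF: "finite F"
    using finite_set_of_finite_funs[of "UNIV :: 'n set" "{0, 2 * N}" 0] by (simp add: F_def)
  have "\<forall>\<alpha>. \<exists>C. \<forall>x. norm ((\<Prod>i\<in>UNIV. (x $ i) ^ \<alpha> i) *\<^sub>R dir_derivs vs f x) \<le> C"
    using assms unfolding schwartz_def D bounded_iff by auto
  then obtain C where C: "\<And>\<alpha> x. norm ((\<Prod>i\<in>UNIV. (x $ i) ^ \<alpha> i) *\<^sub>R dir_derivs vs f x) \<le> C \<alpha>" by metis
  have C0: "0 \<le> C \<alpha>" for \<alpha> using order_trans[OF norm_ge_zero C[where x=0]] .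
  have "norm (dir_derivs vs f x) \<le> (2 ^ (N * CARD('n)) * (\<Sum>\<alpha>\<in>F. C \<alpha>)) * pweight x ^ N" for x
  proof -
    \<comment> \<open>A coordinate of modulus at most 1 needs no monomial; for a larger one 1 +
      x_i^2 is at most twice x_i^2.\<close>
    define \<alpha> where "\<alpha> = (\<lambda>i. if \<bar>x $ i\<bar> \<le> 1 then 0 else 2 * N)"
    have \<alpha>: "\<alpha> \<in> F" by (simp add: \<alpha>_def F_def)
    have "(1 + (x $ i)\<^sup>2) ^ N \<le> 2 ^ N * \<bar>x $ i\<bar> ^ \<alpha> i" for i
    proof (cases "\<bar>x $ i\<bar> \<le> 1")
      case True
      then have "1 + (x $ i)\<^sup>2 \<le> 2" by (simp add: abs_square_le_1)
      then show ?thesis using True power_mono[of "1 + (x $ i)\<^sup>2" 2 N] by (simp add: \<alpha>_def)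
    next
      case False
      then have "1 \<le> \<bar>x $ i\<bar>\<^sup>2" by (intro one_le_power) simp
      then have "1 + (x $ i)\<^sup>2 \<le> 2 * \<bar>x $ i\<bar>\<^sup>2" by simp
      then have "(1 + (x $ i)\<^sup>2) ^ N \<le> (2 * \<bar>x $ i\<bar>\<^sup>2) ^ N" by (rule power_mono) simp
      also have "\<dots> = 2 ^ N * \<bar>x $ i\<bar> ^ (2 * N)" by (simp only: power_mult_distrib power_mult)
      finally show ?thesis using False by (simp add: \<alpha>_def)
    qed
    then have "(\<Prod>i\<in>UNIV. (1 + (x $ i)\<^sup>2) ^ N) \<le> (\<Prod>i\<in>UNIV. 2 ^ N * \<bar>x $ i\<bar> ^ \<alpha> i)"
      by (intro prod_mono) auto
    also have "\<dots> = 2 ^ (N * CARD('n)) * (\<Prod>i\<in>UNIV. \<bar>x $ i\<bar> ^ \<alpha> i)"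
      by (simp add: prod.distrib power_mult)
    finally have 1: "(\<Prod>i\<in>UNIV. (1 + (x $ i)\<^sup>2) ^ N) \<le> 2 ^ (N * CARD('n)) * (\<Prod>i\<in>UNIV. \<bar>x $ i\<bar> ^ \<alpha> i)" .
    have "(\<Prod>i\<in>UNIV. (1 + (x $ i)\<^sup>2) ^ N) * norm (dir_derivs vs f x) \<le>
        2 ^ (N * CARD('n)) * (\<Prod>i\<in>UNIV. \<bar>x $ i\<bar> ^ \<alpha> i) * norm (dir_derivs vs f x)"
      by (rule mult_right_mono[OF 1]) simp
    also have "\<dots> = 2 ^ (N * CARD('n)) * norm ((\<Prod>i\<in>UNIV. (x $ i) ^ \<alpha> i) *\<^sub>R dir_derivs vs f x)"
      by (simp add: abs_prod power_abs)
    also have "\<dots> \<le> 2 ^ (N * CARD('n)) * (\<Sum>\<alpha>\<in>F. C \<alpha>)"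
      by (intro mult_left_mono order_trans[OF C member_le_sum[OF \<alpha>, of C]] C0 finF) auto
    finally have "pweight x ^ N * ((\<Prod>i\<in>UNIV. (1 + (x $ i)\<^sup>2) ^ N) * norm (dir_derivs vs f x)) \<le>
        pweight x ^ N * (2 ^ (N * CARD('n)) * (\<Sum>\<alpha>\<in>F. C \<alpha>))" by (intro mult_left_mono) auto
    moreover have "pweight x ^ N * (\<Prod>i\<in>UNIV. (1 + (x $ i)\<^sup>2) ^ N) = 1"
      unfolding pweight_def prod_power_distrib[symmetric] power_mult_distrib[symmetric] prod.distrib[symmetric]
      by (simp add: add_nonneg_eq_0_iff)
    ultimately show ?thesis by (simp add: mult.assoc[symmetric]) (simp add: ac_simps)
  qed
  then show "\<exists>C. \<forall>x. norm (dir_derivs vs f x) \<le> C * pweight x ^ N" by blast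
qed

text \<open>A bounded smooth function of the space variable is a symbol of order 0 with \<rho> =
  \<delta> = 0. The estimates for inner integrals thereby also apply to Fourier transforms and to
  \<open>reg_transform\<close>. The sign produces f(x - z) at the point (-x, 0, 0).\<close>

lemma is_symbol_fst:
  fixes f :: "real ^ 'n::finite \<Rightarrow> complex"
  assumes "decay 0 f"
  shows "is_symbol 0 0 0 (\<lambda>q. f (- fst q))"
proof -
  let ?L = "\<lambda>q :: 'n point. - fst q"
  have "symbol_weight 0 q = 1" for q :: "'n point"
    using japanese_pos[of "fst (snd q)" "snd (snd q)"] by (simp add: symbol_weight_def)
  then have K: "\<exists>K\<ge>0. \<forall>q. pweight (0 + ?L q) ^ 0 \<le> K * symbol_weight a q" if "a \<in> {0}" for a
    using that by (intro exI[of _ 1]) simp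
  have B: "?L b = 0 \<or> (\<exists>t b'. b' \<in> Basis \<and> ?L b = t *\<^sub>R b' \<and> 0 = symbol_order 0 0 b)" if b: "b \<in> Basis" for b
  proof (cases "fst b = 0")
    case False
    then obtain i where "b = unit_x i" using b by (auto simp: Basis_triple unit_xi_def unit_eta_def)
    then have "(axis i 1 :: real ^ 'n) \<in> Basis \<and> ?L b = (-1) *\<^sub>R axis i 1 \<and> 0 = symbol_order 0 0 b"
      by (simp add: unit_x_def symbol_order_def)
    then show ?thesis by blast
  qed simp
  have "weighted_smooth symbol_weight (symbol_order 0 0) 0 (\<lambda>q. f (0 + ?L q))"
  proof (rule weighted_smooth_affine[where A="{0}" and W="\<lambda>_ z. pweight z ^ 0" and dg="\<lambda>_. 0"])
    show "linear ?L" by (rule linearI) auto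
    show "weighted_smooth (\<lambda>_ z. pweight z ^ 0) (\<lambda>_. 0) 0 f" using assms by (simp only: decay_def)
  qed (use K B in \<open>simp_all add: symbol_weight_nonneg symbol_order_def\<close>)
  then show ?thesis by (simp add: is_symbol_def)
qed

text \<open>For \<delta> = 0 the scale s = 1 is admissible whatever the frequency weight, so any
  number of integrations by parts is free of loss.\<close>

lemma osc_inner_rapid:
  fixes u :: "real ^ 'n::finite \<Rightarrow> complex"
  assumes "decay 1 u" "is_symbol 0 0 0 \<tau>"
  shows "\<exists>C\<ge>0. \<forall>p \<theta>. norm (osc_inner u \<tau> p \<theta>) \<le> C * pweight \<theta> ^ N"
proof -
  from osc_inner_decay[OF assms, of "coords_rep (2 * N)"] obtain C where C: "0 \<le> C" "\<And>p \<theta> r s. 1 \<le> r \<Longrightarrow> 0 \<le> s \<Longrightarrow> s * r \<le> 1 \<Longrightarrow> s * freq_weight p \<theta> powr 0 \<le> 1 \<Longrightarrow>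
      norm (osc_inner (\<lambda>z. u (r *\<^sub>R z)) \<tau> p \<theta>) * bracket_prod s (coords_rep (2 * N)) \<theta> \<le> C * freq_weight p \<theta> powr 0 / r ^ CARD('n)" by blast
  have "norm (osc_inner u \<tau> p \<theta>) \<le> C * pweight \<theta> ^ N" for p \<theta>
  proof -
    have "freq_weight p \<theta> powr 0 = 1" using freq_weight_pos[of p \<theta>] by simp
    then have 1: "norm (osc_inner u \<tau> p \<theta>) * bracket_prod 1 (coords_rep (2 * N)) \<theta> \<le> C"
      using C(2)[of 1 1 p \<theta>] by simp
    have "norm (osc_inner u \<tau> p \<theta>) = norm (osc_inner u \<tau> p \<theta>) * bracket_prod 1 (coords_rep (2 * N)) \<theta> * norm (resolvents 1 (coords_rep (2 * N)) \<theta>)"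
      using bracket_prod_resolvents[of 1 "coords_rep (2 * N)" \<theta>] by (simp add: mult.assoc)
    also have "\<dots> \<le> C * norm (resolvents 1 (coords_rep (2 * N)) \<theta>)" by (rule mult_right_mono[OF 1]) simp
    finally show ?thesis by (simp add: norm_resolvents_coords_rep)
  qed
  then show ?thesis using C(1) by blast
qed

lemma is_symbol_const: "is_symbol 0 0 0 (\<lambda>q. c)"
  using is_symbol_fst[OF decay_const[of c]] by simp

text \<open>With the constant amplitude 1 the inner integral is a Fourier transform, which thus
  inherits measurability and rapid decay.\<close>

lemma fourier_eq_osc_inner:
  fixes f :: "real ^ 'n::finite \<Rightarrow> complex"
  shows "fourier f \<xi> = (1 / (2 * pi) ^ CARD('n)) *\<^sub>R osc_inner f (\<lambda>q. 1) 0 (- \<xi>)"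
proof -
  have "osc_integrand f (\<lambda>q. 1) 0 (- \<xi>) = (\<lambda>x. f x * exp (- \<i> * complex_of_real (x \<bullet> \<xi>)))"
    by (simp add: osc_integrand_def fun_eq_iff mult.commute)
  then show ?thesis by (simp add: fourier_def osc_inner_def)
qed

lemma fourier_measurable:
  assumes "decay 1 f" shows "fourier f \<in> borel_measurable borel"
proof -
  have [measurable]: "(\<lambda>\<xi>. osc_inner f (\<lambda>q. 1) 0 (- \<xi>)) \<in> borel_measurable borel"
    by (rule osc_inner_measurable[OF assms is_symbol_const]) (auto intro!: continuous_intros)
  show ?thesis unfolding fourier_eq_osc_inner[abs_def] by measurable
qed

lemma fourier_rapid:
  fixes f :: "real ^ 'n::finite \<Rightarrow> complex"
  assumes "decay 1 f"
  shows "\<exists>C\<ge>0. \<forall>\<xi>. norm (fourier f \<xi>) \<le> C * pweight \<xi> ^ N"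
proof -
  from osc_inner_rapid[OF assms is_symbol_const[of 1], of N] obtain C where C: "0 \<le> C" "\<And>p \<theta>. norm (osc_inner f (\<lambda>q. 1) p \<theta>) \<le> C * pweight \<theta> ^ N"
    by blast
  have "norm (fourier f \<xi>) \<le> ((1 / (2 * pi) ^ CARD('n)) * C) * pweight \<xi> ^ N" for \<xi>
    unfolding fourier_eq_osc_inner norm_scaleR
    using mult_left_mono[OF C(2)[of 0 "- \<xi>"], of "1 / (2 * pi) ^ CARD('n)"] by (simp add: abs_mult)
  then show ?thesis using C(1) by (intro exI[of _ "(1 / (2 * pi) ^ CARD('n)) * C"]) auto
qed

section \<open>Gaussian functions and Fourier inversion\<close>

definition gauss :: "real ^ 'n::finite \<Rightarrow> real" where
  "gauss w = (\<Prod>i\<in>UNIV. exp (- (w $ i)\<^sup>2 / 2))"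

lemma gauss_pos: "0 < gauss w" by (simp add: gauss_def prod_pos)

lemma gauss_le_1: "gauss w \<le> 1" unfolding gauss_def by (rule prod_le_1) auto

lemma continuous_on_gauss [continuous_intros]:
  "continuous_on A f \<Longrightarrow> continuous_on A (\<lambda>x. gauss (f x))"
  unfolding gauss_def by (intro continuous_intros) auto

text \<open>Read off from the characteristic function of the standard normal distribution, whose
  density is the Gaussian divided by sqrt (2 pi).\<close>

lemma gaussian_1d:
  "integrable lborel (\<lambda>x::real. complex_of_real (exp (- x\<^sup>2 / 2)) * iexp (x * t))"
  "(LINT x|lborel. complex_of_real (exp (- x\<^sup>2 / 2)) * iexp (x * t)) = of_real (sqrt (2 * pi) * exp (- t\<^sup>2 / 2))"
proof -
  have "integrable lborel (\<lambda>x. sqrt (2 * pi) * std_normal_density x)"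
    by (intro integrable_mult_right integrable_normal_density) simp
  moreover have e: "sqrt (2 * pi) * std_normal_density x = exp (- x\<^sup>2 / 2)" for x
    by (simp add: std_normal_density_def)
  ultimately have i: "integrable lborel (\<lambda>x::real. exp (- x\<^sup>2 / 2))" by simp
  show "integrable lborel (\<lambda>x::real. complex_of_real (exp (- x\<^sup>2 / 2)) * iexp (x * t))"
    by (rule Bochner_Integration.integrable_bound[OF i]) (auto simp: norm_mult)
  have "char std_normal_distribution t = (LINT x|lborel. std_normal_density x *\<^sub>R iexp (t * x))"
    unfolding char_def by (subst integral_density) (auto simp: normal_density_nonneg)
  then have "(LINT x|lborel. std_normal_density x *\<^sub>R iexp (t * x)) = of_real (exp (- (t\<^sup>2) / 2))"
    by (simp add: char_std_normal_distribution)
  then have "sqrt (2 * pi) *\<^sub>R (LINT x|lborel. std_normal_density x *\<^sub>R iexp (t * x)) = sqrt (2 * pi) *\<^sub>R of_real (exp (- (t\<^sup>2) / 2))"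
    by simp
  then have "(LINT x|lborel. (sqrt (2 * pi) * std_normal_density x) *\<^sub>R iexp (t * x)) = of_real (sqrt (2 * pi) * exp (- (t\<^sup>2) / 2))"
    by (simp only: integral_scaleR_right[symmetric] scaleR_scaleR) (simp add: scaleR_conv_of_real)
  then show "(LINT x|lborel. complex_of_real (exp (- x\<^sup>2 / 2)) * iexp (x * t)) = of_real (sqrt (2 * pi) * exp (- t\<^sup>2 / 2))"
    unfolding e by (simp add: scaleR_conv_of_real mult.commute)
qed

lemma gauss_fourier:
  fixes v :: "real ^ 'n::finite"
  shows "integrable lborel (\<lambda>x. of_real (gauss x) * iexp (x \<bullet> v))"
    and "(LINT x|lborel. of_real (gauss x) * iexp (x \<bullet> v)) = of_real (sqrt (2 * pi) ^ CARD('n) * gauss v)"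
proof -
  have e: "of_real (gauss x) * iexp (x \<bullet> v) = (\<Prod>i\<in>UNIV. complex_of_real (exp (- (x $ i)\<^sup>2 / 2)) * iexp (x $ i * v $ i))"
    for x :: "real ^ 'n"
  proof -
    have "iexp (x \<bullet> v) = (\<Prod>i\<in>UNIV. iexp (x $ i * v $ i))"
      by (simp add: inner_vec_def exp_sum[symmetric] sum_distrib_left)
    moreover have "complex_of_real (gauss x) = (\<Prod>i\<in>UNIV. complex_of_real (exp (- (x $ i)\<^sup>2 / 2)))"
      by (simp only: gauss_def of_real_prod)
    ultimately show ?thesis by (simp only: prod.distrib)
  qed
  show "integrable lborel (\<lambda>x. of_real (gauss x) * iexp (x \<bullet> v))"
    unfolding e by (rule integral_prod_coordinates(1)) (rule gaussian_1d(1))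
  show "(LINT x|lborel. of_real (gauss x) * iexp (x \<bullet> v)) = of_real (sqrt (2 * pi) ^ CARD('n) * gauss v)"
    unfolding e by (subst integral_prod_coordinates(2)[OF gaussian_1d(1)], subst gaussian_1d(2))
      (simp add: prod.distrib gauss_def)
qed

lemma gauss_integral:
  shows "integrable lborel (gauss :: real ^ 'n::finite \<Rightarrow> real)"
    and "(LINT x|lborel. complex_of_real (gauss (x :: real ^ 'n))) = of_real (sqrt (2 * pi) ^ CARD('n))"
proof -
  show "(LINT x|lborel. complex_of_real (gauss (x :: real ^ 'n))) = of_real (sqrt (2 * pi) ^ CARD('n))"
    using gauss_fourier(2)[of "0 :: real ^ 'n"] by (simp add: gauss_def)
  have "integrable lborel (\<lambda>x :: real ^ 'n. complex_of_real (gauss x))"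
    using gauss_fourier(1)[of "0 :: real ^ 'n"] by simp
  then show "integrable lborel (gauss :: real ^ 'n \<Rightarrow> real)" using integrable_Re by fastforce
qed

lemma gauss_fourier_scaled:
  fixes v :: "real ^ 'n::finite"
  assumes "0 < \<epsilon>"
  shows "(LINT x|lborel. of_real (gauss (\<epsilon> *\<^sub>R x)) * iexp (x \<bullet> v))
      = of_real ((1 / \<epsilon>) ^ CARD('n) * (sqrt (2 * pi) ^ CARD('n) * gauss ((1 / \<epsilon>) *\<^sub>R v)))"
proof -
  let ?f = "\<lambda>x :: real ^ 'n. complex_of_real (gauss (\<epsilon> *\<^sub>R x)) * iexp (x \<bullet> v)"
  have m: "?f \<in> borel_measurable borel"
    by (intro borel_measurable_continuous_onI continuous_intros)
  have "integral\<^sup>L lborel ?f = (1 / \<epsilon>) ^ CARD('n) *\<^sub>R (LINT x|lborel. ?f (0 + (1 / \<epsilon>) *\<^sub>R x))"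
    using lborel_affine_transform(1)[OF _ m, of "1 / \<epsilon>" 0] assms by simp
  also have "(LINT x|lborel. ?f (0 + (1 / \<epsilon>) *\<^sub>R x)) = (LINT x|lborel. of_real (gauss x) * iexp (x \<bullet> ((1 / \<epsilon>) *\<^sub>R v)))"
    using assms by simp
  finally show ?thesis unfolding gauss_fourier(2) by (simp add: scaleR_conv_of_real)
qed

lemma dominated_limit:
  fixes s :: "nat \<Rightarrow> 'a::euclidean_space \<Rightarrow> complex"
  assumes "\<And>i. s i \<in> borel_measurable borel" "f \<in> borel_measurable borel" "integrable lborel w"
    "\<And>x. (\<lambda>i. s i x) \<longlonglongrightarrow> f x" "\<And>i x. norm (s i x) \<le> w x"
  shows "(\<lambda>i. integral\<^sup>L lborel (s i)) \<longlonglongrightarrow> integral\<^sup>L lborel f"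
  by (rule integral_dominated_convergence[where w=w]) (use assms in auto)

text \<open>Gaussian summation: the damped inversion integral is an average of \<open>f\<close>
  around \<open>x\<close> against a Gaussian of width \<open>eps\<close>. Both sides pass to the
  limit by dominated convergence, the left one because the transform is already known to be
  integrable.\<close>

lemma fourier_inversion:
  fixes f :: "real ^ 'n::finite \<Rightarrow> complex"
  assumes f: "decay 1 f"
  shows "(LINT \<xi>|lborel. fourier f \<xi> * iexp (x \<bullet> \<xi>)) = f x"
proof -
  define F where "F = (\<lambda>\<xi>. osc_inner f (\<lambda>q. 1) 0 (- \<xi>))"
  define eps :: "nat \<Rightarrow> real" where "eps = (\<lambda>k. 1 / real (Suc k))"
  have eps: "0 < eps k" for k by (simp add: eps_def)
  have eps0: "eps \<longlonglongrightarrow> 0" unfolding eps_def by (rule LIMSEQ_Suc[OF lim_1_over_n])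
  have Fm [measurable]: "F \<in> borel_measurable borel"
    unfolding F_def by (rule osc_inner_measurable[OF f is_symbol_const]) (auto intro!: continuous_intros)
  obtain C where C: "0 \<le> C" "\<And>p \<theta>. norm (osc_inner f (\<lambda>q. 1) p \<theta>) \<le> C * pweight \<theta> ^ 1"
    using osc_inner_rapid[OF f is_symbol_const[of 1], of 1] by blast
  have FC: "norm (F \<xi>) \<le> C * pweight \<xi>" for \<xi> using C(2)[of 0 "- \<xi>"] by (simp add: F_def)
  obtain D where D: "0 \<le> D" "\<And>z. norm (f z) \<le> D * pweight z ^ 1" by (rule decay_boundE[OF f]) blast
  have cf: "continuous_on UNIV f" by (rule decay_continuous[OF f])
  have Feq: "F \<xi> = (LINT y|lborel. f y * exp (- \<i> * of_real (y \<bullet> \<xi>)))" for \<xi>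
    by (simp add: F_def osc_inner_def osc_integrand_def mult.commute)
  let ?c = "sqrt (2 * pi) ^ CARD('n)"
  \<comment> \<open>The damping makes the double integral absolutely convergent. The \<xi>-integral
    is then a Gaussian concentrated at y = x, and the substitution y = x - eps w removes all powers
    of eps.\<close>
  have approx: "(LINT \<xi>|lborel. of_real (gauss (eps k *\<^sub>R \<xi>)) * (F \<xi> * iexp (x \<bullet> \<xi>)))
      = (LINT w|lborel. f (x - eps k *\<^sub>R w) * of_real (?c * gauss w))" for k
  proof -
    let ?e = "eps k"
    let ?G = "\<lambda>\<xi> y. of_real (gauss (?e *\<^sub>R \<xi>)) * (f y * iexp (\<xi> \<bullet> (x - y)))"
    have gi: "integrable lborel (\<lambda>\<xi> :: real ^ 'n. gauss (?e *\<^sub>R \<xi>))"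
      using lborel_affine_transform(2)[of ?e "gauss :: real ^ 'n \<Rightarrow> real" 0] gauss_integral(1)[where 'n='n] eps[of k]
      by (simp add: borel_measurable_continuous_onI continuous_on_gauss)
    have "(LINT \<xi>|lborel. of_real (gauss (?e *\<^sub>R \<xi>)) * (F \<xi> * iexp (x \<bullet> \<xi>))) = (LINT \<xi>|lborel. LINT y|lborel. ?G \<xi> y)"
    proof (rule Bochner_Integration.integral_cong[OF refl])
      fix \<xi> :: "real ^ 'n"
      have "F \<xi> * iexp (x \<bullet> \<xi>) = (LINT y|lborel. f y * exp (- \<i> * of_real (y \<bullet> \<xi>)) * iexp (x \<bullet> \<xi>))"
        unfolding Feq by (rule integral_mult_left_zero[symmetric])
      also have "\<dots> = (LINT y|lborel. f y * iexp (\<xi> \<bullet> (x - y)))"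
        by (intro Bochner_Integration.integral_cong refl)
          (simp add: exp_add[symmetric] algebra_simps inner_commute mult.assoc)
      finally show "of_real (gauss (?e *\<^sub>R \<xi>)) * (F \<xi> * iexp (x \<bullet> \<xi>)) = (LINT y|lborel. ?G \<xi> y)"
        by (simp only: integral_mult_right_zero)
    qed
    also have "\<dots> = (LINT y|lborel. LINT \<xi>|lborel. ?G \<xi> y)"
    proof (rule dominated_swap(2)[where p="\<lambda>\<xi>. gauss (?e *\<^sub>R \<xi>)" and q="\<lambda>y. D * pweight y"])
      show "(\<lambda>(\<xi>, y). ?G \<xi> y) \<in> borel_measurable (lborel \<Otimes>\<^sub>M lborel)"
        unfolding case_prod_unfold
        by (intro borel_measurable_cont_pair continuous_intros continuous_on_comp_UNIV[OF cf])
      show "norm (?G \<xi> y) \<le> gauss (?e *\<^sub>R \<xi>) * (D * pweight y)" for \<xi> y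
        using D(2)[of y] gauss_pos[of "?e *\<^sub>R \<xi>"] by (simp add: norm_mult mult_left_mono)
    qed (use gi in \<open>auto intro!: integrable_mult_right integrable_pweight\<close>)
    also have "\<dots> = (LINT y|lborel. f y * of_real ((1 / ?e) ^ CARD('n) * (?c * gauss ((1 / ?e) *\<^sub>R (x - y)))))"
    proof (rule Bochner_Integration.integral_cong[OF refl])
      fix y
      have "(LINT \<xi>|lborel. ?G \<xi> y) = (LINT \<xi>|lborel. f y * (of_real (gauss (?e *\<^sub>R \<xi>)) * iexp (\<xi> \<bullet> (x - y))))"
        by (simp add: ac_simps)
      also have "\<dots> = f y * (LINT \<xi>|lborel. of_real (gauss (?e *\<^sub>R \<xi>)) * iexp (\<xi> \<bullet> (x - y)))"
        by (rule integral_mult_right_zero)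
      finally show "(LINT \<xi>|lborel. ?G \<xi> y) = f y * of_real ((1 / ?e) ^ CARD('n) * (?c * gauss ((1 / ?e) *\<^sub>R (x - y))))"
        unfolding gauss_fourier_scaled[OF eps] .
    qed
    also have "\<dots> = \<bar>- ?e\<bar> ^ CARD('n) *\<^sub>R (LINT w|lborel. f (x + (- ?e) *\<^sub>R w) * of_real ((1 / ?e) ^ CARD('n) * (?c * gauss ((1 / ?e) *\<^sub>R (x - (x + (- ?e) *\<^sub>R w))))))"
    proof -
      let ?h = "\<lambda>y. f y * complex_of_real ((1 / ?e) ^ CARD('n) * (?c * gauss ((1 / ?e) *\<^sub>R (x - y))))"
      have "?h \<in> borel_measurable borel"
        by (intro borel_measurable_continuous_onI continuous_intros cf)
      from lborel_affine_transform(1)[OF _ this, of "- ?e" x] eps[of k] show ?thesis by simp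
    qed
    also have "\<dots> = (LINT w|lborel. ?e ^ CARD('n) *\<^sub>R (f (x - ?e *\<^sub>R w) * of_real ((1 / ?e) ^ CARD('n) * (?c * gauss w))))"
      using eps[of k] by (simp add: abs_of_pos)
    also have "\<dots> = (LINT w|lborel. f (x - ?e *\<^sub>R w) * of_real (?c * gauss w))"
      using eps[of k] by (intro Bochner_Integration.integral_cong refl) (simp add: scaleR_conv_of_real power_one_over)
    finally show ?thesis .
  qed
  have lim1: "(\<lambda>k. LINT \<xi>|lborel. of_real (gauss (eps k *\<^sub>R \<xi>)) * (F \<xi> * iexp (x \<bullet> \<xi>))) \<longlonglongrightarrow> (LINT \<xi>|lborel. F \<xi> * iexp (x \<bullet> \<xi>))"
  proof (rule dominated_limit[where w="\<lambda>\<xi>. C * pweight \<xi>"])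
    have g: "(\<lambda>\<xi>. complex_of_real (gauss (eps k *\<^sub>R \<xi>))) \<in> borel_measurable borel" "(\<lambda>\<xi>. iexp (x \<bullet> \<xi>)) \<in> borel_measurable borel" for k
      by (intro borel_measurable_continuous_onI continuous_intros)+
    show "(\<lambda>\<xi>. of_real (gauss (eps k *\<^sub>R \<xi>)) * (F \<xi> * iexp (x \<bullet> \<xi>))) \<in> borel_measurable borel" for k
      by (intro borel_measurable_times g Fm)
    show "(\<lambda>\<xi>. F \<xi> * iexp (x \<bullet> \<xi>)) \<in> borel_measurable borel"
      by (intro borel_measurable_times g Fm)
    show "(\<lambda>k. of_real (gauss (eps k *\<^sub>R \<xi>)) * (F \<xi> * iexp (x \<bullet> \<xi>))) \<longlonglongrightarrow> F \<xi> * iexp (x \<bullet> \<xi>)" for \<xi>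
    proof -
      have "isCont gauss (0 :: real ^ 'n)" using continuous_on_gauss[OF continuous_on_id, of "UNIV :: (real ^ 'n) set"] by (simp add: continuous_on_eq_continuous_at)
      moreover have "(\<lambda>k. eps k *\<^sub>R \<xi>) \<longlonglongrightarrow> 0 *\<^sub>R \<xi>" by (intro tendsto_intros eps0)
      ultimately have "(\<lambda>k. gauss (eps k *\<^sub>R \<xi>)) \<longlonglongrightarrow> gauss (0 :: real ^ 'n)" using isCont_tendsto_compose by fastforce
      then have "(\<lambda>k. gauss (eps k *\<^sub>R \<xi>)) \<longlonglongrightarrow> 1" by (simp add: gauss_def)
      from tendsto_mult[OF tendsto_of_real[OF this] tendsto_const] show ?thesis by simp
    qed
    show "norm (of_real (gauss (eps k *\<^sub>R \<xi>)) * (F \<xi> * iexp (x \<bullet> \<xi>))) \<le> C * pweight \<xi>" for k \<xi>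
    proof -
      have "norm (of_real (gauss (eps k *\<^sub>R \<xi>)) * (F \<xi> * iexp (x \<bullet> \<xi>))) = gauss (eps k *\<^sub>R \<xi>) * norm (F \<xi>)"
        using gauss_pos[of "eps k *\<^sub>R \<xi>"] by (simp add: norm_mult)
      also have "\<dots> \<le> 1 * (C * pweight \<xi>)" using gauss_le_1 gauss_pos[of "eps k *\<^sub>R \<xi>"] FC by (intro mult_mono) auto
      finally show ?thesis by simp
    qed
  qed (auto intro!: integrable_mult_right integrable_pweight)
  have lim2: "(\<lambda>k. LINT w|lborel. f (x - eps k *\<^sub>R w) * of_real (?c * gauss w)) \<longlonglongrightarrow> (LINT w|lborel. f x * of_real (?c * gauss (w :: real ^ 'n)))"
  proof (rule dominated_limit[where w="\<lambda>w. D * (?c * gauss w)"])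
    show "(\<lambda>w. f (x - eps k *\<^sub>R w) * of_real (?c * gauss w)) \<in> borel_measurable borel" for k
      by (intro borel_measurable_continuous_onI continuous_intros continuous_on_comp_UNIV[OF cf])
    show "(\<lambda>w. f x * of_real (?c * gauss w)) \<in> borel_measurable borel"
      by (intro borel_measurable_continuous_onI continuous_intros)
    show "(\<lambda>k. f (x - eps k *\<^sub>R w) * of_real (?c * gauss w)) \<longlonglongrightarrow> f x * of_real (?c * gauss w)" for w
    proof -
      have "isCont f x" using cf by (simp add: continuous_on_eq_continuous_at)
      moreover have "(\<lambda>k. x - eps k *\<^sub>R w) \<longlonglongrightarrow> x - 0 *\<^sub>R w" by (intro tendsto_intros eps0)
      ultimately have "(\<lambda>k. f (x - eps k *\<^sub>R w)) \<longlonglongrightarrow> f x" using isCont_tendsto_compose by fastforce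
      then show ?thesis by (intro tendsto_mult tendsto_const)
    qed
    show "norm (f (x - eps k *\<^sub>R w) * of_real (?c * gauss w)) \<le> D * (?c * gauss w)" for k w
    proof -
      have "norm (f z) \<le> D" for z
        using D(2)[of z] mult_left_mono[OF pweight_le_1[of z] D(1)] by simp
      moreover have "0 \<le> ?c * gauss w" using gauss_pos[of w] by (intro mult_nonneg_nonneg zero_le_power) auto
      ultimately show ?thesis unfolding norm_mult[of "f _"] norm_of_real by (simp only: abs_of_nonneg mult_right_mono)
    qed
  qed (auto intro!: integrable_mult_right gauss_integral)
  have "(LINT \<xi>|lborel. F \<xi> * iexp (x \<bullet> \<xi>)) = (LINT w|lborel. f x * of_real (?c * gauss (w :: real ^ 'n)))"
    by (rule LIMSEQ_unique[OF lim1]) (use lim2 in \<open>simp only: approx\<close>)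
  also have "\<dots> = f x * of_real ?c * (LINT w|lborel. complex_of_real (gauss (w :: real ^ 'n)))"
    by (simp add: mult.assoc)
  also have "\<dots> = f x * of_real (?c * ?c)" unfolding gauss_integral(2) by simp
  \<comment> \<open>One factor comes from transforming the Gaussian, the other from its total mass.
    Their product cancels the normalisation of \<open>fourier\<close>.\<close>
  also have "?c * ?c = (2 * pi) ^ CARD('n)" by (subst power_mult_distrib[symmetric]) simp
  finally have main: "(LINT \<xi>|lborel. F \<xi> * iexp (x \<bullet> \<xi>)) = f x * of_real ((2 * pi) ^ CARD('n))" .
  have "(LINT \<xi>|lborel. fourier f \<xi> * iexp (x \<bullet> \<xi>)) = (1 / (2 * pi) ^ CARD('n)) *\<^sub>R (LINT \<xi>|lborel. F \<xi> * iexp (x \<bullet> \<xi>))"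
    unfolding fourier_eq_osc_inner F_def by (simp only: scaleR_conv_of_real mult.assoc integral_mult_right_zero)
  then show ?thesis unfolding main by (simp add: scaleR_conv_of_real)
qed

subsection \<open>Rapidly decreasing functions and symbols under integrals\<close>

text \<open>Decay without smoothness: what the majorants need from Schwartz functions and from
  Fourier transforms alike.\<close>

definition rapid :: "(real ^ 'n::finite \<Rightarrow> complex) \<Rightarrow> bool" where
  "rapid F \<longleftrightarrow> F \<in> borel_measurable borel \<and> (\<forall>N. \<exists>C\<ge>0. \<forall>x. norm (F x) \<le> C * pweight x ^ N)"

lemma rapid_measurable: "rapid F \<Longrightarrow> F \<in> borel_measurable borel"
  by (simp add: rapid_def)

lemma rapid_fourier: "decay 1 f \<Longrightarrow> rapid (fourier f)"
  by (simp add: rapid_def fourier_measurable fourier_rapid)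

lemma rapid_if_decay:
  assumes "\<And>N. decay N f" shows "rapid f"
  unfolding rapid_def
proof (intro conjI allI)
  show "f \<in> borel_measurable borel"
    by (rule borel_measurable_continuous_onI[OF decay_continuous[OF assms]])
  show "\<exists>C\<ge>0. \<forall>x. norm (f x) \<le> C * pweight x ^ N" for N
    by (rule decay_boundE[OF assms[of N]]) blast
qed

lemma pweight_growth: "pweight x ^ K * (1 + norm x) ^ K \<le> 2 ^ K"
proof -
  have "pweight x * (1 + norm x) * 1 \<le> pweight x * (1 + norm x) * (1 + norm x)"
    by (intro mult_left_mono mult_nonneg_nonneg) auto
  also have "\<dots> \<le> 2" using pweight_norm_upper[of x] by (simp add: power2_eq_square mult.assoc)
  finally have "(pweight x * (1 + norm x)) ^ K \<le> 2 ^ K" by (intro power_mono) auto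
  then show ?thesis by (simp add: power_mult_distrib)
qed

lemma rapid_growth:
  assumes "rapid F"
  shows "\<exists>C\<ge>0. \<forall>x. norm (F x) * (1 + norm x) ^ K \<le> C * pweight x"
proof -
  obtain C where C: "0 \<le> C" "\<And>x. norm (F x) \<le> C * pweight x ^ (K + 1)" using assms unfolding rapid_def by blast
  have "norm (F x) * (1 + norm x) ^ K \<le> (C * 2 ^ K) * pweight x" for x
  proof -
    have "norm (F x) * (1 + norm x) ^ K \<le> (C * pweight x ^ (K + 1)) * (1 + norm x) ^ K"
      by (intro mult_right_mono C) auto
    also have "\<dots> = C * pweight x * (pweight x ^ K * (1 + norm x) ^ K)" by simp
    also have "\<dots> \<le> C * pweight x * 2 ^ K" using C by (intro mult_left_mono pweight_growth) auto
    finally show ?thesis by (simp add: ac_simps)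
  qed
  then show ?thesis using C(1) by (intro exI[of _ "C * 2 ^ K"]) auto
qed

text \<open>Separates the two frequencies whatever the sign of the order, so that rapidly decreasing
  factors in \<xi> and in \<eta> can absorb the growth of a symbol independently.\<close>

lemma japanese_powr_le:
  assumes "\<bar>a\<bar> \<le> real K"
  shows "japanese \<xi> \<eta> powr a \<le> (1 + norm \<xi>) ^ K * (1 + norm \<eta>) ^ K"
proof -
  have "japanese \<xi> \<eta> powr a \<le> japanese \<xi> \<eta> powr real K" using assms japanese_ge_1 by (intro powr_mono) auto
  also have "\<dots> = japanese \<xi> \<eta> ^ K" by (rule powr_realpow[OF japanese_pos])
  also have "\<dots> \<le> ((1 + norm \<xi>) * (1 + norm \<eta>)) ^ K"
    using japanese_pos[of \<xi> \<eta>] by (intro power_mono) (auto simp: japanese_def algebra_simps)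
  finally show ?thesis by (simp add: power_mult_distrib)
qed

lemma is_symbol_growth:
  assumes "is_symbol \<rho> \<delta> a \<tau>"
  shows "\<exists>C\<ge>0. \<exists>K. \<forall>x \<xi> \<eta>. norm (\<tau> (x, \<xi>, \<eta>)) \<le> C * ((1 + norm \<xi>) ^ K * (1 + norm \<eta>) ^ K)"
proof -
  obtain C where C: "0 \<le> C" "\<And>q. norm (\<tau> q) \<le> C * symbol_weight a q" by (rule is_symbol_boundE[OF assms]) blast
  obtain K :: nat where K: "\<bar>a\<bar> \<le> real K" using real_arch_simple by blast
  have "norm (\<tau> (x, \<xi>, \<eta>)) \<le> C * ((1 + norm \<xi>) ^ K * (1 + norm \<eta>) ^ K)" for x \<xi> \<eta>
    using order_trans[OF C(2)[of "(x, \<xi>, \<eta>)", unfolded symbol_weight_def fst_conv snd_conv] mult_left_mono[OF japanese_powr_le[OF K] C(1)]] .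
  then show ?thesis using C(1) by blast
qed

section \<open>Measurability and Fubini with the product weight as majorant\<close>

lemma borel_measurable_pair_lborel:
  fixes F :: "'a::euclidean_space \<times> 'b::euclidean_space \<Rightarrow> complex"
  shows "F \<in> borel_measurable borel \<Longrightarrow> F \<in> borel_measurable (lborel \<Otimes>\<^sub>M lborel)"
  by (simp add: borel_prod[symmetric] cong: measurable_cong_sets)

lemma borel_measurable_integral_snd:
  fixes F :: "'a::euclidean_space \<times> 'b::euclidean_space \<Rightarrow> complex"
  assumes "F \<in> borel_measurable borel"
  shows "(\<lambda>x. LINT y|lborel. F (x, y)) \<in> borel_measurable borel"
proof -
  have [measurable]: "F \<in> borel_measurable (lborel \<Otimes>\<^sub>M lborel)" by (rule borel_measurable_pair_lborel[OF assms])
  have "(\<lambda>x. LINT y|lborel. F (x, y)) \<in> borel_measurable lborel" by measurable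
  then show ?thesis by simp
qed

lemma borel_measurable_comp_cont:
  fixes F :: "'b::euclidean_space \<Rightarrow> complex" and g :: "'a::euclidean_space \<Rightarrow> 'b"
  shows "F \<in> borel_measurable borel \<Longrightarrow> continuous_on UNIV g \<Longrightarrow> (\<lambda>x. F (g x)) \<in> borel_measurable borel"
  using measurable_compose[OF borel_measurable_continuous_onI] .

lemma dominated_swap_pweight:
  fixes F :: "(real ^ 'n::finite) \<Rightarrow> (real ^ 'n) \<Rightarrow> complex"
  assumes "(\<lambda>q. F (fst q) (snd q)) \<in> borel_measurable borel" "\<And>x y. norm (F x y) \<le> C * (pweight x * pweight y)"
  shows "(LINT x|lborel. LINT y|lborel. F x y) = (LINT y|lborel. LINT x|lborel. F x y)"
    and "integrable lborel (\<lambda>x. LINT y|lborel. F x y)"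
    and "integrable lborel (F x)"
proof -
  have m: "case_prod F \<in> borel_measurable (lborel \<Otimes>\<^sub>M lborel)"
    using borel_measurable_pair_lborel[OF assms(1)] by (simp add: case_prod_unfold)
  have b: "norm (F x y) \<le> (C * pweight x) * pweight y" for x y using assms(2)[of x y] by simp
  note * = dominated_swap[OF m integrable_mult_right[OF integrable_pweight] integrable_pweight b]
  show "(LINT x|lborel. LINT y|lborel. F x y) = (LINT y|lborel. LINT x|lborel. F x y)"
    "integrable lborel (\<lambda>x. LINT y|lborel. F x y)" "integrable lborel (F x)" by (rule *)+
qed

lemma norm_integral_pweight_le:
  fixes F :: "real ^ 'n::finite \<Rightarrow> complex"
  assumes "\<And>x. norm (F x) \<le> C * pweight x"
  shows "norm (integral\<^sup>L lborel F) \<le> C * integral\<^sup>L lborel (pweight :: real ^ 'n \<Rightarrow> real)"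
  using norm_integral_le[OF integrable_mult_right[OF integrable_pweight, of C] assms] by simp

lemma integral_pweight_nonneg: "0 \<le> integral\<^sup>L lborel (pweight :: real ^ 'n::finite \<Rightarrow> real)"
  by (rule integral_nonneg_AE) simp

text \<open>The form \<open>\<langle>T\<^sub>\<sigma> (f, g), h\<rangle>\<close> with the frequency \<open>\<eta>\<close> of \<open>g\<close> frozen; \<open>F\<close> is the Fourier transform of \<open>f\<close>.\<close>

definition frozen_form :: "('n::finite) bisymbol \<Rightarrow> real ^ 'n \<Rightarrow> (real ^ 'n \<Rightarrow> complex) \<Rightarrow> (real ^ 'n \<Rightarrow> complex) \<Rightarrow> complex" where
  "frozen_form \<sigma> \<eta> F h = (LINT x|lborel. h x * iexp (x \<bullet> \<eta>) * (LINT \<xi>|lborel. \<sigma> (x, \<xi>, \<eta>) * F \<xi> * iexp (x \<bullet> \<xi>)))"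

lemma inner_integral_bound:
  fixes \<sigma> :: "('n::finite) bisymbol"
  assumes s: "is_symbol \<rho> \<delta> a \<sigma>" and F: "rapid F"
  shows "\<exists>C\<ge>0. \<exists>K. \<forall>x \<xi> \<eta>. norm (\<sigma> (x, \<xi>, \<eta>) * F \<xi>) \<le> C * pweight \<xi> * (1 + norm \<eta>) ^ K"
proof -
  obtain C K where C: "0 \<le> C" "\<And>x \<xi> \<eta>. norm (\<sigma> (x, \<xi>, \<eta>)) \<le> C * ((1 + norm \<xi>) ^ K * (1 + norm \<eta>) ^ K)"
    using is_symbol_growth[OF s] by blast
  obtain D where D: "0 \<le> D" "\<And>x. norm (F x) * (1 + norm x) ^ K \<le> D * pweight x" using rapid_growth[OF F] by blast
  have "norm (\<sigma> (x, \<xi>, \<eta>) * F \<xi>) \<le> (C * D) * pweight \<xi> * (1 + norm \<eta>) ^ K" for x \<xi> \<eta>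
  proof -
    have "norm (\<sigma> (x, \<xi>, \<eta>) * F \<xi>) \<le> C * ((1 + norm \<xi>) ^ K * (1 + norm \<eta>) ^ K) * norm (F \<xi>)"
      unfolding norm_mult by (intro mult_right_mono C) auto
    also have "\<dots> = C * (1 + norm \<eta>) ^ K * (norm (F \<xi>) * (1 + norm \<xi>) ^ K)" by simp
    also have "\<dots> \<le> C * (1 + norm \<eta>) ^ K * (D * pweight \<xi>)" using C(1) by (intro mult_left_mono D) auto
    finally show ?thesis by (simp add: ac_simps)
  qed
  then show ?thesis using C(1) D(1) by (intro exI[of _ "C * D"]) auto
qed

text \<open>The \<xi>-integral is the inner one in \<open>bilinear_psido\<close>, so the transform
  of \<open>g\<close> can be pulled out and the x-integral moved inside. The operators acting on
  \<open>f\<close> and \<open>h\<close> can then be compared for each \<eta>. The last claim, with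
  the order of integration reversed, prepares the exchange of the two arguments.\<close>

lemma pairing_eq_frozen_form:
  fixes \<sigma> :: "('n::finite) bisymbol"
  assumes s: "is_symbol \<rho> \<delta> a \<sigma>" and f: "decay 1 f" and g: "decay 1 g" and h: "rapid h"
  shows "pairable (bilinear_psido \<sigma> f g) h"
    and "pairing (bilinear_psido \<sigma> f g) h = (LINT \<eta>|lborel. fourier g \<eta> * frozen_form \<sigma> \<eta> (fourier f) h)"
    and "bilinear_psido \<sigma> f g x = (LINT \<xi>|lborel. LINT \<eta>|lborel.
        \<sigma> (x, \<xi>, \<eta>) * fourier f \<xi> * fourier g \<eta> * iexp (x \<bullet> (\<xi> + \<eta>)))"
proof -
  let ?F = "fourier f" and ?G = "fourier g"
  have F: "rapid ?F" and G: "rapid ?G" using rapid_fourier f g by blast+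
  have cs: "continuous_on UNIV \<sigma>" by (rule is_symbol_continuous[OF s])
  obtain C K where C: "0 \<le> C" "\<And>x \<xi> \<eta>. norm (\<sigma> (x, \<xi>, \<eta>) * ?F \<xi>) \<le> C * pweight \<xi> * (1 + norm \<eta>) ^ K"
    using inner_integral_bound[OF s F] by blast
  obtain D where D: "0 \<le> D" "\<And>x. norm (?G x) * (1 + norm x) ^ K \<le> D * pweight x" using rapid_growth[OF G] by blast
  obtain E where E: "0 \<le> E" "\<And>x. norm (h x) * (1 + norm x) ^ 0 \<le> E * pweight x" using rapid_growth[OF h] by blast
  define I where "I = (\<lambda>x \<eta>. LINT \<xi>|lborel. \<sigma> (x, \<xi>, \<eta>) * ?F \<xi> * iexp (x \<bullet> \<xi>))"
  let ?P = "integral\<^sup>L lborel (pweight :: real ^ 'n \<Rightarrow> real)"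
  have Ib: "norm (I x \<eta>) \<le> C * (1 + norm \<eta>) ^ K * ?P" for x \<eta>
    unfolding I_def
    by (rule norm_integral_pweight_le) (use C(2)[of x _ \<eta>] in \<open>simp add: norm_mult ac_simps\<close>)
  have Im: "(\<lambda>q. I (fst q) (snd q)) \<in> borel_measurable borel"
    unfolding I_def
    by (rule borel_measurable_integral_snd[of "\<lambda>r. \<sigma> (fst (fst r), snd r, snd (fst r)) * ?F (snd r) * iexp (fst (fst r) \<bullet> snd r)", simplified])
      (intro borel_measurable_times borel_measurable_comp_cont[OF rapid_measurable[OF F]]
        borel_measurable_continuous_onI continuous_on_comp_UNIV[OF cs] continuous_intros)
  have T: "bilinear_psido \<sigma> f g x = (LINT \<eta>|lborel. I x \<eta> * (?G \<eta> * iexp (x \<bullet> \<eta>)))" for x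
  proof -
    have "(LINT \<xi>|lborel. \<sigma> (x, \<xi>, \<eta>) * ?F \<xi> * ?G \<eta> * iexp (x \<bullet> (\<xi> + \<eta>))) = I x \<eta> * (?G \<eta> * iexp (x \<bullet> \<eta>))" for \<eta>
    proof -
      have "(LINT \<xi>|lborel. \<sigma> (x, \<xi>, \<eta>) * ?F \<xi> * ?G \<eta> * iexp (x \<bullet> (\<xi> + \<eta>)))
          = (LINT \<xi>|lborel. \<sigma> (x, \<xi>, \<eta>) * ?F \<xi> * iexp (x \<bullet> \<xi>) * (?G \<eta> * iexp (x \<bullet> \<eta>)))"
        by (intro Bochner_Integration.integral_cong refl)
          (simp add: inner_add_right exp_add distrib_left mult.assoc mult.left_commute)
      then show ?thesis unfolding I_def by (simp only: integral_mult_left_zero)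
    qed
    then show ?thesis by (simp add: bilinear_psido_def)
  qed
  show "bilinear_psido \<sigma> f g x = (LINT \<xi>|lborel. LINT \<eta>|lborel.
        \<sigma> (x, \<xi>, \<eta>) * ?F \<xi> * ?G \<eta> * iexp (x \<bullet> (\<xi> + \<eta>)))"
    unfolding bilinear_psido_def
  proof (rule dominated_swap_pweight(1)[where C="C * D"])
    show "(\<lambda>q. \<sigma> (x, snd q, fst q) * ?F (snd q) * ?G (fst q) * iexp (x \<bullet> (snd q + fst q))) \<in> borel_measurable borel"
      by (intro borel_measurable_times borel_measurable_comp_cont[OF rapid_measurable[OF F]]
        borel_measurable_comp_cont[OF rapid_measurable[OF G]]
        borel_measurable_continuous_onI continuous_on_comp_UNIV[OF cs] continuous_intros)
    show "norm (\<sigma> (x, \<xi>, \<eta>) * ?F \<xi> * ?G \<eta> * iexp (x \<bullet> (\<xi> + \<eta>))) \<le> C * D * (pweight \<eta> * pweight \<xi>)" for \<eta> \<xi>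
    proof -
      have "norm (\<sigma> (x, \<xi>, \<eta>) * ?F \<xi> * ?G \<eta> * iexp (x \<bullet> (\<xi> + \<eta>))) = norm (\<sigma> (x, \<xi>, \<eta>) * ?F \<xi>) * norm (?G \<eta>)"
        by (simp add: norm_mult)
      also have "\<dots> \<le> C * pweight \<xi> * (1 + norm \<eta>) ^ K * norm (?G \<eta>)" by (intro mult_right_mono C) auto
      also have "\<dots> = C * pweight \<xi> * (norm (?G \<eta>) * (1 + norm \<eta>) ^ K)" by simp
      also have "\<dots> \<le> C * pweight \<xi> * (D * pweight \<eta>)" using C(1) by (intro mult_left_mono D) auto
      finally show ?thesis by (simp add: ac_simps)
    qed
  qed
  define S where "S = (\<lambda>x \<eta>. I x \<eta> * (?G \<eta> * iexp (x \<bullet> \<eta>)) * h x)"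
  have Sm: "(\<lambda>q. S (fst q) (snd q)) \<in> borel_measurable borel"
    unfolding S_def
    by (intro borel_measurable_times Im borel_measurable_comp_cont[OF rapid_measurable[OF G]]
        borel_measurable_comp_cont[OF rapid_measurable[OF h]] borel_measurable_continuous_onI continuous_intros)
  have Sb: "norm (S x \<eta>) \<le> (C * ?P * D * E) * (pweight x * pweight \<eta>)" for x \<eta>
  proof -
    have "norm (S x \<eta>) = norm (I x \<eta>) * norm (?G \<eta>) * norm (h x)" by (simp add: S_def norm_mult)
    also have "\<dots> \<le> (C * (1 + norm \<eta>) ^ K * ?P) * norm (?G \<eta>) * norm (h x)" by (intro mult_right_mono Ib) auto
    also have "\<dots> = C * ?P * (norm (?G \<eta>) * (1 + norm \<eta>) ^ K) * (norm (h x) * (1 + norm x) ^ 0)" by simp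
    also have "\<dots> \<le> C * ?P * (D * pweight \<eta>) * (E * pweight x)"
      using C(1) D(1) E(1) integral_pweight_nonneg[where 'n='n] by (intro mult_mono mult_left_mono D E) auto
    finally show ?thesis by (simp add: ac_simps)
  qed
  have eq: "bilinear_psido \<sigma> f g x * h x = (LINT \<eta>|lborel. S x \<eta>)" for x
    unfolding T S_def by (rule integral_mult_left_zero[symmetric])
  show "pairable (bilinear_psido \<sigma> f g) h"
    unfolding pairable_def eq by (rule dominated_swap_pweight(2)[OF Sm Sb])
  have "pairing (bilinear_psido \<sigma> f g) h = (LINT \<eta>|lborel. LINT x|lborel. S x \<eta>)"
    unfolding pairing_def eq by (rule dominated_swap_pweight(1)[OF Sm Sb])
  also have "\<dots> = (LINT \<eta>|lborel. ?G \<eta> * frozen_form \<sigma> \<eta> ?F h)"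
  proof (rule Bochner_Integration.integral_cong[OF refl])
    fix \<eta>
    have "(LINT x|lborel. S x \<eta>) = (LINT x|lborel. ?G \<eta> * (h x * iexp (x \<bullet> \<eta>) * I x \<eta>))"
      by (intro Bochner_Integration.integral_cong refl) (simp add: S_def ac_simps)
    also have "\<dots> = ?G \<eta> * (LINT x|lborel. h x * iexp (x \<bullet> \<eta>) * I x \<eta>)" by (rule integral_mult_right_zero)
    finally show "(LINT x|lborel. S x \<eta>) = ?G \<eta> * frozen_form \<sigma> \<eta> ?F h" by (simp add: frozen_form_def I_def)
  qed
  finally show "pairing (bilinear_psido \<sigma> f g) h = (LINT \<eta>|lborel. ?G \<eta> * frozen_form \<sigma> \<eta> ?F h)" .
qed

subsection \<open>Freezing the space variable\<close>

lemma decay_reflect: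
  fixes f :: "real ^ 'n::finite \<Rightarrow> complex"
  assumes "decay N f"
  shows "decay N (\<lambda>z. f (x - z))"
proof -
  define M where "M = 2 ^ CARD('n) * (1 + norm x) ^ (2 * CARD('n))"
  have "pweight (x + (- z)) ^ N \<le> M ^ N * pweight z ^ N" for z
    using power_mono[OF pweight_shift[of "- z" x] pweight_nonneg, of N] by (simp add: M_def power_mult_distrib)
  moreover have "0 \<le> M ^ N" by (simp add: M_def)
  ultimately have K: "\<exists>K\<ge>0. \<forall>z. pweight (x + (- z)) ^ N \<le> K * pweight z ^ N" by blast
  have "decay N (\<lambda>z. f (x + (- z)))"
    unfolding decay_def
  proof (rule weighted_smooth_affine[where A=UNIV])
    show "linear (\<lambda>z :: real ^ 'n. - z)" by (rule linearI) auto
    show "- b = 0 \<or> (\<exists>t b'. b' \<in> Basis \<and> - b = t *\<^sub>R b' \<and> (0::real) = 0)" if "b \<in> Basis" for b :: "real ^ 'n"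
      using that by (intro disjI2 exI[of _ "-1"] exI[of _ b]) simp
    show "weighted_smooth (\<lambda>_ z. pweight z ^ N) (\<lambda>_. 0) 0 f" using assms by (simp only: decay_def)
  qed (use K in simp_all)
  then show ?thesis by simp
qed

text \<open>In the oscillatory integral the amplitude is evaluated at a space point shifted by z.
  Freezing suppresses the shift, so that the plain operator, where \<sigma> is taken at x only,
  becomes an instance.\<close>

definition freeze_x :: "real ^ 'n::finite \<Rightarrow> 'n bisymbol \<Rightarrow> 'n bisymbol" where
  "freeze_x x \<sigma> = (\<lambda>q. \<sigma> (x, fst (snd q), snd (snd q)))"

lemma dir_deriv_freeze_x: "fst v = 0 \<Longrightarrow> dir_deriv v (freeze_x x \<sigma>) = freeze_x x (dir_deriv v \<sigma>)"
  by (cases v) (auto simp: freeze_x_def dir_deriv_def fun_eq_iff)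

lemma xi_ops_freeze_x: "xi_ops r js (freeze_x x \<sigma>) = freeze_x x (xi_ops r js \<sigma>)"
proof (induction js)
  case (Cons j js)
  then show ?case using dir_deriv_freeze_x[of "unit_xi j" x "xi_ops r js \<sigma>"]
    by (simp add: xi_op_def unit_xi_def) (simp add: freeze_x_def)
qed simp

lemma is_symbol_freeze_x:
  fixes \<sigma> :: "('n::finite) bisymbol"
  assumes "is_symbol \<rho> \<delta> a \<sigma>" shows "is_symbol \<rho> \<delta> a (freeze_x x \<sigma>)"
proof -
  let ?L = "\<lambda>q :: 'n point. (0 :: real ^ 'n, fst (snd q), snd (snd q))"
  have "weighted_smooth symbol_weight (symbol_order \<rho> \<delta>) a (\<lambda>q. \<sigma> ((x, 0, 0) + ?L q))"
  proof (rule weighted_smooth_affine[where A=UNIV])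
    show "linear ?L" by (rule linearI) auto
    show "\<exists>K\<ge>0. \<forall>q. symbol_weight a ((x, 0, 0) + ?L q) \<le> K * symbol_weight a q" for a
      by (intro exI[of _ 1]) (simp add: symbol_weight_def)
    show "?L b = 0 \<or> (\<exists>t b'. b' \<in> Basis \<and> ?L b = t *\<^sub>R b' \<and> symbol_order \<rho> \<delta> b' = symbol_order \<rho> \<delta> b)" if "b \<in> Basis" for b
    proof (cases "fst b = 0")
      case True
      then show ?thesis using that by (intro disjI2 exI[of _ 1] exI[of _ b]) (simp add: prod_eq_iff)
    next
      case False
      then show ?thesis using that by (auto simp: Basis_triple unit_x_def unit_xi_def unit_eta_def zero_prod_def)
    qed
    show "weighted_smooth symbol_weight (symbol_order \<rho> \<delta>) a \<sigma>" using assms by (simp only: is_symbol_def)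
  qed (simp_all add: symbol_weight_nonneg)
  then show ?thesis by (simp add: is_symbol_def freeze_x_def zero_prod_def[symmetric])
qed

subsection \<open>The transposition identity\<close>

text \<open>The weight decays like \<open>pweight\<^sup>2\<close>: one factor is spent on Peetre's inequality in \<open>reflect_bound\<close>.\<close>

definition reg_weight :: "real ^ 'n::finite \<Rightarrow> complex" where "reg_weight = resolvents 1 (coords_rep (2 * 2))"

definition reg_symbol :: "('n::finite) bisymbol \<Rightarrow> 'n bisymbol" where "reg_symbol \<sigma> = xi_ops 1 (coords_rep (2 * 2)) \<sigma>"

lemma transposed_symbol_2: "transposed_symbol 2 \<sigma> p = (LINT \<theta>|lborel. osc_inner reg_weight (reg_symbol \<sigma>) p \<theta>)"
  by (simp add: transposed_symbol_def osc_def reg_weight_def reg_symbol_def)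

lemma norm_reg_weight: "norm (reg_weight z) = pweight z ^ 2"
  unfolding reg_weight_def norm_resolvents_coords_rep by simp

lemma decay_reg_weight: "decay 1 reg_weight"
  unfolding reg_weight_def using decay_resolvents_coords_rep[of 1 2] by (auto intro: decay_mono)

text \<open>Without the weight this would be (2 pi)^n e^(i x.\<xi>) times the Fourier transform of
  \<open>f\<close> at \<xi>, written with z = x - y. The point (-x, 0, 0) turns f(-fst q) into f(x -
  z).\<close>

definition reg_transform :: "(real ^ 'n::finite \<Rightarrow> complex) \<Rightarrow> real ^ 'n \<Rightarrow> real ^ 'n \<Rightarrow> complex" where
  "reg_transform f x \<xi> = osc_inner reg_weight (\<lambda>q. f (- fst q)) (- x, 0, 0) \<xi>"

lemma reg_transform_eq: "reg_transform f x \<xi> = (LINT z|lborel. iexp (z \<bullet> \<xi>) * reg_weight z * f (x - z))"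
  by (simp add: reg_transform_def osc_inner_def osc_integrand_def)

lemma reg_transform_measurable:
  assumes "decay 0 f"
  shows "(\<lambda>q. reg_transform f (fst q) (snd q)) \<in> borel_measurable borel"
  unfolding reg_transform_def by (rule osc_inner_measurable[OF decay_reg_weight is_symbol_fst[OF assms]]) (intro continuous_intros)+

lemma reflect_bound:
  fixes f :: "real ^ 'n::finite \<Rightarrow> complex"
  assumes C: "0 \<le> C" "\<And>z. norm (f z) \<le> C * pweight z"
  shows "norm (reg_weight z * f (x - z)) \<le> (C * 2 ^ CARD('n)) * (pweight x * pweight z)"
proof -
  have "norm (reg_weight z * f (x - z)) \<le> pweight z ^ 2 * (C * pweight (x - z))"
    unfolding norm_mult norm_reg_weight by (intro mult_left_mono C) auto
  also have "\<dots> = C * (pweight (x - z) * pweight z) * pweight z" by (simp add: power2_eq_square)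
  also have "\<dots> \<le> C * (2 ^ CARD('n) * pweight x) * pweight z"
    using pweight_peetre[of "x - z" z] C(1) by (intro mult_right_mono mult_left_mono) auto
  finally show ?thesis by (simp add: ac_simps)
qed

lemma reg_transform_bound:
  fixes f :: "real ^ 'n::finite \<Rightarrow> complex"
  assumes f: "decay 1 f"
  shows "\<exists>C\<ge>0. \<forall>x \<xi>. norm (reg_transform f x \<xi>) \<le> C * pweight x"
proof -
  obtain C where C: "0 \<le> C" "\<And>z. norm (f z) \<le> C * pweight z" by (rule decay_boundE[OF f]) simp
  let ?I = "integral\<^sup>L lborel (pweight :: real ^ 'n \<Rightarrow> real)"
  have "norm (reg_transform f x \<xi>) \<le> (C * 2 ^ CARD('n) * ?I) * pweight x" for x \<xi>
  proof -
    have "norm (reg_transform f x \<xi>) \<le> (C * 2 ^ CARD('n) * pweight x) * ?I"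
      unfolding reg_transform_eq
    proof (rule norm_integral_pweight_le)
      fix z
      have "norm (iexp (z \<bullet> \<xi>) * reg_weight z * f (x - z)) = norm (reg_weight z * f (x - z))" by (simp add: norm_mult)
      then show "norm (iexp (z \<bullet> \<xi>) * reg_weight z * f (x - z)) \<le> C * 2 ^ CARD('n) * pweight x * pweight z"
        using reflect_bound[OF C, of z x] by (simp add: ac_simps)
    qed
    then show ?thesis by (simp add: ac_simps)
  qed
  moreover have "0 \<le> C * 2 ^ CARD('n) * ?I" using C integral_pweight_nonneg by simp
  ultimately show ?thesis by blast
qed

text \<open>
  Removing the factors \<open>reg_weight\<close> again, now for the phase \<open>e\<^bsup>i(x - y)\<xi>\<^esup>\<close> with \<open>z = x - y\<close>.
\<close>

lemma inner_integral_regularised: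
  fixes \<sigma> :: "('n::finite) bisymbol"
  assumes par: "0 \<le> \<delta>" "\<delta> \<le> \<rho>" "\<rho> \<le> 1" "\<delta> < 1" and s: "is_symbol \<rho> \<delta> a \<sigma>" and f: "decay 1 f"
  shows "(LINT \<xi>|lborel. \<sigma> (x, \<xi>, \<eta>) * fourier f \<xi> * iexp (x \<bullet> \<xi>))
    = of_real (1 / (2 * pi) ^ CARD('n)) * (LINT \<xi>|lborel. reg_symbol \<sigma> (x, \<xi>, \<eta>) * reg_transform f x \<xi>)"
proof -
  let ?c = "complex_of_real (1 / (2 * pi) ^ CARD('n))"
  \<comment> \<open>At this point \<theta> - \<zeta> - \<eta> equals \<theta>, so the amplitude of
    the oscillatory integral is \<sigma> at (x, \<theta>, \<eta>).\<close>
  let ?p = "(0, - \<eta>, \<eta>) :: 'n point"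
  let ?u = "\<lambda>z. f (x - z)"
  have u: "decay 1 ?u" by (rule decay_reflect[OF f])
  have cf: "continuous_on UNIV f" by (rule decay_continuous[OF f])
  have A: "\<sigma> (x, \<xi>, \<eta>) * fourier f \<xi> * iexp (x \<bullet> \<xi>) = ?c * osc_inner ?u (freeze_x x \<sigma>) ?p \<xi>" for \<xi>
  proof -
    have "(\<lambda>y. f y * exp (- \<i> * of_real (y \<bullet> \<xi>))) \<in> borel_measurable borel"
      by (intro borel_measurable_continuous_onI continuous_intros cf)
    from lborel_translate(2)[OF this, of x]
    have "(LINT y|lborel. f y * exp (- \<i> * of_real (y \<bullet> \<xi>))) = (LINT z|lborel. f (x - z) * exp (- \<i> * of_real ((x - z) \<bullet> \<xi>)))" by simp
    then have "fourier f \<xi> * iexp (x \<bullet> \<xi>) = ?c * (LINT z|lborel. f (x - z) * exp (- \<i> * of_real ((x - z) \<bullet> \<xi>)) * iexp (x \<bullet> \<xi>))"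
      by (simp add: fourier_def scaleR_conv_of_real)
    also have "(LINT z|lborel. f (x - z) * exp (- \<i> * of_real ((x - z) \<bullet> \<xi>)) * iexp (x \<bullet> \<xi>)) = (LINT z|lborel. iexp (z \<bullet> \<xi>) * f (x - z))"
      by (intro Bochner_Integration.integral_cong refl)
        (simp add: mult.assoc exp_add[symmetric] inner_diff_left algebra_simps)
    finally have 1: "fourier f \<xi> * iexp (x \<bullet> \<xi>) = ?c * (LINT z|lborel. iexp (z \<bullet> \<xi>) * f (x - z))" .
    have 2: "(LINT z|lborel. iexp (z \<bullet> \<xi>) * f (x - z) * \<sigma> (x, \<xi>, \<eta>)) = (LINT z|lborel. iexp (z \<bullet> \<xi>) * f (x - z)) * \<sigma> (x, \<xi>, \<eta>)"
      by (rule integral_mult_left_zero)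
    have "\<sigma> (x, \<xi>, \<eta>) * (fourier f \<xi> * iexp (x \<bullet> \<xi>)) = ?c * (LINT z|lborel. iexp (z \<bullet> \<xi>) * f (x - z) * \<sigma> (x, \<xi>, \<eta>))"
      unfolding 1 2 by (simp only: ac_simps)
    then show ?thesis by (simp add: osc_inner_def osc_integrand_def freeze_x_def mult.assoc)
  qed
  have B: "osc_inner (\<lambda>z. ?u z * reg_weight z) (freeze_x x (reg_symbol \<sigma>)) ?p \<xi> = reg_symbol \<sigma> (x, \<xi>, \<eta>) * reg_transform f x \<xi>" for \<xi>
  proof -
    have "osc_inner (\<lambda>z. ?u z * reg_weight z) (freeze_x x (reg_symbol \<sigma>)) ?p \<xi> = (LINT z|lborel. reg_symbol \<sigma> (x, \<xi>, \<eta>) * (iexp (z \<bullet> \<xi>) * reg_weight z * f (x - z)))"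
      unfolding osc_inner_def by (intro Bochner_Integration.integral_cong refl) (simp add: osc_integrand_def freeze_x_def ac_simps)
    also have "\<dots> = reg_symbol \<sigma> (x, \<xi>, \<eta>) * reg_transform f x \<xi>" unfolding reg_transform_eq by (rule integral_mult_right_zero)
    finally show ?thesis .
  qed
  \<comment> \<open>The reflected \<open>f\<close> supplies the decay in z, so the integral
    converges without the inserted factors and these can be removed.\<close>
  have "osc (\<lambda>z. ?u z * reg_weight z) (xi_ops 1 (coords_rep (2 * 2)) (freeze_x x \<sigma>)) ?p = osc ?u (freeze_x x \<sigma>) ?p"
    unfolding reg_weight_def by (rule osc_remove_list[OF par u is_symbol_freeze_x[OF s]]) simp
  then have "(LINT \<xi>|lborel. reg_symbol \<sigma> (x, \<xi>, \<eta>) * reg_transform f x \<xi>) = osc ?u (freeze_x x \<sigma>) ?p"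
    unfolding xi_ops_freeze_x reg_symbol_def[symmetric] osc_def B .
  then show ?thesis unfolding A osc_def by simp
qed

text \<open>The substitution x = y + z in the double integral over y and z. At \<theta> = \<zeta> +
  \<eta> + \<xi> the amplitude is \<open>Q\<close> at (x, \<xi>, \<eta>) and thus constant in z, so
  what remains of the z-integral is \<open>reg_transform\<close>.\<close>

lemma outer_integral_regularised:
  fixes Q :: "('n::finite) bisymbol"
  assumes q: "is_symbol \<rho> \<delta> a Q" and f: "decay 1 f"
  shows "(LINT y|lborel. f y * iexp (y \<bullet> (\<zeta> + \<eta>)) * osc_inner reg_weight Q (y, \<zeta>, \<eta>) (\<zeta> + \<eta> + \<xi>))
    = (LINT x|lborel. iexp (x \<bullet> (\<zeta> + \<eta>)) * Q (x, \<xi>, \<eta>) * reg_transform f x \<xi>)"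
proof -
  obtain C where C: "0 \<le> C" "\<And>z. norm (f z) \<le> C * pweight z" by (rule decay_boundE[OF f]) simp
  obtain D where D: "0 \<le> D" "\<And>q. norm (Q q) \<le> D * symbol_weight a q" by (rule is_symbol_boundE[OF q]) blast
  define B where "B = D * japanese \<xi> \<eta> powr a"
  have B: "norm (Q (x, \<xi>, \<eta>)) \<le> B" for x using D(2)[of "(x, \<xi>, \<eta>)"] by (simp add: B_def symbol_weight_def)
  have B0: "0 \<le> B" using D(1) by (simp add: B_def)
  have cf: "continuous_on UNIV f" by (rule decay_continuous[OF f])
  have cu: "continuous_on UNIV (reg_weight :: real ^ 'n \<Rightarrow> complex)" by (rule decay_continuous[OF decay_reg_weight])
  have cq: "continuous_on UNIV Q" by (rule is_symbol_continuous[OF q])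
  define G where "G = (\<lambda>y z. f y * iexp (y \<bullet> (\<zeta> + \<eta>)) * (iexp (z \<bullet> (\<zeta> + \<eta> + \<xi>)) * reg_weight z * Q (y + z, \<xi>, \<eta>)))"
  define G' where "G' = (\<lambda>x z. iexp (x \<bullet> (\<zeta> + \<eta>)) * Q (x, \<xi>, \<eta>) * (iexp (z \<bullet> \<xi>) * reg_weight z * f (x - z)))"
  have "(LINT y|lborel. f y * iexp (y \<bullet> (\<zeta> + \<eta>)) * osc_inner reg_weight Q (y, \<zeta>, \<eta>) (\<zeta> + \<eta> + \<xi>)) = (LINT y|lborel. LINT z|lborel. G y z)"
    by (simp add: osc_inner_def osc_integrand_def G_def)
  also have "\<dots> = (LINT z|lborel. LINT y|lborel. G y z)"
  proof (rule dominated_swap_pweight(1)[where C="C * B"])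
    show "(\<lambda>q. G (fst q) (snd q)) \<in> borel_measurable borel"
      unfolding G_def by (intro borel_measurable_continuous_onI continuous_intros continuous_on_comp_UNIV[OF cf]
        continuous_on_comp_UNIV[OF cu] continuous_on_comp_UNIV[OF cq])
    show "norm (G y z) \<le> (C * B) * (pweight y * pweight z)" for y z
    proof -
      have "norm (G y z) = norm (f y) * (pweight z * pweight z * norm (Q (y + z, \<xi>, \<eta>)))"
        by (simp add: G_def norm_mult norm_reg_weight power2_eq_square)
      also have "\<dots> \<le> (C * pweight y) * (pweight z * 1 * B)"
        using C B B0 pweight_le_1 by (intro mult_mono) auto
      finally show ?thesis by (simp add: ac_simps)
    qed
  qed
  also have "\<dots> = (LINT z|lborel. LINT x|lborel. G' x z)"
  proof (rule Bochner_Integration.integral_cong[OF refl])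
    fix z
    have "(\<lambda>y. G y z) \<in> borel_measurable borel"
      unfolding G_def by (intro borel_measurable_continuous_onI continuous_intros cf continuous_on_comp_UNIV[OF cq])
    \<comment> \<open>The shift y = x - z rearranges the phase: (x - z).(\<zeta> + \<eta>) +
      z.(\<zeta> + \<eta> + \<xi>) = x.(\<zeta> + \<eta>) + z.\<xi>.\<close>
    from lborel_translate(1)[OF this, of "- z"]
    have "(LINT y|lborel. G y z) = (LINT x|lborel. G (- z + x) z)" by simp
    moreover have "G (- z + x) z = G' x z" for x
    proof -
      have "iexp ((- z + x) \<bullet> (\<zeta> + \<eta>)) * iexp (z \<bullet> (\<zeta> + \<eta> + \<xi>)) = iexp (x \<bullet> (\<zeta> + \<eta>)) * iexp (z \<bullet> \<xi>)"
        by (simp add: exp_add[symmetric] inner_add_left inner_add_right algebra_simps)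
      then have "f (x - z) * reg_weight z * Q (x, \<xi>, \<eta>) * (iexp ((- z + x) \<bullet> (\<zeta> + \<eta>)) * iexp (z \<bullet> (\<zeta> + \<eta> + \<xi>)))
          = f (x - z) * reg_weight z * Q (x, \<xi>, \<eta>) * (iexp (x \<bullet> (\<zeta> + \<eta>)) * iexp (z \<bullet> \<xi>))" by simp
      then show ?thesis by (simp add: G_def G'_def mult.assoc mult.left_commute mult.commute)
    qed
    ultimately show "(LINT y|lborel. G y z) = (LINT x|lborel. G' x z)" by simp
  qed
  also have "\<dots> = (LINT x|lborel. LINT z|lborel. G' x z)"
  proof (rule dominated_swap_pweight(1)[where C="B * (C * 2 ^ CARD('n))", symmetric])
    show "(\<lambda>q. G' (fst q) (snd q)) \<in> borel_measurable borel"
      unfolding G'_def by (intro borel_measurable_continuous_onI continuous_intros continuous_on_comp_UNIV[OF cf]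
        continuous_on_comp_UNIV[OF cu] continuous_on_comp_UNIV[OF cq])
    show "norm (G' x z) \<le> (B * (C * 2 ^ CARD('n))) * (pweight x * pweight z)" for x z
    proof -
      have "norm (G' x z) = norm (Q (x, \<xi>, \<eta>)) * norm (reg_weight z * f (x - z))" by (simp add: G'_def norm_mult)
      also have "\<dots> \<le> B * ((C * 2 ^ CARD('n)) * (pweight x * pweight z))"
        using B B0 reflect_bound[OF C] by (intro mult_mono) auto
      finally show ?thesis by (simp add: ac_simps)
    qed
  qed
  also have "\<dots> = (LINT x|lborel. iexp (x \<bullet> (\<zeta> + \<eta>)) * Q (x, \<xi>, \<eta>) * reg_transform f x \<xi>)"
    unfolding G'_def reg_transform_eq by (simp only: integral_mult_right_zero)
  finally show ?thesis .
qed

text \<open>Both forms equal the same regularised integral over x and \<xi>. The right-hand side is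
  an integral over y, \<zeta>, \<theta> and z; each interchange has its own product majorant, and
  the regularisation makes all of them available. The \<zeta>-integral is carried out by Fourier
  inversion for \<open>h\<close>.\<close>

lemma frozen_form_transpose:
  fixes \<sigma> :: "('n::finite) bisymbol"
  assumes par: "0 \<le> \<delta>" "\<delta> \<le> \<rho>" "\<rho> \<le> 1" "\<delta> < 1" and s: "is_symbol \<rho> \<delta> a \<sigma>"
    and f: "\<And>N. decay N f" and h: "\<And>N. decay N h"
  shows "frozen_form \<sigma> \<eta> (fourier f) h = frozen_form (\<lambda>q. of_real (1 / (2 * pi) ^ CARD('n)) * transposed_symbol 2 \<sigma> q) \<eta> (fourier h) f"
proof -
  let ?c = "complex_of_real (1 / (2 * pi) ^ CARD('n))"
  define Q where "Q = reg_symbol \<sigma>"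
  have rho: "0 \<le> \<rho>" using par by simp
  have q: "is_symbol \<rho> \<delta> a Q" unfolding Q_def reg_symbol_def by (rule is_symbol_xi_ops[OF rho s])
  have sA: "is_symbol \<rho> \<delta> a (transposed_symbol 2 \<sigma>)" by (rule is_symbol_transposed_symbol[OF par _ s]) simp
  have cA: "continuous_on UNIV (transposed_symbol 2 \<sigma>)" by (rule is_symbol_continuous[OF sA])
  have cq: "continuous_on UNIV Q" by (rule is_symbol_continuous[OF q])
  have cf: "continuous_on UNIV f" and ch: "continuous_on UNIV h" by (rule decay_continuous[OF f], rule decay_continuous[OF h])
  define hh where "hh = fourier h"
  have hh: "rapid hh" unfolding hh_def by (rule rapid_fourier[OF h])
  note mh = borel_measurable_comp_cont[OF rapid_measurable[OF hh]]
  have mV: "(\<lambda>q. reg_transform f (fst q) (snd q)) \<in> borel_measurable borel" by (rule reg_transform_measurable[OF f])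
  obtain Cf where Cf: "0 \<le> Cf" "\<And>z. norm (f z) \<le> Cf * pweight z" by (rule decay_boundE[OF f[of 1]]) simp
  obtain Ch where Ch: "0 \<le> Ch" "\<And>z. norm (h z) \<le> Ch * pweight z" by (rule decay_boundE[OF h[of 1]]) simp
  obtain CV where CV: "0 \<le> CV" "\<And>x \<xi>. norm (reg_transform f x \<xi>) \<le> CV * pweight x" using reg_transform_bound[OF f] by blast
  obtain CA KA where CA: "0 \<le> CA" "\<And>x \<zeta> \<eta>. norm (transposed_symbol 2 \<sigma> (x, \<zeta>, \<eta>) * hh \<zeta>) \<le> CA * pweight \<zeta> * (1 + norm \<eta>) ^ KA"
    using inner_integral_bound[OF sA hh] by blast
  obtain CQ KQ where CQ: "0 \<le> CQ" "\<And>x \<xi> \<eta>. norm (Q (x, \<xi>, \<eta>)) \<le> CQ * ((1 + norm \<xi>) ^ KQ * (1 + norm \<eta>) ^ KQ)"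
    using is_symbol_growth[OF q] by blast
  \<comment> \<open>Of these powers of the weight, \<open>KQ\<close> offset the growth of
    \<open>Q\<close> in \<xi> and the remaining one is integrable.\<close>
  obtain CW where CW: "0 \<le> CW" "\<And>p \<theta>. norm (osc_inner reg_weight (\<lambda>q. f (- fst q)) p \<theta>) \<le> CW * pweight \<theta> ^ (KQ + 1)"
    using osc_inner_rapid[OF decay_reg_weight is_symbol_fst[OF f], of "KQ + 1"] by blast
  obtain CH where CH: "0 \<le> CH" "\<And>p \<theta>. norm (osc_inner reg_weight Q p \<theta>) \<le> CH * base_weight p powr (\<bar>a\<bar> + 2 * CARD('n)) * pweight \<theta>"
    using osc_inner_bound[OF par decay_reg_weight q] by blast
  obtain KH :: nat where KH: "\<bar>\<bar>a\<bar> + 2 * CARD('n)\<bar> \<le> real KH" using real_arch_simple by blast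
  \<comment> \<open>A polynomial majorant in \<zeta> for the bound on the inner integral, which no
    longer involves the order \<open>a\<close>; \<eta> is fixed.\<close>
  define L where "L = (\<lambda>\<zeta> :: real ^ 'n. CH * ((1 + norm \<zeta>) ^ KH * (1 + norm \<eta>) ^ KH))"
  have L0: "0 \<le> L \<zeta>" for \<zeta> using CH(1) by (simp add: L_def)
  have HL: "norm (osc_inner reg_weight Q (y, \<zeta>, \<eta>) \<theta>) \<le> L \<zeta> * pweight \<theta>" for y \<zeta> \<theta>
  proof -
    have "CH * base_weight (y, \<zeta>, \<eta>) powr (\<bar>a\<bar> + 2 * CARD('n)) \<le> L \<zeta>"
      unfolding L_def base_weight_def using japanese_powr_le[OF KH] CH(1) by (intro mult_left_mono) simp
    then show ?thesis by (intro order_trans[OF CH(2)] mult_right_mono) auto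
  qed
  define E where "E = (\<lambda>y \<zeta>. f y * iexp (y \<bullet> (\<zeta> + \<eta>)))"
  have Eb: "norm (E y \<zeta>) \<le> Cf * pweight y" for y \<zeta> using Cf(2)[of y] by (simp add: E_def norm_mult)
  define J where "J = (\<lambda>\<zeta> \<theta>. LINT y|lborel. E y \<zeta> * osc_inner reg_weight Q (y, \<zeta>, \<eta>) \<theta>)"
  have Jm: "(\<lambda>q. J (fst q) (snd q)) \<in> borel_measurable borel"
  proof -
    have "(\<lambda>r :: ((real ^ 'n) \<times> (real ^ 'n)) \<times> (real ^ 'n). E (snd r) (fst (fst r)) * osc_inner reg_weight Q (snd r, fst (fst r), \<eta>) (snd (fst r))) \<in> borel_measurable borel"
      unfolding E_def
      by (intro borel_measurable_times osc_inner_measurable[OF decay_reg_weight q] borel_measurable_continuous_onI continuous_intros continuous_on_comp_UNIV[OF cf])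
    from borel_measurable_integral_snd[OF this] show ?thesis by (simp add: J_def)
  qed
  let ?I = "integral\<^sup>L lborel (pweight :: real ^ 'n \<Rightarrow> real)"
  have Jb: "norm (J \<zeta> \<theta>) \<le> (Cf * ?I) * L \<zeta> * pweight \<theta>" for \<zeta> \<theta>
  proof -
    have "norm (J \<zeta> \<theta>) \<le> (Cf * (L \<zeta> * pweight \<theta>)) * ?I"
      unfolding J_def
    proof (rule norm_integral_pweight_le)
      fix y
      have "norm (E y \<zeta> * osc_inner reg_weight Q (y, \<zeta>, \<eta>) \<theta>) \<le> (Cf * pweight y) * (L \<zeta> * pweight \<theta>)"
        unfolding norm_mult using Eb HL Cf(1) by (intro mult_mono) auto
      then show "norm (E y \<zeta> * osc_inner reg_weight Q (y, \<zeta>, \<eta>) \<theta>) \<le> Cf * (L \<zeta> * pweight \<theta>) * pweight y" by (simp add: ac_simps)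
    qed
    then show ?thesis by (simp add: ac_simps)
  qed

  have S1: "frozen_form (\<lambda>q. ?c * transposed_symbol 2 \<sigma> q) \<eta> hh f = ?c * (LINT y|lborel. LINT \<zeta>|lborel. hh \<zeta> * (E y \<zeta> * transposed_symbol 2 \<sigma> (y, \<zeta>, \<eta>)))"
  proof -
    have "f y * iexp (y \<bullet> \<eta>) * (LINT \<zeta>|lborel. ?c * transposed_symbol 2 \<sigma> (y, \<zeta>, \<eta>) * hh \<zeta> * iexp (y \<bullet> \<zeta>))
        = ?c * (LINT \<zeta>|lborel. hh \<zeta> * (E y \<zeta> * transposed_symbol 2 \<sigma> (y, \<zeta>, \<eta>)))" for y
    proof -
      have "f y * iexp (y \<bullet> \<eta>) * (LINT \<zeta>|lborel. ?c * transposed_symbol 2 \<sigma> (y, \<zeta>, \<eta>) * hh \<zeta> * iexp (y \<bullet> \<zeta>))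
          = (LINT \<zeta>|lborel. f y * iexp (y \<bullet> \<eta>) * (?c * transposed_symbol 2 \<sigma> (y, \<zeta>, \<eta>) * hh \<zeta> * iexp (y \<bullet> \<zeta>)))"
        by (rule integral_mult_right_zero[symmetric])
      also have "\<dots> = (LINT \<zeta>|lborel. ?c * (hh \<zeta> * (E y \<zeta> * transposed_symbol 2 \<sigma> (y, \<zeta>, \<eta>))))"
        by (intro Bochner_Integration.integral_cong refl) (simp add: E_def inner_add_right distrib_left exp_add)
      finally show ?thesis by (simp only: integral_mult_right_zero)
    qed
    then show ?thesis unfolding frozen_form_def by (simp only: integral_mult_right_zero)
  qed
  have S2: "(LINT y|lborel. LINT \<zeta>|lborel. hh \<zeta> * (E y \<zeta> * transposed_symbol 2 \<sigma> (y, \<zeta>, \<eta>))) = (LINT \<zeta>|lborel. LINT y|lborel. hh \<zeta> * (E y \<zeta> * transposed_symbol 2 \<sigma> (y, \<zeta>, \<eta>)))"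
  proof (rule dominated_swap_pweight(1)[where C="Cf * (CA * (1 + norm \<eta>) ^ KA)"])
    show "(\<lambda>q. hh (snd q) * (E (fst q) (snd q) * transposed_symbol 2 \<sigma> (fst q, snd q, \<eta>))) \<in> borel_measurable borel"
      unfolding E_def by (intro borel_measurable_times mh borel_measurable_continuous_onI continuous_intros
          continuous_on_comp_UNIV[OF cf] continuous_on_comp_UNIV[OF cA])
    show "norm (hh \<zeta> * (E y \<zeta> * transposed_symbol 2 \<sigma> (y, \<zeta>, \<eta>))) \<le> Cf * (CA * (1 + norm \<eta>) ^ KA) * (pweight y * pweight \<zeta>)" for y \<zeta>
    proof -
      have "norm (hh \<zeta> * (E y \<zeta> * transposed_symbol 2 \<sigma> (y, \<zeta>, \<eta>))) = norm (E y \<zeta>) * norm (transposed_symbol 2 \<sigma> (y, \<zeta>, \<eta>) * hh \<zeta>)"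
        by (simp add: norm_mult)
      also have "\<dots> \<le> (Cf * pweight y) * (CA * pweight \<zeta> * (1 + norm \<eta>) ^ KA)"
        using Cf(1) by (intro mult_mono Eb CA) auto
      finally show ?thesis by (simp add: ac_simps)
    qed
  qed
  have S3: "(LINT y|lborel. hh \<zeta> * (E y \<zeta> * transposed_symbol 2 \<sigma> (y, \<zeta>, \<eta>))) = (LINT \<xi>|lborel. hh \<zeta> * J \<zeta> (\<zeta> + \<eta> + \<xi>))" for \<zeta>
  proof -
    have "(LINT y|lborel. E y \<zeta> * transposed_symbol 2 \<sigma> (y, \<zeta>, \<eta>)) = (LINT y|lborel. LINT \<theta>|lborel. E y \<zeta> * osc_inner reg_weight Q (y, \<zeta>, \<eta>) \<theta>)"
      unfolding transposed_symbol_2 Q_def by (simp only: integral_mult_right_zero)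
    also have "\<dots> = (LINT \<theta>|lborel. J \<zeta> \<theta>)"
      unfolding J_def
    proof (rule dominated_swap_pweight(1)[where C="Cf * L \<zeta>"])
      show "(\<lambda>q. E (fst q) \<zeta> * osc_inner reg_weight Q (fst q, \<zeta>, \<eta>) (snd q)) \<in> borel_measurable borel"
        unfolding E_def
        by (intro borel_measurable_times osc_inner_measurable[OF decay_reg_weight q] borel_measurable_continuous_onI continuous_intros continuous_on_comp_UNIV[OF cf])
      show "norm (E y \<zeta> * osc_inner reg_weight Q (y, \<zeta>, \<eta>) \<theta>) \<le> Cf * L \<zeta> * (pweight y * pweight \<theta>)" for y \<theta>
      proof -
        have "norm (E y \<zeta> * osc_inner reg_weight Q (y, \<zeta>, \<eta>) \<theta>) \<le> (Cf * pweight y) * (L \<zeta> * pweight \<theta>)"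
          unfolding norm_mult using Cf(1) by (intro mult_mono Eb HL) auto
        then show ?thesis by (simp add: ac_simps)
      qed
    qed
    \<comment> \<open>Back from \<theta> to the original frequency \<xi> = \<theta> - \<zeta> -
      \<eta>, at which the amplitude becomes independent of \<zeta>.\<close>
    also have "\<dots> = (LINT \<xi>|lborel. J \<zeta> (\<zeta> + \<eta> + \<xi>))"
    proof -
      have "J \<zeta> \<in> borel_measurable borel"
        using borel_measurable_comp_cont[OF Jm, of "\<lambda>\<theta>. (\<zeta>, \<theta>)"] by (simp add: continuous_on_Pair continuous_on_const continuous_on_id)
      from lborel_translate(1)[OF this, of "\<zeta> + \<eta>"] show ?thesis by simp
    qed
    finally show ?thesis by (simp only: integral_mult_right_zero)
  qed
  have S4: "(LINT \<zeta>|lborel. LINT \<xi>|lborel. hh \<zeta> * J \<zeta> (\<zeta> + \<eta> + \<xi>)) = (LINT \<xi>|lborel. LINT \<zeta>|lborel. hh \<zeta> * J \<zeta> (\<zeta> + \<eta> + \<xi>))"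
  proof -
    \<comment> \<open>\<open>KH\<close> powers beat the growth of \<open>L\<close>; the other
      \<open>2 * CARD('n)\<close> pay for separating \<xi> from \<zeta> in the shifted
      weight.\<close>
    obtain D where D: "0 \<le> D" "\<And>x. norm (hh x) * (1 + norm x) ^ (KH + 2 * CARD('n)) \<le> D * pweight x" using rapid_growth[OF hh] by blast
    define M where "M = Cf * ?I * CH * (1 + norm \<eta>) ^ KH * (2 ^ CARD('n) * (1 + norm \<eta>) ^ (2 * CARD('n)))"
    have M0: "0 \<le> M" using Cf(1) CH(1) integral_pweight_nonneg[where 'n='n] by (simp add: M_def)
    show ?thesis
    proof (rule dominated_swap_pweight(1)[where C="M * D"])
      have "(\<lambda>q. J (fst q) (fst q + \<eta> + snd q)) \<in> borel_measurable borel"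
        using borel_measurable_comp_cont[OF Jm, of "\<lambda>q. (fst q, fst q + \<eta> + snd q)"] by (simp add: continuous_intros)
      then show "(\<lambda>q. hh (fst q) * J (fst q) (fst q + \<eta> + snd q)) \<in> borel_measurable borel"
        by (intro borel_measurable_times mh) (auto intro!: continuous_intros)
      fix \<zeta> \<xi> :: "real ^ 'n"
      have "pweight (\<zeta> + \<eta> + \<xi>) \<le> 2 ^ CARD('n) * (1 + norm (\<zeta> + \<eta>)) ^ (2 * CARD('n)) * pweight \<xi>"
        using pweight_shift[of \<xi> "\<zeta> + \<eta>"] by (simp add: ac_simps)
      also have "\<dots> \<le> 2 ^ CARD('n) * ((1 + norm \<zeta>) * (1 + norm \<eta>)) ^ (2 * CARD('n)) * pweight \<xi>"
      proof (intro mult_right_mono mult_left_mono power_mono)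
        have "norm (\<zeta> + \<eta>) + 0 \<le> (norm \<zeta> + norm \<eta>) + norm \<zeta> * norm \<eta>"
          by (intro add_mono norm_triangle_ineq mult_nonneg_nonneg norm_ge_zero)
        then show "1 + norm (\<zeta> + \<eta>) \<le> (1 + norm \<zeta>) * (1 + norm \<eta>)" by (simp add: algebra_simps)
      qed simp_all
      finally have P: "pweight (\<zeta> + \<eta> + \<xi>) \<le> 2 ^ CARD('n) * ((1 + norm \<zeta>) * (1 + norm \<eta>)) ^ (2 * CARD('n)) * pweight \<xi>" .
      have "norm (hh \<zeta> * J \<zeta> (\<zeta> + \<eta> + \<xi>)) \<le> norm (hh \<zeta>) * ((Cf * ?I) * L \<zeta> * pweight (\<zeta> + \<eta> + \<xi>))"
        unfolding norm_mult by (intro mult_left_mono Jb) auto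
      also have "\<dots> \<le> norm (hh \<zeta>) * ((Cf * ?I) * L \<zeta> * (2 ^ CARD('n) * ((1 + norm \<zeta>) * (1 + norm \<eta>)) ^ (2 * CARD('n)) * pweight \<xi>))"
        using Cf(1) L0 integral_pweight_nonneg[where 'n='n] by (intro mult_left_mono P mult_nonneg_nonneg) auto
      also have "\<dots> = M * (norm (hh \<zeta>) * (1 + norm \<zeta>) ^ (KH + 2 * CARD('n))) * pweight \<xi>"
        unfolding M_def L_def by (simp only: power_add power_mult_distrib ac_simps)
      also have "\<dots> \<le> M * (D * pweight \<zeta>) * pweight \<xi>" using M0 by (intro mult_right_mono mult_left_mono D) auto
      finally show "norm (hh \<zeta> * J \<zeta> (\<zeta> + \<eta> + \<xi>)) \<le> M * D * (pweight \<zeta> * pweight \<xi>)" by (simp add: ac_simps)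
    qed
  qed
  have S5: "(LINT \<zeta>|lborel. hh \<zeta> * J \<zeta> (\<zeta> + \<eta> + \<xi>)) = (LINT x|lborel. h x * iexp (x \<bullet> \<eta>) * (Q (x, \<xi>, \<eta>) * reg_transform f x \<xi>))" for \<xi>
  proof -
    define B where "B = CQ * ((1 + norm \<xi>) ^ KQ * (1 + norm \<eta>) ^ KQ)"
    have B: "0 \<le> B" "norm (Q (x, \<xi>, \<eta>)) \<le> B" for x using CQ by (simp_all add: B_def)
    obtain D where D: "0 \<le> D" "\<And>x. norm (hh x) * (1 + norm x) ^ 0 \<le> D * pweight x" using rapid_growth[OF hh] by blast
    have "(LINT \<zeta>|lborel. hh \<zeta> * J \<zeta> (\<zeta> + \<eta> + \<xi>)) = (LINT \<zeta>|lborel. LINT x|lborel. hh \<zeta> * (iexp (x \<bullet> (\<zeta> + \<eta>)) * Q (x, \<xi>, \<eta>) * reg_transform f x \<xi>))"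
      unfolding J_def E_def outer_integral_regularised[OF q f] by (simp only: integral_mult_right_zero)
    also have "\<dots> = (LINT x|lborel. LINT \<zeta>|lborel. hh \<zeta> * (iexp (x \<bullet> (\<zeta> + \<eta>)) * Q (x, \<xi>, \<eta>) * reg_transform f x \<xi>))"
    proof (rule dominated_swap_pweight(1)[where C="D * (B * CV)"])
      have "(\<lambda>q :: (real ^ 'n) \<times> (real ^ 'n). reg_transform f (snd q) \<xi>) \<in> borel_measurable borel"
        using borel_measurable_comp_cont[OF mV, of "\<lambda>q :: (real ^ 'n) \<times> (real ^ 'n). (snd q, \<xi>)"] by (simp add: continuous_intros)
      then show "(\<lambda>q. hh (fst q) * (iexp (snd q \<bullet> (fst q + \<eta>)) * Q (snd q, \<xi>, \<eta>) * reg_transform f (snd q) \<xi>)) \<in> borel_measurable borel"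
        by (intro borel_measurable_times mh) (auto intro!: borel_measurable_continuous_onI continuous_intros continuous_on_comp_UNIV[OF cq])
      fix \<zeta> x
      have "norm (hh \<zeta> * (iexp (x \<bullet> (\<zeta> + \<eta>)) * Q (x, \<xi>, \<eta>) * reg_transform f x \<xi>)) = norm (hh \<zeta>) * (norm (Q (x, \<xi>, \<eta>)) * norm (reg_transform f x \<xi>))"
        by (simp add: norm_mult)
      also have "\<dots> \<le> (D * pweight \<zeta>) * (B * (CV * pweight x))"
        using D B CV by (intro mult_mono mult_nonneg_nonneg) auto
      finally show "norm (hh \<zeta> * (iexp (x \<bullet> (\<zeta> + \<eta>)) * Q (x, \<xi>, \<eta>) * reg_transform f x \<xi>)) \<le> D * (B * CV) * (pweight \<zeta> * pweight x)"
        by (simp add: ac_simps)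
    qed
    also have "\<dots> = (LINT x|lborel. h x * iexp (x \<bullet> \<eta>) * (Q (x, \<xi>, \<eta>) * reg_transform f x \<xi>))"
    proof (rule Bochner_Integration.integral_cong[OF refl])
      fix x
      have "(LINT \<zeta>|lborel. hh \<zeta> * (iexp (x \<bullet> (\<zeta> + \<eta>)) * Q (x, \<xi>, \<eta>) * reg_transform f x \<xi>))
          = (LINT \<zeta>|lborel. hh \<zeta> * iexp (x \<bullet> \<zeta>) * (iexp (x \<bullet> \<eta>) * (Q (x, \<xi>, \<eta>) * reg_transform f x \<xi>)))"
        by (intro Bochner_Integration.integral_cong refl) (simp add: inner_add_right distrib_left exp_add)
      also have "\<dots> = (LINT \<zeta>|lborel. hh \<zeta> * iexp (x \<bullet> \<zeta>)) * (iexp (x \<bullet> \<eta>) * (Q (x, \<xi>, \<eta>) * reg_transform f x \<xi>))"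
        by (rule integral_mult_left_zero)
      \<comment> \<open>The only place where the transform of \<open>h\<close> is converted back
        into \<open>h\<close>.\<close>
      also have "(LINT \<zeta>|lborel. hh \<zeta> * iexp (x \<bullet> \<zeta>)) = h x" unfolding hh_def by (rule fourier_inversion[OF h])
      finally show "(LINT \<zeta>|lborel. hh \<zeta> * (iexp (x \<bullet> (\<zeta> + \<eta>)) * Q (x, \<xi>, \<eta>) * reg_transform f x \<xi>)) = h x * iexp (x \<bullet> \<eta>) * (Q (x, \<xi>, \<eta>) * reg_transform f x \<xi>)"
        by simp
    qed
    finally show ?thesis .
  qed
  have S6: "(LINT \<xi>|lborel. LINT x|lborel. h x * iexp (x \<bullet> \<eta>) * (Q (x, \<xi>, \<eta>) * reg_transform f x \<xi>)) = (LINT x|lborel. LINT \<xi>|lborel. h x * iexp (x \<bullet> \<eta>) * (Q (x, \<xi>, \<eta>) * reg_transform f x \<xi>))"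
  proof (rule dominated_swap_pweight(1)[where C="Ch * (CQ * (1 + norm \<eta>) ^ KQ * CW * 2 ^ KQ)"])
    have "(\<lambda>q. reg_transform f (snd q) (fst q)) \<in> borel_measurable borel"
      using borel_measurable_comp_cont[OF mV, of "\<lambda>q. (snd q, fst q)"] by (simp add: continuous_intros)
    then show "(\<lambda>q. h (snd q) * iexp (snd q \<bullet> \<eta>) * (Q (snd q, fst q, \<eta>) * reg_transform f (snd q) (fst q))) \<in> borel_measurable borel"
      by (intro borel_measurable_times) (auto intro!: borel_measurable_continuous_onI continuous_intros continuous_on_comp_UNIV[OF cq] continuous_on_comp_UNIV[OF ch])
    fix \<xi> x
    have "norm (Q (x, \<xi>, \<eta>)) * norm (reg_transform f x \<xi>) \<le> (CQ * ((1 + norm \<xi>) ^ KQ * (1 + norm \<eta>) ^ KQ)) * (CW * pweight \<xi> ^ (KQ + 1))"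
      unfolding reg_transform_def using CQ(1) by (intro mult_mono CQ CW) auto
    also have "\<dots> = CQ * (1 + norm \<eta>) ^ KQ * CW * pweight \<xi> * (pweight \<xi> ^ KQ * (1 + norm \<xi>) ^ KQ)" by simp
    also have "\<dots> \<le> CQ * (1 + norm \<eta>) ^ KQ * CW * pweight \<xi> * 2 ^ KQ"
      using CQ(1) CW(1) by (intro mult_left_mono pweight_growth) auto
    finally have 1: "norm (Q (x, \<xi>, \<eta>)) * norm (reg_transform f x \<xi>) \<le> CQ * (1 + norm \<eta>) ^ KQ * CW * pweight \<xi> * 2 ^ KQ" .
    have "norm (h x * iexp (x \<bullet> \<eta>) * (Q (x, \<xi>, \<eta>) * reg_transform f x \<xi>)) = norm (h x) * (norm (Q (x, \<xi>, \<eta>)) * norm (reg_transform f x \<xi>))"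
      by (simp add: norm_mult)
    also have "\<dots> \<le> (Ch * pweight x) * (CQ * (1 + norm \<eta>) ^ KQ * CW * pweight \<xi> * 2 ^ KQ)"
      using Ch by (intro mult_mono 1) auto
    finally show "norm (h x * iexp (x \<bullet> \<eta>) * (Q (x, \<xi>, \<eta>) * reg_transform f x \<xi>)) \<le> Ch * (CQ * (1 + norm \<eta>) ^ KQ * CW * 2 ^ KQ) * (pweight \<xi> * pweight x)"
      by (simp add: ac_simps)
  qed
  have S7: "frozen_form \<sigma> \<eta> (fourier f) h = ?c * (LINT x|lborel. LINT \<xi>|lborel. h x * iexp (x \<bullet> \<eta>) * (Q (x, \<xi>, \<eta>) * reg_transform f x \<xi>))"
  proof -
    have "h x * iexp (x \<bullet> \<eta>) * (LINT \<xi>|lborel. \<sigma> (x, \<xi>, \<eta>) * fourier f \<xi> * iexp (x \<bullet> \<xi>))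
        = ?c * (LINT \<xi>|lborel. h x * iexp (x \<bullet> \<eta>) * (Q (x, \<xi>, \<eta>) * reg_transform f x \<xi>))" for x
      unfolding inner_integral_regularised[OF par s f] Q_def integral_mult_right_zero by simp
    then show ?thesis unfolding frozen_form_def by (simp only: integral_mult_right_zero)
  qed
  show ?thesis unfolding hh_def[symmetric] S1 S2 S3 S4 S5 S6 S7 ..
qed

section \<open>Exchange of the two frequencies and the conclusion\<close>

definition swap_freq :: "('n::finite) bisymbol \<Rightarrow> 'n bisymbol" where
  "swap_freq \<sigma> = (\<lambda>q. \<sigma> (fst q, snd (snd q), fst (snd q)))"

lemma swap_freq_swap_freq [simp]: "swap_freq (swap_freq \<sigma>) = \<sigma>" by (simp add: swap_freq_def)

lemma is_symbol_swap_freq: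
  fixes \<sigma> :: "('n::finite) bisymbol"
  assumes "is_symbol \<rho> \<delta> a \<sigma>" shows "is_symbol \<rho> \<delta> a (swap_freq \<sigma>)"
proof -
  let ?L = "\<lambda>q :: 'n point. (fst q, snd (snd q), fst (snd q))"
  have "weighted_smooth symbol_weight (symbol_order \<rho> \<delta>) a (\<lambda>q. \<sigma> (0 + ?L q))"
  proof (rule weighted_smooth_affine[where A=UNIV])
    show "linear ?L" by (rule linearI) auto
    show "\<exists>K\<ge>0. \<forall>q. symbol_weight a (0 + ?L q) \<le> K * symbol_weight a q" for a
      by (intro exI[of _ 1]) (simp add: symbol_weight_def japanese_def add.commute add.left_commute)
    show "?L b = 0 \<or> (\<exists>t b'. b' \<in> Basis \<and> ?L b = t *\<^sub>R b' \<and> symbol_order \<rho> \<delta> b' = symbol_order \<rho> \<delta> b)" if "b \<in> Basis" for b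
      using that by (intro disjI2 exI[of _ 1] exI[of _ "?L b"]) (auto simp: Basis_triple unit_x_def unit_xi_def unit_eta_def symbol_order_def)
    show "weighted_smooth symbol_weight (symbol_order \<rho> \<delta>) a \<sigma>" using assms by (simp only: is_symbol_def)
  qed (simp_all add: symbol_weight_nonneg)
  then show ?thesis by (simp add: is_symbol_def swap_freq_def)
qed

text \<open>The operator is an iterated integral in a fixed order, so exchanging the arguments also
  needs the interchange of the integrals.\<close>

lemma bilinear_psido_swap_freq:
  assumes s: "is_symbol \<rho> \<delta> a \<sigma>" and f: "decay 1 f" and g: "decay 1 g"
  shows "bilinear_psido \<sigma> f g = bilinear_psido (swap_freq \<sigma>) g f"
proof
  fix x
  have "bilinear_psido \<sigma> f g x = (LINT \<xi>|lborel. LINT \<eta>|lborel.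
        \<sigma> (x, \<xi>, \<eta>) * fourier f \<xi> * fourier g \<eta> * iexp (x \<bullet> (\<xi> + \<eta>)))"
    by (rule pairing_eq_frozen_form(3)[OF s f g rapid_fourier[OF f]])
  also have "\<dots> = bilinear_psido (swap_freq \<sigma>) g f x"
    unfolding bilinear_psido_def
    by (intro Bochner_Integration.integral_cong refl) (simp add: swap_freq_def ac_simps)
  finally show "bilinear_psido \<sigma> f g x = bilinear_psido (swap_freq \<sigma>) g f x" .
qed

text \<open>Both pairings are integrals over \<eta> against the transform of the same
  \<open>g\<close>, and their frozen forms agree for every \<eta>.\<close>

lemma transpose1:
  fixes \<sigma> :: "('n::finite) bisymbol"
  assumes par: "0 \<le> \<delta>" "\<delta> \<le> \<rho>" "\<rho> \<le> 1" "\<delta> < 1" and s: "is_symbol \<rho> \<delta> m \<sigma>"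
  obtains \<sigma>' where "is_symbol \<rho> \<delta> m \<sigma>'" "is_transpose1 (bilinear_psido \<sigma>) (bilinear_psido \<sigma>')"
proof
  define \<sigma>' where "\<sigma>' = (\<lambda>q. of_real (1 / (2 * pi) ^ CARD('n)) * transposed_symbol 2 \<sigma> q)"
  show s': "is_symbol \<rho> \<delta> m \<sigma>'" unfolding \<sigma>'_def by (intro is_symbol_cmult is_symbol_transposed_symbol[OF par _ s]) simp
  show "is_transpose1 (bilinear_psido \<sigma>) (bilinear_psido \<sigma>')"
    unfolding is_transpose1_def
  proof (intro ballI conjI)
    fix f g h :: "real ^ 'n \<Rightarrow> complex"
    assume "f \<in> schwartz" "g \<in> schwartz" "h \<in> schwartz"
    then have d: "decay N f" "decay N g" "decay N h" for N by (simp_all add: schwartz_decay)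
    show "pairable (bilinear_psido \<sigma> f g) h" by (rule pairing_eq_frozen_form(1)[OF s d(1,2) rapid_if_decay[OF d(3)]])
    show "pairable (bilinear_psido \<sigma>' h g) f" by (rule pairing_eq_frozen_form(1)[OF s' d(3,2) rapid_if_decay[OF d(1)]])
    show "pairing (bilinear_psido \<sigma> f g) h = pairing (bilinear_psido \<sigma>' h g) f"
      unfolding pairing_eq_frozen_form(2)[OF s d(1,2) rapid_if_decay[OF d(3)]]
        pairing_eq_frozen_form(2)[OF s' d(3,2) rapid_if_decay[OF d(1)]]
      unfolding \<sigma>'_def frozen_form_transpose[OF par s d(1,3)] ..
  qed
qed

theorem theorem1:
  fixes m \<rho> \<delta> :: real and \<sigma> :: "('n::finite) bisymbol"
  assumes "0 \<le> \<delta>" "\<delta> \<le> \<rho>" "\<rho> \<le> 1" "\<delta> < 1"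
    and "\<sigma> \<in> BS m \<rho> \<delta>"
  shows "(\<exists>\<sigma>1 \<in> BS m \<rho> \<delta>. is_transpose1 (bilinear_psido \<sigma>) (bilinear_psido \<sigma>1)) \<and>
         (\<exists>\<sigma>2 \<in> BS m \<rho> \<delta>. is_transpose2 (bilinear_psido \<sigma>) (bilinear_psido \<sigma>2))"
proof
  have s: "is_symbol \<rho> \<delta> m \<sigma>" by (rule BS_imp_is_symbol[OF assms(5)])
  show "\<exists>\<sigma>1 \<in> BS m \<rho> \<delta>. is_transpose1 (bilinear_psido \<sigma>) (bilinear_psido \<sigma>1)"
    by (rule transpose1[OF assms(1-4) s]) (use is_symbol_imp_BS in blast)
  \<comment> \<open>The second transpose in (f, g) is the first transpose in (g, f); the result
    \<tau> acts on (h, f) and has to be swapped once more to act on (f, h).\<close>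
  obtain \<tau> where t: "is_symbol \<rho> \<delta> m \<tau>" "is_transpose1 (bilinear_psido (swap_freq \<sigma>)) (bilinear_psido \<tau>)"
    by (rule transpose1[OF assms(1-4) is_symbol_swap_freq[OF s]])
  have "is_transpose2 (bilinear_psido \<sigma>) (bilinear_psido (swap_freq \<tau>))"
    unfolding is_transpose2_def
  proof (intro ballI)
    fix f g h :: "real ^ 'n \<Rightarrow> complex"
    assume S: "f \<in> schwartz" "g \<in> schwartz" "h \<in> schwartz"
    then have d: "decay N f" "decay N g" "decay N h" for N by (simp_all add: schwartz_decay)
    have "bilinear_psido \<sigma> f g = bilinear_psido (swap_freq \<sigma>) g f"
      by (rule bilinear_psido_swap_freq[OF s d(1,2)])
    moreover have "bilinear_psido (swap_freq \<tau>) f h = bilinear_psido \<tau> h f"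
      using bilinear_psido_swap_freq[OF is_symbol_swap_freq[OF t(1)] d(1,3)] by simp
    ultimately show "pairable (bilinear_psido \<sigma> f g) h \<and> pairable (bilinear_psido (swap_freq \<tau>) f h) g \<and>
        pairing (bilinear_psido \<sigma> f g) h = pairing (bilinear_psido (swap_freq \<tau>) f h) g"
      using t(2) S unfolding is_transpose1_def by simp
  qed
  then show "\<exists>\<sigma>2 \<in> BS m \<rho> \<delta>. is_transpose2 (bilinear_psido \<sigma>) (bilinear_psido \<sigma>2)"
    using is_symbol_imp_BS[OF is_symbol_swap_freq[OF t(1)]] by blast
qed

end
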